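(* Let $(R,\mathfrak{m},k)$ be a local ring with $\mathfrak{m}^3=0$, and let $E:=E_R(k)$. Let $M$ be a nonzero $R$-module such that $\mathfrak{m}^2M=0$ and $\mu(M)\le\lambda(\mathfrak{m}M)$. If $\operatorname{Ext}_R^i(E,M)=0$ for all $i\gg 0$, then $R$ is Gorenstein.
   Context: All rings are commutative Noetherian local rings and all modules are finitely generated. $R$ has maximal ideal $\mathfrak{m}$ and residue field $k=R/\mathfrak{m}$. $E_R(k)$ is the injective hull of $k$ over $R$, $\mu(-)$ is the minimal number of generators and $\lambda(-)$ is length. *)

theory Defs
  imports "HOL-Algebra.Module" "HOL-Algebra.Ideal_Product" "HOL-Algebra.Ring_Divisibility"
    "HOL-Library.Extended_Nat"
begin

section \<open>Local rings\<close>

locale noetherian_local_ring = cring R + noetherian_ring R for R (structure) and \<mm> +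
  assumes maximalideal: "maximalideal \<mm> R"
    and unique_maximalideal: "maximalideal J R \<Longrightarrow> J = \<mm>"


section \<open>Modules\<close>

text \<open>
  A module is a record of HOL-Algebra whose ring multiplication and unit play no role
  (the locale \<^locale>\<open>module\<close> does not constrain them); below they are left undefined.
\<close>

definition regular_module :: "('a, 'r) ring_scheme \<Rightarrow> ('a, 'a) module" where
  "regular_module R =
     \<lparr>carrier = carrier R, monoid.mult = undefined, one = undefined,
      ring.zero = \<zero>\<^bsub>R\<^esub>, add = add R, smult = (\<lambda>a x. a \<otimes>\<^bsub>R\<^esub> x)\<rparr>"

definition quotient_module :: "('a, 'm, 'z) module_scheme \<Rightarrow> 'm set \<Rightarrow> ('a, 'm set) module" where
  "quotient_module M N =
     \<lparr>carrier = a_rcosets\<^bsub>M\<^esub> N, monoid.mult = undefined, one = undefined,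
      ring.zero = N, add = set_add M,
      smult = (\<lambda>a X. \<Union>x\<in>X. N +>\<^bsub>M\<^esub> (a \<odot>\<^bsub>M\<^esub> x))\<rparr>"

definition residue_module :: "('a, 'r) ring_scheme \<Rightarrow> 'a set \<Rightarrow> ('a, 'a set) module" where
  "residue_module R \<mm> = quotient_module (regular_module R) \<mm>"

definition zero_module :: "('a, 'm, 'z) module_scheme \<Rightarrow> bool" where
  "zero_module M \<longleftrightarrow> carrier M = {\<zero>\<^bsub>M\<^esub>}"

definition span_module :: "('a, 'r) ring_scheme \<Rightarrow> ('a, 'm, 'z) module_scheme \<Rightarrow> 'm set \<Rightarrow> 'm set" where
  "span_module R M A = \<Inter>{N. submodule N R M \<and> A \<subseteq> N}"

definition finitely_generated :: "('a, 'r) ring_scheme \<Rightarrow> ('a, 'm, 'z) module_scheme \<Rightarrow> bool" where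
  "finitely_generated R M \<longleftrightarrow>
     (\<exists>A. A \<subseteq> carrier M \<and> finite A \<and> span_module R M A = carrier M)"

text \<open>The number \<open>\<mu>(M)\<close>, meaningful for finitely generated \<open>M\<close>.\<close>

definition min_generators :: "('a, 'r) ring_scheme \<Rightarrow> ('a, 'm, 'z) module_scheme \<Rightarrow> nat" where
  "min_generators R M =
     (LEAST n. \<exists>A. A \<subseteq> carrier M \<and> finite A \<and> card A = n \<and> span_module R M A = carrier M)"

text \<open>The length \<open>\<lambda>(M)\<close>, as the supremum of the lengths of strict chains of submodules.\<close>

definition module_length :: "('a, 'r) ring_scheme \<Rightarrow> ('a, 'm, 'z) module_scheme \<Rightarrow> enat" where
  "module_length R M =
     Sup {enat n | n. \<exists>N :: nat \<Rightarrow> 'm set.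
            (\<forall>i\<le>n. submodule (N i) R M) \<and> (\<forall>i<n. N i \<subset> N (Suc i))}"

definition ideal_smult ::
    "('a, 'r) ring_scheme \<Rightarrow> 'a set \<Rightarrow> ('a, 'm, 'z) module_scheme \<Rightarrow> 'm set" where
  "ideal_smult R I M = span_module R M {a \<odot>\<^bsub>M\<^esub> x | a x. a \<in> I \<and> x \<in> carrier M}"

definition linear_maps ::
    "('a, 'r) ring_scheme \<Rightarrow> ('a, 'm, 'y) module_scheme \<Rightarrow> ('a, 'n, 'z) module_scheme
      \<Rightarrow> ('m \<Rightarrow> 'n) set" where
  "linear_maps R M N =
     {f. f \<in> carrier M \<rightarrow> carrier N \<and>
         (\<forall>x\<in>carrier M. \<forall>y\<in>carrier M. f (x \<oplus>\<^bsub>M\<^esub> y) = f x \<oplus>\<^bsub>N\<^esub> f y) \<and>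
         (\<forall>a\<in>carrier R. \<forall>x\<in>carrier M. f (a \<odot>\<^bsub>M\<^esub> x) = a \<odot>\<^bsub>N\<^esub> f x)}"

text \<open>
  The module of linear maps. Its elements are the linear maps that are
  \<open>undefined\<close> outside \<open>carrier M\<close>, so that equal maps are equal as HOL functions.
\<close>

definition Hom_module ::
    "('a, 'r) ring_scheme \<Rightarrow> ('a, 'm, 'y) module_scheme \<Rightarrow> ('a, 'n, 'z) module_scheme
      \<Rightarrow> ('a, 'm \<Rightarrow> 'n) module" where
  "Hom_module R M N =
     \<lparr>carrier = linear_maps R M N \<inter> extensional (carrier M), monoid.mult = undefined, one = undefined,
      ring.zero = (\<lambda>x\<in>carrier M. \<zero>\<^bsub>N\<^esub>), add = (\<lambda>f g. \<lambda>x\<in>carrier M. f x \<oplus>\<^bsub>N\<^esub> g x),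
      smult = (\<lambda>a f. \<lambda>x\<in>carrier M. a \<odot>\<^bsub>N\<^esub> f x)\<rparr>"

text \<open>The free module with basis \<open>X\<close>, as the finitely supported functions on \<open>X\<close>.\<close>

definition free_module :: "('a, 'r) ring_scheme \<Rightarrow> 'x set \<Rightarrow> ('a, 'x \<Rightarrow> 'a) module" where
  "free_module R X =
     \<lparr>carrier = {f. (\<forall>x. f x \<in> carrier R) \<and> (\<forall>x. x \<notin> X \<longrightarrow> f x = \<zero>\<^bsub>R\<^esub>) \<and> finite {x. f x \<noteq> \<zero>\<^bsub>R\<^esub>}},
      monoid.mult = undefined, one = undefined, ring.zero = (\<lambda>_. \<zero>\<^bsub>R\<^esub>),
      add = (\<lambda>f g x. f x \<oplus>\<^bsub>R\<^esub> g x), smult = (\<lambda>a f x. a \<otimes>\<^bsub>R\<^esub> f x)\<rparr>"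


section \<open>Injective modules, injective hulls and injective dimension\<close>

text \<open>
  HOL cannot quantify over all types in a definition, so the test modules \<open>B\<close> are those with
  elements in \<^typ>\<open>'a list\<close>, where \<^typ>\<open>'a\<close> is the type of the ring elements. This is no restriction:
  an isomorphic copy of \<open>R\<close> and its ideals is among them, so by Baer's criterion the
  extension property holds for all \<open>R\<close>-modules.
\<close>

definition injective_module :: "('a, 'r) ring_scheme \<Rightarrow> ('a, 'i, 'z) module_scheme \<Rightarrow> bool" where
  "injective_module R I \<longleftrightarrow> module R I \<and>
     (\<forall>(B :: ('a, 'a list) module) A f.
        module R B \<and> submodule A R B \<and> f \<in> linear_maps R (B\<lparr>carrier := A\<rparr>) I \<longrightarrow>
        (\<exists>g \<in> linear_maps R B I. \<forall>x\<in>A. g x = f x))"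

definition injective_hull ::
    "('a, 'r) ring_scheme \<Rightarrow> ('a, 'm, 'y) module_scheme \<Rightarrow> ('a, 'e, 'z) module_scheme \<Rightarrow> bool" where
  "injective_hull R K E \<longleftrightarrow> injective_module R E \<and>
     (\<exists>\<iota> \<in> linear_maps R K E. inj_on \<iota> (carrier K) \<and>
        (\<forall>N. submodule N R E \<and> N \<inter> \<iota> ` carrier K = {\<zero>\<^bsub>E\<^esub>} \<longrightarrow> N = {\<zero>\<^bsub>E\<^esub>}))"

definition injective_resolution ::
    "('a, 'r) ring_scheme \<Rightarrow> ('a, 'm, 'z) module_scheme \<Rightarrow>
     (nat \<Rightarrow> ('a, 'i) module) \<Rightarrow> (nat \<Rightarrow> 'i \<Rightarrow> 'i) \<Rightarrow> ('m \<Rightarrow> 'i) \<Rightarrow> bool" where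
  "injective_resolution R M I d \<eta> \<longleftrightarrow>
     (\<forall>n. injective_module R (I n)) \<and>
     \<eta> \<in> linear_maps R M (I 0) \<and> inj_on \<eta> (carrier M) \<and>
     (\<forall>n. d n \<in> linear_maps R (I n) (I (Suc n))) \<and>
     \<eta> ` carrier M = a_kernel (I 0) (I 1) (d 0) \<and>
     (\<forall>n. d n ` carrier (I n) = a_kernel (I (Suc n)) (I (Suc (Suc n))) (d (Suc n)))"

text \<open>
  A type large enough to contain the free resolutions and, over a noetherian ring, the minimal
  injective resolution of a module with elements in \<^typ>\<open>'m\<close>: all terms of these have cardinality
  at most the maximum of \<open>|R|\<close>, \<open>|M|\<close> and \<open>\<aleph>\<^sub>0\<close>.
\<close>

type_synonym ('a, 'm) resolution_index = "(nat \<times> 'a \<times> 'm) list"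

definition injective_dimension :: "('a, 'r) ring_scheme \<Rightarrow> ('a, 'm, 'z) module_scheme \<Rightarrow> enat" where
  "injective_dimension R M =
     Inf {enat n | n. \<exists>(I :: nat \<Rightarrow> ('a, ('a, 'm) resolution_index) module) d \<eta>.
            injective_resolution R M I d \<eta> \<and> (\<forall>i>n. zero_module (I i))}"

definition gorenstein :: "('a, 'r) ring_scheme \<Rightarrow> 'a set \<Rightarrow> bool" where
  "gorenstein R \<mm> \<longleftrightarrow>
     noetherian_local_ring R \<mm> \<and> injective_dimension R (regular_module R) < \<infinity>"


section \<open>Ext\<close>

text \<open>
  With \<open>F n\<close> the free module on \<open>X n\<close>, the maps \<open>d n : F (n+1) \<rightarrow> F n\<close> and \<open>\<epsilon> : F 0 \<rightarrow> N\<close> form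
  an exact sequence ending in \<open>F 0 \<rightarrow> N \<rightarrow> 0\<close>.
\<close>

definition free_resolution ::
    "('a, 'r) ring_scheme \<Rightarrow> ('a, 'm, 'z) module_scheme \<Rightarrow>
     (nat \<Rightarrow> 'x set) \<Rightarrow> (nat \<Rightarrow> ('x \<Rightarrow> 'a) \<Rightarrow> ('x \<Rightarrow> 'a)) \<Rightarrow> (('x \<Rightarrow> 'a) \<Rightarrow> 'm) \<Rightarrow> bool" where
  "free_resolution R N X d \<epsilon> \<longleftrightarrow>
     (let F = (\<lambda>n. free_module R (X n)) in
       \<epsilon> \<in> linear_maps R (F 0) N \<and> \<epsilon> ` carrier (F 0) = carrier N \<and>
       (\<forall>n. d n \<in> linear_maps R (F (Suc n)) (F n)) \<and>
       d 0 ` carrier (F 1) = a_kernel (F 0) N \<epsilon> \<and>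
       (\<forall>n. d (Suc n) ` carrier (F (Suc (Suc n))) = a_kernel (F (Suc n)) (F n) (d n)))"

text \<open>The cohomology modules of the complex \<open>Hom(P, M)\<close>, for a complex \<open>P\<close> with \<open>d n : P (n+1) \<rightarrow> P n\<close>.\<close>

definition cocycles ::
    "('a, 'r) ring_scheme \<Rightarrow> (nat \<Rightarrow> ('a, 'p) module) \<Rightarrow> (nat \<Rightarrow> 'p \<Rightarrow> 'p) \<Rightarrow>
     ('a, 'm, 'z) module_scheme \<Rightarrow> nat \<Rightarrow> ('p \<Rightarrow> 'm) set" where
  "cocycles R P d M n =
     {f \<in> carrier (Hom_module R (P n) M).
        compose (carrier (P (Suc n))) f (d n) = \<zero>\<^bsub>Hom_module R (P (Suc n)) M\<^esub>}"

primrec coboundaries ::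
    "('a, 'r) ring_scheme \<Rightarrow> (nat \<Rightarrow> ('a, 'p) module) \<Rightarrow> (nat \<Rightarrow> 'p \<Rightarrow> 'p) \<Rightarrow>
     ('a, 'm, 'z) module_scheme \<Rightarrow> nat \<Rightarrow> ('p \<Rightarrow> 'm) set" where
  "coboundaries R P d M 0 = {\<zero>\<^bsub>Hom_module R (P 0) M\<^esub>}"
| "coboundaries R P d M (Suc n) =
     (\<lambda>f. compose (carrier (P (Suc n))) f (d n)) ` carrier (Hom_module R (P n) M)"

definition Hom_cohomology ::
    "('a, 'r) ring_scheme \<Rightarrow> (nat \<Rightarrow> ('a, 'p) module) \<Rightarrow> (nat \<Rightarrow> 'p \<Rightarrow> 'p) \<Rightarrow>
     ('a, 'm, 'z) module_scheme \<Rightarrow> nat \<Rightarrow> ('a, ('p \<Rightarrow> 'm) set) module" where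
  "Hom_cohomology R P d M n =
     quotient_module ((Hom_module R (P n) M)\<lparr>carrier := cocycles R P d M n\<rparr>)
       (coboundaries R P d M n)"

text \<open>
  The module \<open>Ext\<^sup>n(N, M)\<close> over \<open>R\<close>, computed from a chosen free resolution of \<open>N\<close>; one exists by
  \<open>free_resolution_exists\<close> below.
\<close>

definition some_free_resolution ::
    "('a, 'r) ring_scheme \<Rightarrow> ('a, 'm, 'z) module_scheme \<Rightarrow>
     (nat \<Rightarrow> ('a, 'm) resolution_index set) \<times>
     (nat \<Rightarrow> (('a, 'm) resolution_index \<Rightarrow> 'a) \<Rightarrow> (('a, 'm) resolution_index \<Rightarrow> 'a))" where
  "some_free_resolution R N = (SOME (X, d). \<exists>\<epsilon>. free_resolution R N X d \<epsilon>)"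

definition Ext ::
    "('a, 'r) ring_scheme \<Rightarrow> nat \<Rightarrow> ('a, 'n, 'y) module_scheme \<Rightarrow> ('a, 'm, 'z) module_scheme \<Rightarrow>
     ('a, ((('a, 'n) resolution_index \<Rightarrow> 'a) \<Rightarrow> 'm) set) module" where
  "Ext R n N M =
     (case some_free_resolution R N of (X, d) \<Rightarrow>
        Hom_cohomology R (\<lambda>i. free_module R (X i)) d M n)"


subsection \<open>Existence of free resolutions\<close>

lemma free_module_is_module:
  assumes "cring R"
  shows "module R (free_module R X)"
proof -
  interpret cring R by fact
  have fin_add: "finite {x. f x \<oplus>\<^bsub>R\<^esub> g x \<noteq> \<zero>\<^bsub>R\<^esub>}"
    if "finite {x. f x \<noteq> \<zero>\<^bsub>R\<^esub>}" "finite {x. g x \<noteq> \<zero>\<^bsub>R\<^esub>}" for f g :: "'c \<Rightarrow> 'a"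
  proof (rule finite_subset)
    show "{x. f x \<oplus>\<^bsub>R\<^esub> g x \<noteq> \<zero>\<^bsub>R\<^esub>} \<subseteq> {x. f x \<noteq> \<zero>\<^bsub>R\<^esub>} \<union> {x. g x \<noteq> \<zero>\<^bsub>R\<^esub>}" by auto
  qed (use that in auto)
  have fin_smult: "finite {x. a \<otimes>\<^bsub>R\<^esub> f x \<noteq> \<zero>\<^bsub>R\<^esub>}"
    if "finite {x. f x \<noteq> \<zero>\<^bsub>R\<^esub>}" "a \<in> carrier R" for f :: "'c \<Rightarrow> 'a" and a
    by (rule finite_subset[OF _ that(1)]) (use that in auto)
  have inv: "\<exists>g\<in>carrier (free_module R X). g \<oplus>\<^bsub>free_module R X\<^esub> f = \<zero>\<^bsub>free_module R X\<^esub>"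
    if "f \<in> carrier (free_module R X)" for f
  proof
    have "(\<lambda>x. \<ominus>\<^bsub>R\<^esub> f x) = (\<lambda>x. (\<ominus>\<^bsub>R\<^esub> \<one>\<^bsub>R\<^esub>) \<otimes>\<^bsub>R\<^esub> f x)"
      using that by (auto simp: free_module_def l_minus)
    with fin_smult[of f "\<ominus>\<^bsub>R\<^esub> \<one>\<^bsub>R\<^esub>"] that
    show "(\<lambda>x. \<ominus>\<^bsub>R\<^esub> f x) \<in> carrier (free_module R X)"
      by (auto simp: free_module_def fun_eq_iff)
    show "(\<lambda>x. \<ominus>\<^bsub>R\<^esub> f x) \<oplus>\<^bsub>free_module R X\<^esub> f = \<zero>\<^bsub>free_module R X\<^esub>"
      using that by (auto simp: free_module_def l_neg)
  qed
  show ?thesis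
  proof (rule moduleI)
    show "abelian_group (free_module R X)"
      by (rule abelian_groupI)
         (use inv in \<open>auto simp: free_module_def fin_add a_assoc intro!: ext a_comm\<close>)
  qed (auto simp: free_module_def fin_smult l_distr r_distr m_assoc \<open>cring R\<close>)
qed

lemma submodule_kernel:
  assumes "module R M" "module R N" "f \<in> linear_maps R M N"
  shows "submodule (a_kernel M N f) R M"
proof -
  interpret M: module R M by fact
  interpret N: module R N by fact
  have f: "f x \<in> carrier N" if "x \<in> carrier M" for x
    using assms(3) that by (auto simp: linear_maps_def)
  have smult: "f (a \<odot>\<^bsub>M\<^esub> x) = a \<odot>\<^bsub>N\<^esub> f x" if "a \<in> carrier R" "x \<in> carrier M" for a x
    using assms(3) that by (auto simp: linear_maps_def)
  have add: "f (x \<oplus>\<^bsub>M\<^esub> y) = f x \<oplus>\<^bsub>N\<^esub> f y" if "x \<in> carrier M" "y \<in> carrier M" for x y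
    using assms(3) that by (auto simp: linear_maps_def)
  have zero: "f \<zero>\<^bsub>M\<^esub> = \<zero>\<^bsub>N\<^esub>"
    using smult[of "\<zero>\<^bsub>R\<^esub>" "\<zero>\<^bsub>M\<^esub>"] f[of "\<zero>\<^bsub>M\<^esub>"] by simp
  have neg: "f (\<ominus>\<^bsub>M\<^esub> x) = \<zero>\<^bsub>N\<^esub>" if "x \<in> carrier M" "f x = \<zero>\<^bsub>N\<^esub>" for x
    using smult[of "\<ominus>\<^bsub>R\<^esub> \<one>\<^bsub>R\<^esub>" x] that by (simp add: M.smult_l_minus)
  show ?thesis
    by (rule M.submoduleI) (auto simp: a_kernel_def' smult add zero neg)
qed

lemma free_module_cover:
  fixes j :: "'m \<Rightarrow> 'x"
  assumes M: "module R M" and j: "inj_on j (carrier M)"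
  shows "\<exists>e \<in> linear_maps R (free_module R (j ` carrier M)) M.
           e ` carrier (free_module R (j ` carrier M)) = carrier M"
proof -
  interpret module R M by fact
  define X where "X = j ` carrier M"
  define g where "g = inv_into (carrier M) j"
  define supp where "supp f = {x. f x \<noteq> \<zero>\<^bsub>R\<^esub>}" for f :: "'x \<Rightarrow> 'a"
  define e where "e f = (\<Oplus>\<^bsub>M\<^esub>x\<in>supp f. f x \<odot>\<^bsub>M\<^esub> g x)" for f
  let ?F = "free_module R X"
  have g: "g x \<in> carrier M" if "x \<in> X" for x
    using that unfolding X_def g_def by (rule inv_into_into)
  have F: "finite (supp f)" "supp f \<subseteq> X" "\<And>x. f x \<in> carrier R" if "f \<in> carrier ?F" for f
    using that by (auto simp: free_module_def supp_def)
  have e_eq: "e f = (\<Oplus>\<^bsub>M\<^esub>x\<in>A. f x \<odot>\<^bsub>M\<^esub> g x)"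
    if f: "f \<in> carrier ?F" and A: "finite A" "supp f \<subseteq> A" "A \<subseteq> X" for f A
    unfolding e_def
    by (rule M.add.finprod_mono_neutral_cong_left)
       (use F[OF f] A g in \<open>auto simp: supp_def subset_iff\<close>)
  have closed: "e f \<in> carrier M" if "f \<in> carrier ?F" for f
    unfolding e_def by (rule M.finsum_closed) (use F[OF that] g in auto)
  have add: "e (f \<oplus>\<^bsub>?F\<^esub> h) = e f \<oplus>\<^bsub>M\<^esub> e h"
    if f: "f \<in> carrier ?F" and h: "h \<in> carrier ?F" for f h
  proof -
    interpret F: module R ?F by (rule free_module_is_module) (rule R.is_cring)
    define A where "A = supp f \<union> supp h"
    have A: "finite A" "A \<subseteq> X" using F[OF f] F[OF h] by (auto simp: A_def)
    have "supp (f \<oplus>\<^bsub>?F\<^esub> h) \<subseteq> A"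
      by (auto simp: A_def supp_def free_module_def)
    then have "e (f \<oplus>\<^bsub>?F\<^esub> h) = (\<Oplus>\<^bsub>M\<^esub>x\<in>A. (f \<oplus>\<^bsub>?F\<^esub> h) x \<odot>\<^bsub>M\<^esub> g x)"
      using e_eq[OF F.M.a_closed[OF f h]] A by blast
    also have "\<dots> = (\<Oplus>\<^bsub>M\<^esub>x\<in>A. f x \<odot>\<^bsub>M\<^esub> g x \<oplus>\<^bsub>M\<^esub> h x \<odot>\<^bsub>M\<^esub> g x)"
      by (rule M.finsum_cong')
         (use A F[OF f] F[OF h] g in \<open>auto simp: free_module_def smult_l_distr subset_iff\<close>)
    also have "\<dots> = (\<Oplus>\<^bsub>M\<^esub>x\<in>A. f x \<odot>\<^bsub>M\<^esub> g x) \<oplus>\<^bsub>M\<^esub> (\<Oplus>\<^bsub>M\<^esub>x\<in>A. h x \<odot>\<^bsub>M\<^esub> g x)"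
      by (rule M.finsum_addf) (use A F[OF f] F[OF h] g in auto)
    also have "\<dots> = e f \<oplus>\<^bsub>M\<^esub> e h"
      using e_eq[OF f, of A] e_eq[OF h, of A] A by (auto simp: A_def)
    finally show ?thesis .
  qed
  have smult: "e (a \<odot>\<^bsub>?F\<^esub> f) = a \<odot>\<^bsub>M\<^esub> e f"
    if a: "a \<in> carrier R" and f: "f \<in> carrier ?F" for a f
  proof -
    interpret F: module R ?F by (rule free_module_is_module) (rule R.is_cring)
    have "supp (a \<odot>\<^bsub>?F\<^esub> f) \<subseteq> supp f"
      using a by (auto simp: supp_def free_module_def)
    then have "e (a \<odot>\<^bsub>?F\<^esub> f) = (\<Oplus>\<^bsub>M\<^esub>x\<in>supp f. (a \<odot>\<^bsub>?F\<^esub> f) x \<odot>\<^bsub>M\<^esub> g x)"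
      using e_eq[OF F.smult_closed[OF a f]] F(1,2)[OF f] by blast
    also have "\<dots> = (\<Oplus>\<^bsub>M\<^esub>x\<in>supp f. a \<odot>\<^bsub>M\<^esub> (f x \<odot>\<^bsub>M\<^esub> g x))"
      by (rule M.finsum_cong')
         (use a F[OF f] g in \<open>auto simp: free_module_def smult_assoc1 subset_iff\<close>)
    also have "\<dots> = a \<odot>\<^bsub>M\<^esub> e f"
      unfolding e_def by (rule finsum_smult_ldistr[symmetric]) (use a F[OF f] g in auto)
    finally show ?thesis .
  qed
  have "e \<in> linear_maps R ?F M"
    using closed add smult by (auto simp: linear_maps_def)
  moreover have "y \<in> e ` carrier ?F" if y: "y \<in> carrier M" for y
  proof (cases "\<one>\<^bsub>R\<^esub> = \<zero>\<^bsub>R\<^esub>")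
    case True
    with smult_one[OF y] smult_l_null[OF y] have "y = \<zero>\<^bsub>M\<^esub>" by simp
    moreover have "e (\<lambda>_. \<zero>\<^bsub>R\<^esub>) = \<zero>\<^bsub>M\<^esub>" by (simp add: e_def supp_def)
    moreover have "(\<lambda>_. \<zero>\<^bsub>R\<^esub>) \<in> carrier ?F" by (simp add: free_module_def)
    ultimately show ?thesis by (metis image_eqI)
  next
    case False
    define f where "f = (\<lambda>x. if x = j y then \<one>\<^bsub>R\<^esub> else \<zero>\<^bsub>R\<^esub>)"
    have supp: "supp f = {j y}" using False by (auto simp: supp_def f_def)
    have "f \<in> carrier ?F"
      using y supp by (auto simp: free_module_def f_def X_def supp_def)
    have "e f = (\<Oplus>\<^bsub>M\<^esub>x\<in>{j y}. f x \<odot>\<^bsub>M\<^esub> g x)"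
      by (simp only: e_def supp)
    also have "\<dots> = f (j y) \<odot>\<^bsub>M\<^esub> g (j y) \<oplus>\<^bsub>M\<^esub> (\<Oplus>\<^bsub>M\<^esub>x\<in>{}. f x \<odot>\<^bsub>M\<^esub> g x)"
      by (rule M.finsum_insert) (use y in \<open>auto simp: f_def g_def inv_into_f_f[OF j]\<close>)
    also have "\<dots> = y"
      using y by (simp add: f_def g_def inv_into_f_f[OF j])
    finally have "e f = y" .
    with \<open>f \<in> carrier ?F\<close> show ?thesis by blast
  qed
  ultimately show ?thesis
    using closed unfolding X_def by blast
qed

lemma free_module_encoding:
  "\<exists>j :: (('a, 'm) resolution_index \<Rightarrow> 'a) \<Rightarrow> ('a, 'm) resolution_index.
     inj_on j (carrier (free_module R X))"
proof -
  define u :: "nat \<times> 'a \<times> 'm \<Rightarrow> nat \<times> 'a \<times> 'm" where "u = (\<lambda>(n, p). (Suc n, p))"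
  define enc :: "(('a, 'm) resolution_index \<times> 'a) list \<Rightarrow> ('a, 'm) resolution_index"
    where "enc = (\<lambda>ps. concat (map (\<lambda>(l, a). (0, a, undefined) # map u l) ps))"
  have inj_u: "inj u" by (auto simp: inj_def u_def)
  have take: "takeWhile (\<lambda>p. fst p \<noteq> 0) (map u l @ enc ps) = map u l"
    and drop: "dropWhile (\<lambda>p. fst p \<noteq> 0) (map u l @ enc ps) = enc ps" for l ps
    by (induction l) (cases ps; auto simp: enc_def u_def)+
  have inj_enc: "ps = qs" if "enc ps = enc qs" for ps qs
    using that
  proof (induction ps arbitrary: qs)
    case Nil
    then show ?case by (cases qs) (auto simp: enc_def)
  next
    case (Cons p ps)
    obtain l a where p: "p = (l, a)" by fastforce
    have [simp]: "enc ((l, a) # ps) = (0, a, undefined) # map u l @ enc ps" for l a ps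
      by (simp add: enc_def)
    from Cons.prems p obtain l' a' qs' where qs: "qs = (l', a') # qs'"
      by (cases qs) (auto simp: enc_def)
    from Cons.prems have "a = a'" and eq: "map u l @ enc ps = map u l' @ enc qs'"
      by (auto simp: p qs)
    moreover from eq have "map u l = map u l'" "enc ps = enc qs'"
      using take drop by metis+
    ultimately show ?case
      using Cons.IH inj_u by (simp add: p qs)
  qed
  define graph where "graph f = {(x, f x) | x. f x \<noteq> \<zero>\<^bsub>R\<^esub>}"
    for f :: "('a, 'm) resolution_index \<Rightarrow> 'a"
  define j where "j f = enc (SOME l. set l = graph f)" for f
  have "inj_on j (carrier (free_module R X))"
  proof (rule inj_onI)
    fix f h assume f: "f \<in> carrier (free_module R X)" and h: "h \<in> carrier (free_module R X)"
      and eq: "j f = j h"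
    have set: "set (SOME l. set l = graph f) = graph f" if "f \<in> carrier (free_module R X)" for f
    proof -
      have "graph f = (\<lambda>x. (x, f x)) ` {x. f x \<noteq> \<zero>\<^bsub>R\<^esub>}" by (auto simp: graph_def)
      with that have "finite (graph f)" by (auto simp: free_module_def)
      then show ?thesis using finite_list[of "graph f"] by (metis (mono_tags) someI_ex)
    qed
    have "(SOME l. set l = graph f) = (SOME l. set l = graph h)"
      using eq unfolding j_def by (rule inj_enc)
    from arg_cong[OF this, of set] have gr: "graph f = graph h"
      by (simp only: set[OF f] set[OF h])
    have iff: "f x \<noteq> \<zero>\<^bsub>R\<^esub> \<and> f x = y \<longleftrightarrow> h x \<noteq> \<zero>\<^bsub>R\<^esub> \<and> h x = y" for x y
      using arg_cong[OF gr, of "\<lambda>G. (x, y) \<in> G"] by (auto simp: graph_def)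
    show "f = h"
    proof
      fix x
      show "f x = h x" using iff[of x "f x"] iff[of x "h x"] by auto
    qed
  qed
  then show ?thesis by blast
qed

lemma free_resolution_exists:
  fixes R :: "('a, 'r) ring_scheme" and N :: "('a, 'm, 'z) module_scheme"
  assumes "module R N"
  shows "\<exists>(X :: nat \<Rightarrow> ('a, 'm) resolution_index set) d \<epsilon>. free_resolution R N X d \<epsilon>"
proof -
  interpret module R N by fact
  let ?F = "\<lambda>X :: ('a, 'm) resolution_index set. free_module R X"
  have F: "module R (?F X)" for X by (rule free_module_is_module) (rule R.is_cring)
  have "inj_on (\<lambda>y. [(0 :: nat, undefined :: 'a, y)]) (carrier N)" by (auto simp: inj_on_def)
  from free_module_cover[OF assms this]
  obtain X0 :: "('a, 'm) resolution_index set" and e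
    where e: "e \<in> linear_maps R (?F X0) N" "e ` carrier (?F X0) = carrier N" by blast
  have step: "\<exists>Y d. d \<in> linear_maps R (?F Y) (?F X) \<and> d ` carrier (?F Y) = K"
    if K: "submodule K R (?F X)" for X K
  proof -
    have sub: "K \<subseteq> carrier (?F X)" using module.submoduleE(1)[OF F K] .
    have mod: "module R ((?F X)\<lparr>carrier := K\<rparr>)" by (rule submodule.submodule_is_module[OF K F])
    obtain j :: "(('a, 'm) resolution_index \<Rightarrow> 'a) \<Rightarrow> ('a, 'm) resolution_index"
      where "inj_on j (carrier (?F X))" using free_module_encoding[of R X] by blast
    then have "inj_on j (carrier ((?F X)\<lparr>carrier := K\<rparr>))" using sub by (auto intro: inj_on_subset)
    from free_module_cover[OF mod this] obtain Y d
      where "d \<in> linear_maps R (?F Y) ((?F X)\<lparr>carrier := K\<rparr>)" "d ` carrier (?F Y) = K" by auto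
    then show ?thesis using sub by (auto simp: linear_maps_def Pi_def subset_iff)
  qed
  let ?good = "\<lambda>(X, Y, d). d \<in> linear_maps R (?F Y) (?F X)"
  let ?next = "\<lambda>(X, Y, d) (X', Y', d').
                 X' = Y \<and> d' ` carrier (?F Y') = a_kernel (?F Y) (?F X) d"
  let ?start = "\<lambda>(X, Y, d). X = X0 \<and> d ` carrier (?F Y) = a_kernel (?F X0) N e"
  have "\<exists>s. \<forall>n. (?good (s n) \<and> (n = 0 \<longrightarrow> ?start (s n))) \<and> ?next (s n) (s (Suc n))"
  proof (rule dependent_nat_choice)
    obtain Y d where "d \<in> linear_maps R (?F Y) (?F X0)"
      "d ` carrier (?F Y) = a_kernel (?F X0) N e"
      using step[OF submodule_kernel[OF F assms e(1)]] by blast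
    then show "\<exists>s. ?good s \<and> (0 = (0 :: nat) \<longrightarrow> ?start s)"
      by (intro exI[of _ "(X0, Y, d)"]) simp
  next
    fix s and n :: nat
    assume good: "?good s \<and> (n = 0 \<longrightarrow> ?start s)"
    obtain X Y d where s: "s = (X, Y, d)" by (cases s)
    with good have "d \<in> linear_maps R (?F Y) (?F X)" by simp
    from step[OF submodule_kernel[OF F F this]] obtain Y' d'
      where "d' \<in> linear_maps R (?F Y') (?F Y)" "d' ` carrier (?F Y') = a_kernel (?F Y) (?F X) d"
      by blast
    then show "\<exists>t. (?good t \<and> (Suc n = 0 \<longrightarrow> ?start t)) \<and> ?next s t"
      by (intro exI[of _ "(Y, Y', d')"]) (simp add: s)
  qed
  then obtain s
    where s: "\<And>n. (?good (s n) \<and> (n = 0 \<longrightarrow> ?start (s n))) \<and> ?next (s n) (s (Suc n))"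
    by (elim exE) (rule that, erule spec)
  have good: "?good (s n)" for n using s[of n] by (elim conjE)
  have next': "?next (s n) (s (Suc n))" for n using s[of n] by (elim conjE)
  have start: "?start (s 0)" by (rule mp[OF conjunct2[OF conjunct1[OF s[of 0]]] refl])
  define X where "X n = fst (s n)" for n
  define d where "d n = snd (snd (s n))" for n
  have "fst (snd (s n)) = X (Suc n)" for n
    using next'[of n] by (simp add: X_def split: prod.splits)
  then have s_eq: "s n = (X n, X (Suc n), d n)" for n
    by (simp add: X_def d_def prod_eq_iff)
  have "free_resolution R N X d e"
    unfolding free_resolution_def Let_def
    using e start good next' by (simp add: s_eq)
  then show ?thesis by blast
qed

end

(*
  Let b_i be the Betti numbers of E, Z_i its syzygies in a minimal free resolution G, e = embdim
  the length of m/m^2 and g = sqdim the length of m^2.  Injectivity and the simple socle of E give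
  length E = length R = 1 + e + g, and R is Gorenstein as soon as E is cyclic or E embeds into
  a free module.  Because m^2 M = 0, a map G_{i+1} -> mM is a cocycle and maps G_i -> mM become zero
  in G_{i+1}, so vanishing of Ext gives b_{i+1} length(mM) <= b_i mu(M), and hence b_i is eventually
  constant.  If a syzygy Z_i far out has a minimal generator in its socle, Ext^1(k, M) = 0 and
  counting lengths in M forces e <= 1.  Otherwise m Z_i = m^2 G_{i-1} far out, so that e = g + 1;
  then b_{i+1} - b_i >= g (b_i - b_{i-1}) for all i, which together with length E = length R leaves
  only b_0 <= 1 and b_0 = b_1 = b_2 = 2.  In the latter case the adjugate of the 2x2 presentation
  matrix of E embeds E into a free module.
*)
theory Submission
  imports Defs
begin

section \<open>Submodules and linear maps\<close>

text \<open>The obstacle is that Ext vanishes only in high degrees, while E sits at the start of the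
  resolution. Far out, the constant Betti number b and m Z = m^2 F give the same length twice, 2 b
  (1 + g) = b (1 + e + g), hence e = g + 1. This is a statement about R alone, so it can be carried
  back to the start: with it the length equation b_(i+2) + c_(i+1) + b_(i+1) + c_i = 2 b_(i+1) (1 +
  g) and the bound c_i \<le> g b_i hold in every degree (c_i is \<open>c i\<close> below), and a
  strict increase of Betti numbers would continue forever. At the start, length E = length R turns
  b_0 \<ge> 3 into such an increase. The hypothesis on mu(M) turns b_(i+1) length(mM) \<le> b_i
  mu(M) into b_(i+1) \<le> b_i, and it bounds e times the socle length of M by that socle length,
  whence e \<le> 1. When the Betti numbers are two, the determinant of the presentation matrix
  annihilates the faithful module E and so vanishes; the work lies in showing that the kernel of the
  adjugate is no larger than the image of the matrix.\<close>

lemma submodule_iff: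
  assumes "module R M"
  shows "submodule N R M \<longleftrightarrow> N \<subseteq> carrier M \<and> \<zero>\<^bsub>M\<^esub> \<in> N \<and>
           (\<forall>x\<in>N. \<forall>y\<in>N. x \<oplus>\<^bsub>M\<^esub> y \<in> N) \<and> (\<forall>a\<in>carrier R. \<forall>x\<in>N. a \<odot>\<^bsub>M\<^esub> x \<in> N)"
    (is "_ \<longleftrightarrow> ?P")
proof
  interpret module R M by fact
  show ?P if N: "submodule N R M"
    using submoduleE[OF N] subgroup.one_closed[OF submodule.axioms(1)[OF N]] by auto
  show "submodule N R M" if P: ?P
  proof (rule submoduleI)
    fix a assume "a \<in> N"
    then have "\<ominus>\<^bsub>M\<^esub> a = (\<ominus>\<^bsub>R\<^esub> \<one>\<^bsub>R\<^esub>) \<odot>\<^bsub>M\<^esub> a"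
      using P by (simp add: smult_l_minus subset_iff)
    then show "\<ominus>\<^bsub>M\<^esub> a \<in> N"
      using P \<open>a \<in> N\<close> by simp
  qed (use P in auto)
qed

context module
begin

lemma submodule_sub: "submodule N R M \<Longrightarrow> x \<in> N \<Longrightarrow> x \<in> carrier M"
  and submodule_zero_mem: "submodule N R M \<Longrightarrow> \<zero>\<^bsub>M\<^esub> \<in> N"
  and submodule_add: "submodule N R M \<Longrightarrow> x \<in> N \<Longrightarrow> y \<in> N \<Longrightarrow> x \<oplus>\<^bsub>M\<^esub> y \<in> N"
  and submodule_smult: "submodule N R M \<Longrightarrow> a \<in> carrier R \<Longrightarrow> x \<in> N \<Longrightarrow> a \<odot>\<^bsub>M\<^esub> x \<in> N"
  using submodule_iff[OF module_axioms, of N] by blast+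

lemma submodule_minus: "submodule N R M \<Longrightarrow> x \<in> N \<Longrightarrow> y \<in> N \<Longrightarrow> x \<ominus>\<^bsub>M\<^esub> y \<in> N"
  by (simp add: a_minus_def submoduleE(3) submoduleE(5))

lemma minus_eq_zero_iff:
  "x \<in> carrier M \<Longrightarrow> y \<in> carrier M \<Longrightarrow> x \<ominus>\<^bsub>M\<^esub> y = \<zero>\<^bsub>M\<^esub> \<longleftrightarrow> x = y"
  by (metis M.a_inv_closed M.minus_equality M.minus_minus M.r_neg a_minus_def)

lemma submodule_cancel_left:
  assumes N: "submodule N R M" and "x \<in> N" "y \<in> carrier M" "x \<oplus>\<^bsub>M\<^esub> y \<in> N"
  shows "y \<in> N"
proof -
  have "\<ominus>\<^bsub>M\<^esub> x \<oplus>\<^bsub>M\<^esub> (x \<oplus>\<^bsub>M\<^esub> y) \<in> N"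
    using assms by (simp add: submoduleE(3) submoduleE(5))
  then show ?thesis
    using assms submodule_sub[OF N] by (simp add: M.r_neg1)
qed

lemma submodule_zero: "submodule {\<zero>\<^bsub>M\<^esub>} R M"
  by (simp add: submodule_iff[OF module_axioms])

lemma submodule_Int: "submodule A R M \<Longrightarrow> submodule B R M \<Longrightarrow> submodule (A \<inter> B) R M"
  by (auto simp: submodule_iff[OF module_axioms])

lemma submodule_carrier_update:
  assumes L: "submodule L R M"
  shows "submodule N R (M\<lparr>carrier := L\<rparr>) \<longleftrightarrow> submodule N R M \<and> N \<subseteq> L"
  unfolding submodule_iff[OF module_axioms]
    submodule_iff[OF submodule.submodule_is_module[OF L module_axioms]]
  using submodule_sub[OF L] by auto

lemma submodule_set_add:
  assumes A: "submodule A R M" and B: "submodule B R M"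
  shows "submodule (A <+>\<^bsub>M\<^esub> B) R M"
  unfolding submodule_iff[OF module_axioms]
proof (intro conjI ballI)
  note sub = submodule_sub[OF A] submodule_sub[OF B]
  show "A <+>\<^bsub>M\<^esub> B \<subseteq> carrier M" using sub by (auto simp: set_add_def')
  show "\<zero>\<^bsub>M\<^esub> \<in> A <+>\<^bsub>M\<^esub> B"
    unfolding set_add_def'
    by (intro UN_I[OF submodule_zero_mem[OF A]] UN_I[OF submodule_zero_mem[OF B]]) simp
next
  note sub = submodule_sub[OF A] submodule_sub[OF B]
  fix x y assume "x \<in> A <+>\<^bsub>M\<^esub> B" "y \<in> A <+>\<^bsub>M\<^esub> B"
  then obtain a b a' b' where *: "a \<in> A" "b \<in> B" "x = a \<oplus>\<^bsub>M\<^esub> b" "a' \<in> A" "b' \<in> B" "y = a' \<oplus>\<^bsub>M\<^esub> b'"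
    by (auto simp: set_add_def')
  then have "x \<oplus>\<^bsub>M\<^esub> y = (a \<oplus>\<^bsub>M\<^esub> a') \<oplus>\<^bsub>M\<^esub> (b \<oplus>\<^bsub>M\<^esub> b')"
    using sub by (simp add: M.a_ac)
  then show "x \<oplus>\<^bsub>M\<^esub> y \<in> A <+>\<^bsub>M\<^esub> B"
    unfolding set_add_def'
    by (intro UN_I[OF submodule_add[OF A *(1,4)]] UN_I[OF submodule_add[OF B *(2,5)]]) simp
next
  note sub = submodule_sub[OF A] submodule_sub[OF B]
  fix c x assume c: "c \<in> carrier R" and "x \<in> A <+>\<^bsub>M\<^esub> B"
  then obtain a b where *: "a \<in> A" "b \<in> B" "x = a \<oplus>\<^bsub>M\<^esub> b" by (auto simp: set_add_def')
  then have "c \<odot>\<^bsub>M\<^esub> x = c \<odot>\<^bsub>M\<^esub> a \<oplus>\<^bsub>M\<^esub> c \<odot>\<^bsub>M\<^esub> b"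
    using sub c by (simp add: smult_r_distr)
  then show "c \<odot>\<^bsub>M\<^esub> x \<in> A <+>\<^bsub>M\<^esub> B"
    unfolding set_add_def'
    by (intro UN_I[OF submodule_smult[OF A c *(1)]] UN_I[OF submodule_smult[OF B c *(2)]]) simp
qed

lemma subset_set_add:
  assumes A: "submodule A R M" and B: "submodule B R M"
  shows "A \<subseteq> A <+>\<^bsub>M\<^esub> B" "B \<subseteq> A <+>\<^bsub>M\<^esub> B"
proof -
  show "A \<subseteq> A <+>\<^bsub>M\<^esub> B"
  proof
    fix x assume "x \<in> A"
    then have "x = x \<oplus>\<^bsub>M\<^esub> \<zero>\<^bsub>M\<^esub>" using submodule_sub[OF A] by simp
    then show "x \<in> A <+>\<^bsub>M\<^esub> B"
      unfolding set_add_def' by (intro UN_I[OF \<open>x \<in> A\<close>] UN_I[OF submodule_zero_mem[OF B]]) simp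
  qed
  show "B \<subseteq> A <+>\<^bsub>M\<^esub> B"
  proof
    fix x assume "x \<in> B"
    then have "x = \<zero>\<^bsub>M\<^esub> \<oplus>\<^bsub>M\<^esub> x" using submodule_sub[OF B] by simp
    then show "x \<in> A <+>\<^bsub>M\<^esub> B"
      unfolding set_add_def' by (intro UN_I[OF submodule_zero_mem[OF A]] UN_I[OF \<open>x \<in> B\<close>]) simp
  qed
qed

lemma set_add_least:
  assumes "submodule C R M" "A \<subseteq> C" "B \<subseteq> C"
  shows "A <+>\<^bsub>M\<^esub> B \<subseteq> C"
  using assms submodule_add[OF assms(1)] by (auto simp: set_add_def')

lemma set_add_mono: "A \<subseteq> A' \<Longrightarrow> A <+>\<^bsub>M\<^esub> B \<subseteq> A' <+>\<^bsub>M\<^esub> B"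
  by (auto simp: set_add_def')

text \<open>If x in A' equals a + b, then b lies in A' \<inter> B = A \<inter> B, so x is in A. Thus
  a strict inclusion stays strict after intersecting with B or after adding B, which is what makes
  length additive.\<close>

lemma modular_eq:
  assumes A: "submodule A R M" and A': "submodule A' R M" and B: "submodule B R M"
    and "A \<subseteq> A'" "A \<inter> B = A' \<inter> B" "A <+>\<^bsub>M\<^esub> B = A' <+>\<^bsub>M\<^esub> B"
  shows "A = A'"
proof
  show "A' \<subseteq> A"
  proof
    fix x assume x: "x \<in> A'"
    then have "x \<in> A <+>\<^bsub>M\<^esub> B" using subset_set_add(1)[OF A' B] assms(6) by auto
    then obtain a b where ab: "a \<in> A" "b \<in> B" "x = a \<oplus>\<^bsub>M\<^esub> b" by (auto simp: set_add_def')
    then have "b \<in> A'"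
      using submodule_cancel_left[OF A', of a b] submodule_sub[OF B] assms(4) x by auto
    then have "b \<in> A" using ab assms(5) by auto
    then show "x \<in> A" using ab submodule_add[OF A] by auto
  qed
qed fact

lemma submodule_cyclic:
  assumes x: "x \<in> carrier M"
  shows "submodule ((\<lambda>a. a \<odot>\<^bsub>M\<^esub> x) ` carrier R) R M" "x \<in> (\<lambda>a. a \<odot>\<^bsub>M\<^esub> x) ` carrier R"
  unfolding submodule_iff[OF module_axioms]
proof (safe)
  show "\<zero>\<^bsub>M\<^esub> \<in> (\<lambda>a. a \<odot>\<^bsub>M\<^esub> x) ` carrier R"
    by (rule image_eqI[of _ _ "\<zero>\<^bsub>R\<^esub>"]) (use x in auto)
  show "x \<in> (\<lambda>a. a \<odot>\<^bsub>M\<^esub> x) ` carrier R"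
    by (rule image_eqI[of _ _ "\<one>\<^bsub>R\<^esub>"]) (use x in auto)
  show "a \<odot>\<^bsub>M\<^esub> x \<oplus>\<^bsub>M\<^esub> b \<odot>\<^bsub>M\<^esub> x \<in> (\<lambda>a. a \<odot>\<^bsub>M\<^esub> x) ` carrier R"
    if "a \<in> carrier R" "b \<in> carrier R" for a b
    by (rule image_eqI[of _ _ "a \<oplus>\<^bsub>R\<^esub> b"]) (use x that in \<open>auto simp: smult_l_distr\<close>)
  show "a \<odot>\<^bsub>M\<^esub> (b \<odot>\<^bsub>M\<^esub> x) \<in> (\<lambda>a. a \<odot>\<^bsub>M\<^esub> x) ` carrier R"
    if "a \<in> carrier R" "b \<in> carrier R" for a b
    by (rule image_eqI[of _ _ "a \<otimes>\<^bsub>R\<^esub> b"]) (use x that in \<open>auto simp: smult_assoc1\<close>)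
qed (use x in auto)

end

section \<open>Linear maps, their kernels, images and factorizations\<close>

lemma linear_mapsI:
  assumes "\<And>x. x \<in> carrier M \<Longrightarrow> f x \<in> carrier N"
    and "\<And>x y. x \<in> carrier M \<Longrightarrow> y \<in> carrier M \<Longrightarrow> f (x \<oplus>\<^bsub>M\<^esub> y) = f x \<oplus>\<^bsub>N\<^esub> f y"
    and "\<And>a x. a \<in> carrier R \<Longrightarrow> x \<in> carrier M \<Longrightarrow> f (a \<odot>\<^bsub>M\<^esub> x) = a \<odot>\<^bsub>N\<^esub> f x"
  shows "f \<in> linear_maps R M N"
  using assms by (auto simp: linear_maps_def)

lemma
  assumes "f \<in> linear_maps R M N"
  shows lin_closed: "x \<in> carrier M \<Longrightarrow> f x \<in> carrier N"
    and lin_add: "x \<in> carrier M \<Longrightarrow> y \<in> carrier M \<Longrightarrow> f (x \<oplus>\<^bsub>M\<^esub> y) = f x \<oplus>\<^bsub>N\<^esub> f y"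
    and lin_smult: "a \<in> carrier R \<Longrightarrow> x \<in> carrier M \<Longrightarrow> f (a \<odot>\<^bsub>M\<^esub> x) = a \<odot>\<^bsub>N\<^esub> f x"
  using assms by (auto simp: linear_maps_def)

lemma lin_zero:
  assumes "module R M" "module R N" "f \<in> linear_maps R M N"
  shows "f \<zero>\<^bsub>M\<^esub> = \<zero>\<^bsub>N\<^esub>"
proof -
  interpret M: module R M by fact
  interpret N: module R N by fact
  have "f \<zero>\<^bsub>M\<^esub> = \<zero>\<^bsub>R\<^esub> \<odot>\<^bsub>N\<^esub> f \<zero>\<^bsub>M\<^esub>"
    using lin_smult[OF assms(3), of "\<zero>\<^bsub>R\<^esub>" "\<zero>\<^bsub>M\<^esub>"] by simp
  then show ?thesis using lin_closed[OF assms(3), of "\<zero>\<^bsub>M\<^esub>"] by simp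
qed

lemma lin_uminus:
  assumes "module R M" "module R N" "f \<in> linear_maps R M N" "x \<in> carrier M"
  shows "f (\<ominus>\<^bsub>M\<^esub> x) = \<ominus>\<^bsub>N\<^esub> f x"
proof -
  interpret M: module R M by fact
  interpret N: module R N by fact
  show ?thesis
    using lin_smult[OF assms(3), of "\<ominus>\<^bsub>R\<^esub> \<one>\<^bsub>R\<^esub>" x] lin_closed[OF assms(3,4)] assms(4)
    by (simp add: M.smult_l_minus N.smult_l_minus)
qed

lemma lin_minus:
  assumes "module R M" "module R N" "f \<in> linear_maps R M N" "x \<in> carrier M" "y \<in> carrier M"
  shows "f (x \<ominus>\<^bsub>M\<^esub> y) = f x \<ominus>\<^bsub>N\<^esub> f y"
proof -
  interpret M: module R M by fact
  show ?thesis
    using assms by (simp add: a_minus_def lin_add[OF assms(3)] lin_uminus)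
qed

lemma lin_comp:
  assumes f: "f \<in> linear_maps R L M" and g: "g \<in> linear_maps R M N"
  shows "(\<lambda>x. g (f x)) \<in> linear_maps R L N"
  by (rule linear_mapsI)
     (simp_all add: lin_closed[OF f] lin_closed[OF g] lin_add[OF f] lin_add[OF g]
        lin_smult[OF f] lin_smult[OF g])

lemma lin_smult_left:
  assumes "module R M" "a \<in> carrier R"
  shows "(\<lambda>x. a \<odot>\<^bsub>M\<^esub> x) \<in> linear_maps R M M"
proof -
  interpret module R M by fact
  show ?thesis
    using assms(2) by (intro linear_mapsI)
      (auto simp: smult_r_distr smult_assoc1[symmetric] m_comm)
qed

lemma lin_smult_right:
  assumes "module R M" "x \<in> carrier M"
  shows "(\<lambda>a. a \<odot>\<^bsub>M\<^esub> x) \<in> linear_maps R (regular_module R) M"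
proof -
  interpret module R M by fact
  show ?thesis
    using assms(2) by (intro linear_mapsI) (auto simp: regular_module_def smult_l_distr smult_assoc1)
qed

lemma lin_diff:
  assumes "module R N" and f: "f \<in> linear_maps R M N" and g: "g \<in> linear_maps R M N"
  shows "(\<lambda>x. f x \<ominus>\<^bsub>N\<^esub> g x) \<in> linear_maps R M N"
proof -
  interpret module R N by fact
  show ?thesis
    by (intro linear_mapsI)
       (simp_all add: lin_closed[OF f] lin_closed[OF g] lin_add[OF f] lin_add[OF g]
          lin_smult[OF f] lin_smult[OF g] smult_r_distr smult_r_minus M.a_ac M.minus_add a_minus_def)
qed

lemma submodule_vimage:
  assumes "module R M" "module R N" and f: "f \<in> linear_maps R M N"
    and L: "submodule L R M" and A: "submodule A R N"
  shows "submodule {x \<in> L. f x \<in> A} R M"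
proof -
  interpret M: module R M by fact
  interpret N: module R N by fact
  show ?thesis
    unfolding submodule_iff[OF assms(1)]
    using M.submodule_sub[OF L] M.submodule_zero_mem[OF L] M.submodule_add[OF L] M.submodule_smult[OF L]
      N.submodule_zero_mem[OF A] N.submodule_add[OF A] N.submodule_smult[OF A]
      lin_zero[OF assms(1-3)]
    by (auto simp: lin_add[OF f] lin_smult[OF f])
qed

lemma submodule_image:
  assumes "module R M" "module R N" and f: "f \<in> linear_maps R M N" and L: "submodule L R M"
  shows "submodule (f ` L) R N"
proof -
  interpret M: module R M by fact
  show ?thesis
    unfolding submodule_iff[OF assms(2)]
  proof (intro conjI ballI)
    note sub = M.submodule_sub[OF L]
    show "f ` L \<subseteq> carrier N" using sub lin_closed[OF f] by auto
    show "\<zero>\<^bsub>N\<^esub> \<in> f ` L"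
      using M.submodule_zero_mem[OF L] lin_zero[OF assms(1-3)] by (metis image_eqI)
    show "x \<oplus>\<^bsub>N\<^esub> y \<in> f ` L" if "x \<in> f ` L" "y \<in> f ` L" for x y
      using that sub M.submodule_add[OF L] lin_add[OF f] by (auto simp: image_iff) metis
    show "a \<odot>\<^bsub>N\<^esub> x \<in> f ` L" if "a \<in> carrier R" "x \<in> f ` L" for a x
      using that sub M.submodule_smult[OF L] lin_smult[OF f] by (auto simp: image_iff) metis
  qed
qed

text \<open>The quotient of F by the kernel of p is represented by the image of p, as M with a
  smaller carrier. A value of h is f at an arbitrarily chosen preimage; \<open>ker\<close> makes it
  independent of the choice.\<close>

lemma lin_factor:
  assumes "module R F" "module R M" "module R N"
    and p: "p \<in> linear_maps R F M" and f: "f \<in> linear_maps R F N"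
    and ker: "\<And>u. u \<in> carrier F \<Longrightarrow> p u = \<zero>\<^bsub>M\<^esub> \<Longrightarrow> f u = \<zero>\<^bsub>N\<^esub>"
  shows "\<exists>h \<in> linear_maps R (M\<lparr>carrier := p ` carrier F\<rparr>) N. \<forall>u\<in>carrier F. h (p u) = f u"
proof -
  interpret F: module R F by fact
  interpret M: module R M by fact
  interpret N: module R N by fact
  define h where "h y = f (SOME u. u \<in> carrier F \<and> p u = y)" for y
  have h: "h (p u) = f u" if u: "u \<in> carrier F" for u
  proof -
    define v where "v = (SOME v. v \<in> carrier F \<and> p v = p u)"
    have v: "v \<in> carrier F" "p v = p u"
      using someI[of "\<lambda>v. v \<in> carrier F \<and> p v = p u" u] u by (auto simp: v_def)
    have "p (v \<ominus>\<^bsub>F\<^esub> u) = \<zero>\<^bsub>M\<^esub>"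
      using v u lin_closed[OF p u] unfolding lin_minus[OF assms(1,2) p v(1) u]
      by (simp add: M.minus_eq_zero_iff)
    then have "f v \<ominus>\<^bsub>N\<^esub> f u = \<zero>\<^bsub>N\<^esub>"
      using ker[of "v \<ominus>\<^bsub>F\<^esub> u"] v u by (simp add: lin_minus[OF assms(1,3) f])
    then show ?thesis
      using v u lin_closed[OF f] unfolding h_def v_def[symmetric] by (simp add: N.minus_eq_zero_iff)
  qed
  have "h \<in> linear_maps R (M\<lparr>carrier := p ` carrier F\<rparr>) N"
  proof (rule linear_mapsI)
    fix x y assume "x \<in> carrier (M\<lparr>carrier := p ` carrier F\<rparr>)" "y \<in> carrier (M\<lparr>carrier := p ` carrier F\<rparr>)"
    then obtain u v where uv: "u \<in> carrier F" "x = p u" "v \<in> carrier F" "y = p v" by auto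
    then show "h (x \<oplus>\<^bsub>M\<lparr>carrier := p ` carrier F\<rparr>\<^esub> y) = h x \<oplus>\<^bsub>N\<^esub> h y"
      using h[of "u \<oplus>\<^bsub>F\<^esub> v"] by (simp add: h lin_add[OF p] lin_add[OF f])
  next
    fix a x assume "a \<in> carrier R" "x \<in> carrier (M\<lparr>carrier := p ` carrier F\<rparr>)"
    then obtain u where u: "u \<in> carrier F" "x = p u" "a \<in> carrier R" by auto
    then show "h (a \<odot>\<^bsub>M\<lparr>carrier := p ` carrier F\<rparr>\<^esub> x) = a \<odot>\<^bsub>N\<^esub> h x"
      using h[of "a \<odot>\<^bsub>F\<^esub> u"] by (simp add: h lin_smult[OF p] lin_smult[OF f])
  qed (auto simp: h lin_closed[OF f])
  then show ?thesis using h by blast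
qed

lemma a_kernel_iff: "x \<in> a_kernel M N f \<longleftrightarrow> x \<in> carrier M \<and> f x = \<zero>\<^bsub>N\<^esub>"
  by (simp add: a_kernel_def')

section \<open>Lengths of intervals in the submodule lattice\<close>

definition submodule_chain ::
    "('a, 'r) ring_scheme \<Rightarrow> ('a, 'm, 'z) module_scheme \<Rightarrow> 'm set \<Rightarrow> 'm set \<Rightarrow> nat \<Rightarrow> (nat \<Rightarrow> 'm set) \<Rightarrow> bool"
  where "submodule_chain R M A B n N \<longleftrightarrow>
     (\<forall>i\<le>n. submodule (N i) R M \<and> A \<subseteq> N i \<and> N i \<subseteq> B) \<and> (\<forall>i<n. N i \<subset> N (Suc i))"

text \<open>This is the length of the quotient B / A, read off from the submodules between A and B
  so that no quotient module has to be formed. A chain need not start at A or end at B.\<close>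

definition interval_length ::
    "('a, 'r) ring_scheme \<Rightarrow> ('a, 'm, 'z) module_scheme \<Rightarrow> 'm set \<Rightarrow> 'm set \<Rightarrow> enat" where
  "interval_length R M A B = Sup {enat n | n. \<exists>N. submodule_chain R M A B n N}"

lemma interval_length_ge: "submodule_chain R M A B n N \<Longrightarrow> enat n \<le> interval_length R M A B"
  unfolding interval_length_def by (rule Sup_upper) auto

lemma interval_length_le:
  "(\<And>n N. submodule_chain R M A B n N \<Longrightarrow> enat n \<le> c) \<Longrightarrow> interval_length R M A B \<le> c"
  unfolding interval_length_def by (rule Sup_least) auto

lemma interval_length_mono:
  assumes "A' \<subseteq> A" "B \<subseteq> B'"
  shows "interval_length R M A B \<le> interval_length R M A' B'"
proof (rule interval_length_le)
  fix n N assume "submodule_chain R M A B n N"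
  then have "submodule_chain R M A' B' n N"
    using assms unfolding submodule_chain_def by blast
  then show "enat n \<le> interval_length R M A' B'" by (rule interval_length_ge)
qed

text \<open>For finite c both sets are bounded by c, hence finite, and they attain their suprema;
  the hypothesis then applies to the two maxima.\<close>

lemma enat_Sup_add_le:
  fixes X Y :: "enat set"
  assumes "X \<noteq> {}" "Y \<noteq> {}" and le: "\<And>x y. x \<in> X \<Longrightarrow> y \<in> Y \<Longrightarrow> x + y \<le> c"
  shows "Sup X + Sup Y \<le> c"
proof (cases c)
  case (enat m)
  have fin: "finite Z \<and> Sup Z \<in> Z" if "Z \<noteq> {}" "\<And>z. z \<in> Z \<Longrightarrow> z \<le> c" for Z :: "enat set"
  proof -
    have "finite Z" by (rule finite_enat_bounded) (use that enat in auto)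
    then show ?thesis using that by (simp add: Sup_enat_def)
  qed
  have "x \<le> c" if "x \<in> X" for x
    using le[OF that] assms(2) by (metis add_increasing2 dual_order.trans ex_in_conv le_iff_add)
  moreover have "y \<le> c" if "y \<in> Y" for y
    using le[OF _ that] assms(1) by (metis add.commute dual_order.trans ex_in_conv le_iff_add)
  ultimately show ?thesis using fin[of X] fin[of Y] assms by blast
qed simp

lemma submodule_chain_Suc:
  assumes "submodule_chain R M A C k N" "submodule C R M" "C \<subset> D" "submodule D R M" "A \<subseteq> D"
  shows "\<exists>N'. submodule_chain R M A D (Suc k) N' \<and> N' (Suc k) = D"
proof -
  have "submodule_chain R M A D (Suc k) (N(Suc k := D))"
    unfolding submodule_chain_def
  proof (intro conjI allI impI)
    fix i assume "i \<le> Suc k"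
    then have "i = Suc k \<or> (i \<noteq> Suc k \<and> i \<le> k)" by auto
    moreover have "submodule (N i) R M \<and> A \<subseteq> N i \<and> N i \<subseteq> D" if "i \<le> k"
      using assms that unfolding submodule_chain_def by blast
    ultimately show "submodule ((N(Suc k := D)) i) R M" "A \<subseteq> (N(Suc k := D)) i" "(N(Suc k := D)) i \<subseteq> D"
      using assms(4,5) by auto
  next
    fix i assume "i < Suc k"
    then show "(N(Suc k := D)) i \<subset> (N(Suc k := D)) (Suc i)"
    proof (cases "i = k")
      case True
      have "N k \<subseteq> C" using assms(1) by (simp add: submodule_chain_def)
      then show ?thesis using True assms(3) by auto
    next
      case False
      then show ?thesis using assms(1) \<open>i < Suc k\<close> by (simp add: submodule_chain_def)
    qed
  qed
  then show ?thesis by force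
qed

text \<open>Intersecting a strict chain with a submodule, or adding a submodule to it, creates
  repetitions. Only the proper steps are counted, and they form a strict chain again.\<close>

lemma interval_length_weak_chain:
  assumes "\<And>i. i \<le> n \<Longrightarrow> submodule (P i) R M \<and> A \<subseteq> P i \<and> P i \<subseteq> B"
    and "\<And>i. i < n \<Longrightarrow> P i \<subseteq> P (Suc i)"
  shows "enat (card {i. i < n \<and> P i \<noteq> P (Suc i)}) \<le> interval_length R M A B"
proof -
  have "\<exists>N. submodule_chain R M A (P k) (card {i. i < k \<and> P i \<noteq> P (Suc i)}) N" if "k \<le> n" for k
    using that
  proof (induction k)
    case 0
    then show ?case using assms(1)[of 0]
      by (intro exI[of _ "\<lambda>_. P 0"]) (auto simp: submodule_chain_def)
  next
    case (Suc k)
    then obtain N where N: "submodule_chain R M A (P k) (card {i. i < k \<and> P i \<noteq> P (Suc i)}) N"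
      by auto
    show ?case
    proof (cases "P k = P (Suc k)")
      case True
      then have "{i. i < Suc k \<and> P i \<noteq> P (Suc i)} = {i. i < k \<and> P i \<noteq> P (Suc i)}"
        by (auto simp: less_Suc_eq)
      then show ?thesis using N True by auto
    next
      case False
      then have "{i. i < Suc k \<and> P i \<noteq> P (Suc i)} = insert k {i. i < k \<and> P i \<noteq> P (Suc i)}"
        by (auto simp: less_Suc_eq)
      moreover have "P k \<subset> P (Suc k)" using False assms(2)[of k] Suc.prems by auto
      ultimately show ?thesis
        using submodule_chain_Suc[OF N, of "P (Suc k)"] assms(1)[of k] assms(1)[of "Suc k"] Suc.prems
        by auto
    qed
  qed
  from this[of n] obtain N where
    "submodule_chain R M A (P n) (card {i. i < n \<and> P i \<noteq> P (Suc i)}) N" by auto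
  then have "enat (card {i. i < n \<and> P i \<noteq> P (Suc i)}) \<le> interval_length R M A (P n)"
    by (rule interval_length_ge)
  also have "\<dots> \<le> interval_length R M A B"
    by (rule interval_length_mono) (use assms(1)[of n] in auto)
  finally show ?thesis .
qed

context module
begin

text \<open>A chain from A to C is intersected with B and enlarged by B. By
  \<open>modular_eq\<close> each strict step survives in at least one of the two traces, which
  bounds the left side. The other inequality concatenates chains. Infinite lengths are
  covered.\<close>

lemma interval_length_add:
  assumes A: "submodule A R M" and B: "submodule B R M" and C: "submodule C R M"
    and AB: "A \<subseteq> B" and BC: "B \<subseteq> C"
  shows "interval_length R M A C = interval_length R M A B + interval_length R M B C"
proof (rule antisym)
  show "interval_length R M A C \<le> interval_length R M A B + interval_length R M B C"
  proof (rule interval_length_le)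
    fix n N assume N': "submodule_chain R M A C n N"
    have N: "submodule (N i) R M" "A \<subseteq> N i" "N i \<subseteq> C" if "i \<le> n" for i
      using that N' by (simp_all add: submodule_chain_def)
    have strict: "N i \<subset> N (Suc i)" if "i < n" for i
      using that N' by (simp add: submodule_chain_def)
    let ?P = "\<lambda>i. N i \<inter> B" and ?Q = "\<lambda>i. N i <+>\<^bsub>M\<^esub> B"
    let ?S = "{i. i < n \<and> ?P i \<noteq> ?P (Suc i)}" and ?T = "{i. i < n \<and> ?Q i \<noteq> ?Q (Suc i)}"
    have "{..<n} \<subseteq> ?S \<union> ?T"
    proof
      fix i assume "i \<in> {..<n}"
      then have i: "i < n" by simp
      then have "?P i \<noteq> ?P (Suc i) \<or> ?Q i \<noteq> ?Q (Suc i)"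
        using modular_eq[OF N(1) N(1) B, of i "Suc i"] strict[OF i] by auto
      then show "i \<in> ?S \<union> ?T" using i by auto
    qed
    then have "card {..<n} \<le> card (?S \<union> ?T)" by (rule card_mono[rotated]) auto
    also have "\<dots> \<le> card ?S + card ?T" by (rule card_Un_le)
    finally have "enat n \<le> enat (card ?S) + enat (card ?T)" by simp
    also have "\<dots> \<le> interval_length R M A B + interval_length R M B C"
    proof (rule add_mono)
      show "enat (card ?S) \<le> interval_length R M A B"
      proof (rule interval_length_weak_chain)
        show "submodule (?P i) R M \<and> A \<subseteq> ?P i \<and> ?P i \<subseteq> B" if "i \<le> n" for i
          using N[OF that] submodule_Int B AB by blast
        show "?P i \<subseteq> ?P (Suc i)" if "i < n" for i
          using strict[OF that] by auto
      qed
      show "enat (card ?T) \<le> interval_length R M B C"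
      proof (rule interval_length_weak_chain)
        show "submodule (?Q i) R M \<and> B \<subseteq> ?Q i \<and> ?Q i \<subseteq> C" if "i \<le> n" for i
          using submodule_set_add[OF N(1)[OF that] B] subset_set_add(2)[OF N(1)[OF that] B]
            set_add_least[OF C N(3)[OF that] BC] by simp
        show "?Q i \<subseteq> ?Q (Suc i)" if "i < n" for i
          using strict[OF that] by (intro set_add_mono) auto
      qed
    qed
    finally show "enat n \<le> interval_length R M A B + interval_length R M B C" .
  qed
  show "interval_length R M A B + interval_length R M B C \<le> interval_length R M A C"
    unfolding interval_length_def[of R M A B] interval_length_def[of R M B C]
  proof (rule enat_Sup_add_le)
    have "submodule_chain R M A B 0 (\<lambda>_. A)" "submodule_chain R M B C 0 (\<lambda>_. B)"
      using assms by (auto simp: submodule_chain_def)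
    then show "{enat n | n. \<exists>N. submodule_chain R M A B n N} \<noteq> {}"
      "{enat n | n. \<exists>N. submodule_chain R M B C n N} \<noteq> {}" by blast+
    fix x y assume "x \<in> {enat n | n. \<exists>N. submodule_chain R M A B n N}"
      "y \<in> {enat n | n. \<exists>N. submodule_chain R M B C n N}"
    then obtain k l N L where *: "x = enat k" "y = enat l"
      and N: "submodule_chain R M A B k N" and L: "submodule_chain R M B C l L" by auto
    \<comment> \<open>\<open>N k\<close> and \<open>L 0\<close> may coincide, so \<open>L 0\<close>
      is left out: at the joint, \<open>N k\<close> \<subseteq> B \<subseteq> \<open>L 0\<close>
      \<subset> \<open>L 1\<close> keeps the step strict, and the total number of steps is still k +
      l.\<close>
    let ?P = "\<lambda>i. if i \<le> k then N i else L (i - k)"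
    have "submodule_chain R M A C (k + l) ?P"
      unfolding submodule_chain_def
    proof (intro conjI allI impI)
      fix i assume i: "i \<le> k + l"
      have NN: "submodule (N j) R M" "A \<subseteq> N j" "N j \<subseteq> B" if "j \<le> k" for j
        using that N by (simp_all add: submodule_chain_def)
      have LL: "submodule (L j) R M" "B \<subseteq> L j" "L j \<subseteq> C" if "j \<le> l" for j
        using that L by (simp_all add: submodule_chain_def)
      show "submodule (?P i) R M" "A \<subseteq> ?P i" "?P i \<subseteq> C"
        using NN[of i] LL[of "i - k"] i order_trans[OF AB] order_trans[OF _ BC] by (cases "i \<le> k"; simp)+
    next
      fix i assume i: "i < k + l"
      consider "i < k" | "i = k" | "i > k" by linarith
      then show "?P i \<subset> ?P (Suc i)"
      proof cases
        case 1
        then show ?thesis using N by (auto simp: submodule_chain_def)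
      next
        case 2
        then have "N k \<subseteq> B" "B \<subseteq> L 0" "L 0 \<subset> L (Suc 0)"
          using N L i by (auto simp: submodule_chain_def)
        then show ?thesis using 2 by auto
      next
        case 3
        then have "Suc i - k = Suc (i - k)" "i - k < l" using i by auto
        then show ?thesis using 3 L by (auto simp: submodule_chain_def)
      qed
    qed
    then show "x + y \<le> interval_length R M A C"
      using interval_length_ge * by fastforce
  qed
qed

lemma interval_length_self [simp]: "interval_length R M A A = 0"
proof -
  have "interval_length R M A A \<le> 0"
  proof (rule interval_length_le)
    fix n N assume N: "submodule_chain R M A A n N"
    have "n = 0"
    proof (rule ccontr)
      assume "n \<noteq> 0"
      then have "0 < n" "Suc 0 \<le> n" by auto
      then have "N 0 \<subset> N (Suc 0)" "N 0 = A" "N (Suc 0) = A"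
        using N unfolding submodule_chain_def by blast+
      then show False by auto
    qed
    then show "enat n \<le> 0" by (simp add: zero_enat_def)
  qed
  then show ?thesis by simp
qed

lemma interval_length_ge_1:
  assumes "submodule A R M" "submodule B R M" "A \<subset> B"
  shows "1 \<le> interval_length R M A B"
proof -
  have "submodule_chain R M A B 1 (\<lambda>i. if i = 0 then A else B)"
    using assms by (auto simp: submodule_chain_def)
  from interval_length_ge[OF this] show ?thesis by (simp add: one_enat_def)
qed

lemma interval_length_eq_0_iff:
  assumes "submodule A R M" "submodule B R M" "A \<subseteq> B"
  shows "interval_length R M A B = 0 \<longleftrightarrow> A = B"
  using interval_length_ge_1[OF assms(1,2)] assms(3) by force

text \<open>The passage from numerical equalities back to equalities of submodules; finiteness is
  what allows cancelling the common length.\<close>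

lemma interval_length_eq_imp_eq:
  assumes "submodule A R M" "submodule B R M" "submodule C R M" "A \<subseteq> B" "B \<subseteq> C"
    and "interval_length R M A C \<le> interval_length R M A B" "interval_length R M A B \<noteq> \<infinity>"
  shows "B = C"
proof -
  have "interval_length R M B C = 0"
    using interval_length_add[OF assms(1-5)] assms(6,7)
    by (cases "interval_length R M B C"; cases "interval_length R M A B") (auto simp: zero_enat_def)
  then show ?thesis using interval_length_eq_0_iff assms by blast
qed

lemma interval_length_simple:
  assumes A: "submodule A R M" and B: "submodule B R M" and "A \<subset> B"
    and simple: "\<And>N. submodule N R M \<Longrightarrow> A \<subseteq> N \<Longrightarrow> N \<subseteq> B \<Longrightarrow> N = A \<or> N = B"
  shows "interval_length R M A B = 1"
proof (rule antisym)
  show "interval_length R M A B \<le> 1"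
  proof (rule interval_length_le)
    fix n N assume N: "submodule_chain R M A B n N"
    have "\<not> 2 \<le> n"
    proof
      assume n: "2 \<le> n"
      then have "N 0 \<subset> N 1" "N 1 \<subset> N 2"
        using N by (auto simp: submodule_chain_def numeral_2_eq_2)
      moreover have "N i = A \<or> N i = B" if "i \<le> 2" for i
        using simple[of "N i"] N n that by (auto simp: submodule_chain_def)
      from this[of 0] this[of 1] this[of 2] have "N 0 = A \<or> N 0 = B" "N 1 = A \<or> N 1 = B" "N 2 = A \<or> N 2 = B"
        by auto
      ultimately show False using \<open>A \<subset> B\<close> by auto
    qed
    then show "enat n \<le> 1" by (simp add: one_enat_def)
  qed
  show "1 \<le> interval_length R M A B" using assms by (intro interval_length_ge_1)
qed

text \<open>Links the length in the hypothesis on \<open>ideal_smult R \<mm> M\<close> to intervals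
  in the submodule lattice of M itself.\<close>

lemma module_length_submodule:
  assumes L: "submodule L R M"
  shows "module_length R (M\<lparr>carrier := L\<rparr>) = interval_length R M {\<zero>\<^bsub>M\<^esub>} L"
  unfolding module_length_def interval_length_def submodule_chain_def
    submodule_carrier_update[OF L]
  using submodule_zero_mem
  by (intro arg_cong[of _ _ Sup] Collect_cong ex_cong1 conj_cong refl) auto

end

lemma interval_length_carrier_update:
  assumes "module R M" "submodule L R M" "B \<subseteq> L"
  shows "interval_length R (M\<lparr>carrier := L\<rparr>) A B = interval_length R M A B"
  unfolding interval_length_def submodule_chain_def module.submodule_carrier_update[OF assms(1,2)]
  using assms(3) by (intro arg_cong[of _ _ Sup] Collect_cong ex_cong1 conj_cong refl) auto

text \<open>The correspondence theorem: preimage and image are mutually inverse on the submodules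
  between the given ends, so strict chains correspond. The isomorphism theorems needed below are
  read off from this lemma as statements about lengths.\<close>

lemma interval_length_image:
  assumes M: "module R M" and N: "module R N" and f: "f \<in> linear_maps R M N"
    and L: "submodule L R M" and A: "submodule A R N"
    and AB: "A \<subseteq> B" and BL: "B \<subseteq> f ` L"
  shows "interval_length R M {x \<in> L. f x \<in> A} {x \<in> L. f x \<in> B} = interval_length R N A B"
proof (rule antisym)
  interpret M: module R M by fact
  interpret N: module R N by fact
  let ?v = "\<lambda>P. {x \<in> L. f x \<in> P}"
  have fv: "f ` ?v P = P" if "P \<subseteq> B" for P using that BL by auto
  \<comment> \<open>Two elements of L with the same image differ by an element of the kernel, which
    lies in \<open>?v A\<close> and hence in Q.\<close>
  have vf: "?v (f ` Q) = Q" if Q: "submodule Q R M" "?v A \<subseteq> Q" "Q \<subseteq> L" for Q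
  proof
    show "?v (f ` Q) \<subseteq> Q"
    proof
      fix x assume "x \<in> ?v (f ` Q)"
      then obtain y where y: "y \<in> Q" "f x = f y" "x \<in> L" by auto
      then have c: "x \<in> carrier M" "y \<in> carrier M" using Q M.submodule_sub[OF L] by auto
      then have "f (x \<ominus>\<^bsub>M\<^esub> y) = \<zero>\<^bsub>N\<^esub>"
        using y lin_closed[OF f c(2)] unfolding lin_minus[OF M N f c]
        by (simp add: N.minus_eq_zero_iff)
      then have "x \<ominus>\<^bsub>M\<^esub> y \<in> ?v A"
        using M.submodule_minus[OF L] y Q N.submodule_zero_mem[OF A] by auto
      then have "x \<ominus>\<^bsub>M\<^esub> y \<in> Q" using Q by auto
      then have "y \<oplus>\<^bsub>M\<^esub> (x \<ominus>\<^bsub>M\<^esub> y) \<in> Q" using M.submodule_add[OF Q(1) y(1)] by simp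
      also have "y \<oplus>\<^bsub>M\<^esub> (x \<ominus>\<^bsub>M\<^esub> y) = x"
        using c by (simp add: a_minus_def M.a_lcomm[of y x] M.r_neg)
      finally show "x \<in> Q" .
    qed
  qed (use Q in auto)
  show "interval_length R N A B \<le> interval_length R M (?v A) (?v B)"
  proof (rule interval_length_le)
    fix n P assume P: "submodule_chain R N A B n P"
    have "?v (P i) \<subset> ?v (P (Suc i))" if "i < n" for i
    proof -
      have "P i \<subset> P (Suc i)" "P i \<subseteq> B" "P (Suc i) \<subseteq> B"
        using P that by (simp_all add: submodule_chain_def)
      then have "?v (P i) \<subseteq> ?v (P (Suc i))" "?v (P i) \<noteq> ?v (P (Suc i))"
        using fv[of "P i"] fv[of "P (Suc i)"] by (blast, metis psubset_eq)
      then show ?thesis by blast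
    qed
    then have "submodule_chain R M (?v A) (?v B) n (\<lambda>i. ?v (P i))"
      using P submodule_vimage[OF M N f L] by (auto simp: submodule_chain_def)
    then show "enat n \<le> interval_length R M (?v A) (?v B)" by (rule interval_length_ge)
  qed
  show "interval_length R M (?v A) (?v B) \<le> interval_length R N A B"
  proof (rule interval_length_le)
    fix n Q assume Q: "submodule_chain R M (?v A) (?v B) n Q"
    have Qi: "submodule (Q i) R M" "?v A \<subseteq> Q i" "Q i \<subseteq> ?v B" if "i \<le> n" for i
      using Q that by (simp_all add: submodule_chain_def)
    then have QL: "Q i \<subseteq> L" if "i \<le> n" for i using that by blast
    have "submodule_chain R N A B n (\<lambda>i. f ` Q i)"
      unfolding submodule_chain_def
    proof (intro conjI allI impI)
      fix i assume i: "i \<le> n"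
      show "submodule (f ` Q i) R N" by (rule submodule_image[OF M N f Qi(1)[OF i]])
      show "A \<subseteq> f ` Q i" using Qi(2)[OF i] fv[OF AB] by blast
      show "f ` Q i \<subseteq> B" using Qi(3)[OF i] by auto
    next
      fix i assume i: "i < n"
      then have "Q i \<subset> Q (Suc i)" using Q by (auto simp: submodule_chain_def)
      moreover have "f ` Q i \<noteq> f ` Q (Suc i)"
        using vf[OF Qi(1)[of i] Qi(2)[of i] QL[of i]] i
          vf[OF Qi(1)[of "Suc i"] Qi(2)[of "Suc i"] QL[of "Suc i"]]
          \<open>Q i \<subset> Q (Suc i)\<close> by (metis Suc_leI less_imp_le_nat psubset_eq)
      ultimately show "f ` Q i \<subset> f ` Q (Suc i)" by blast
    qed
    then show "enat n \<le> interval_length R N A B" by (rule interval_length_ge)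
  qed
qed

lemma interval_length_rank_nullity:
  assumes M: "module R M" and N: "module R N" and f: "f \<in> linear_maps R M N"
    and L: "submodule L R M"
  shows "interval_length R M {\<zero>\<^bsub>M\<^esub>} L =
           interval_length R M {\<zero>\<^bsub>M\<^esub>} {x \<in> L. f x = \<zero>\<^bsub>N\<^esub>} + interval_length R N {\<zero>\<^bsub>N\<^esub>} (f ` L)"
proof -
  interpret M: module R M by fact
  interpret N: module R N by fact
  have K: "{x \<in> L. f x = \<zero>\<^bsub>N\<^esub>} = {x \<in> L. f x \<in> {\<zero>\<^bsub>N\<^esub>}}" by auto
  have L': "L = {x \<in> L. f x \<in> f ` L}" by auto
  have sub: "submodule {x \<in> L. f x \<in> {\<zero>\<^bsub>N\<^esub>}} R M"
    by (rule submodule_vimage[OF M N f L N.submodule_zero])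
  have img: "submodule (f ` L) R N" by (rule submodule_image[OF M N f L])
  have "interval_length R M {x \<in> L. f x \<in> {\<zero>\<^bsub>N\<^esub>}} {x \<in> L. f x \<in> f ` L} =
      interval_length R N {\<zero>\<^bsub>N\<^esub>} (f ` L)"
    by (rule interval_length_image[OF M N f L N.submodule_zero])
       (use N.submodule_zero_mem[OF img] in auto)
  moreover have "interval_length R M {\<zero>\<^bsub>M\<^esub>} L = interval_length R M {\<zero>\<^bsub>M\<^esub>} {x \<in> L. f x \<in> {\<zero>\<^bsub>N\<^esub>}} +
      interval_length R M {x \<in> L. f x \<in> {\<zero>\<^bsub>N\<^esub>}} L"
    by (rule M.interval_length_add[OF M.submodule_zero sub L]) (use M.submodule_zero_mem[OF sub] in auto)
  ultimately show ?thesis unfolding L'[symmetric] K by simp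
qed

section \<open>Products of ideals with modules, and finite direct powers\<close>

lemma regular_module_simps [simp]:
  "carrier (regular_module R) = carrier R"
  "\<zero>\<^bsub>regular_module R\<^esub> = \<zero>\<^bsub>R\<^esub>"
  "x \<oplus>\<^bsub>regular_module R\<^esub> y = x \<oplus>\<^bsub>R\<^esub> y"
  "a \<odot>\<^bsub>regular_module R\<^esub> x = a \<otimes>\<^bsub>R\<^esub> x"
  by (simp_all add: regular_module_def)

lemma regular_module_is_module:
  assumes "cring R"
  shows "module R (regular_module R)"
proof -
  interpret cring R by fact
  show ?thesis
  proof (rule moduleI)
    show "abelian_group (regular_module R)"
    proof (rule abelian_groupI)
      show "\<exists>y\<in>carrier (regular_module R). y \<oplus>\<^bsub>regular_module R\<^esub> x = \<zero>\<^bsub>regular_module R\<^esub>"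
        if "x \<in> carrier (regular_module R)" for x
        using that by (intro bexI[of _ "\<ominus>\<^bsub>R\<^esub> x"]) (simp_all add: l_neg)
    qed (simp_all add: a_assoc, simp add: a_comm)
  qed (simp_all add: assms l_distr r_distr m_assoc)
qed

text \<open>Maximality of \<open>\<mm>\<close> and the chain condition speak of ideals, the length
  calculus of submodules; this lemma passes between them.\<close>

lemma submodule_regular_iff:
  assumes "cring R"
  shows "submodule I R (regular_module R) \<longleftrightarrow> ideal I R"
proof -
  interpret cring R by fact
  interpret Reg: module R "regular_module R" by (rule regular_module_is_module[OF assms])
  show ?thesis
  proof
    assume I: "submodule I R (regular_module R)"
    show "ideal I R"
    proof (rule idealI)
      show "subgroup I (add_monoid R)"
      proof (rule add.subgroupI)
        fix a assume a: "a \<in> I"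
        then have "(\<ominus>\<^bsub>R\<^esub> \<one>\<^bsub>R\<^esub>) \<otimes>\<^bsub>R\<^esub> a \<in> I"
          using Reg.submodule_smult[OF I, of "\<ominus>\<^bsub>R\<^esub> \<one>\<^bsub>R\<^esub>" a] by simp
        then show "\<ominus>\<^bsub>R\<^esub> a \<in> I"
          using Reg.submodule_sub[OF I a] by (simp add: l_minus)
      qed (use Reg.submodule_sub[OF I] Reg.submodule_zero_mem[OF I] Reg.submodule_add[OF I] in auto)
      show "x \<otimes>\<^bsub>R\<^esub> a \<in> I" if "a \<in> I" "x \<in> carrier R" for a x
        using that Reg.submodule_smult[OF I] by simp
      then show "a \<otimes>\<^bsub>R\<^esub> x \<in> I" if "a \<in> I" "x \<in> carrier R" for a x
        using that Reg.submodule_sub[OF I] by (simp add: m_comm)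
    qed (rule ring_axioms)
  next
    assume "ideal I R"
    then interpret ideal I R .
    show "submodule I R (regular_module R)"
      unfolding submodule_iff[OF Reg.module_axioms] using I_l_closed a_subset by auto
  qed
qed

text \<open>\<open>ideal_smult\<close> multiplies only into the whole module. Here the second factor
  is any subset, with the span taken in the ambient M, so that m^2 and the products of m with
  syzygies are instances.\<close>

definition ideal_mult ::
    "('a, 'r) ring_scheme \<Rightarrow> 'a set \<Rightarrow> ('a, 'm, 'z) module_scheme \<Rightarrow> 'm set \<Rightarrow> 'm set" where
  "ideal_mult R I M N = span_module R M {a \<odot>\<^bsub>M\<^esub> x | a x. a \<in> I \<and> x \<in> N}"

lemma ideal_smult_eq: "ideal_smult R I M = ideal_mult R I M (carrier M)"
  by (simp add: ideal_smult_def ideal_mult_def)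

context module
begin

lemma submodule_span:
  assumes "A \<subseteq> carrier M"
  shows "submodule (span_module R M A) R M"
proof -
  let ?S = "{N. submodule N R M \<and> A \<subseteq> N}"
  have "carrier M \<in> ?S" using carrier_is_submodule assms by simp
  then have sub: "span_module R M A \<subseteq> carrier M" unfolding span_module_def by blast
  show ?thesis
    unfolding submodule_iff[OF module_axioms]
    using sub unfolding span_module_def
    by (auto intro: submodule_zero_mem submodule_add submodule_smult)
qed

lemma span_superset: "A \<subseteq> span_module R M A"
  by (auto simp: span_module_def)

lemma span_least: "submodule C R M \<Longrightarrow> A \<subseteq> C \<Longrightarrow> span_module R M A \<subseteq> C"
  by (auto simp: span_module_def)

lemma submodule_ideal_mult:
  assumes "I \<subseteq> carrier R" "N \<subseteq> carrier M"
  shows "submodule (ideal_mult R I M N) R M"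
  unfolding ideal_mult_def by (rule submodule_span) (use assms in blast)

lemma ideal_mult_mem: "a \<in> I \<Longrightarrow> x \<in> N \<Longrightarrow> a \<odot>\<^bsub>M\<^esub> x \<in> ideal_mult R I M N"
  unfolding ideal_mult_def by (rule subsetD[OF span_superset]) blast

lemma ideal_mult_least:
  assumes "submodule C R M" "\<And>a x. a \<in> I \<Longrightarrow> x \<in> N \<Longrightarrow> a \<odot>\<^bsub>M\<^esub> x \<in> C"
  shows "ideal_mult R I M N \<subseteq> C"
  unfolding ideal_mult_def by (rule span_least) (use assms in auto)

lemma ideal_mult_subset:
  assumes "I \<subseteq> carrier R" "submodule N R M"
  shows "ideal_mult R I M N \<subseteq> N"
  by (rule ideal_mult_least[OF assms(2)]) (use assms submodule_smult in blast)

lemma ideal_mult_mono: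
  assumes "I \<subseteq> carrier R" "N' \<subseteq> carrier M" "N \<subseteq> N'"
  shows "ideal_mult R I M N \<subseteq> ideal_mult R I M N'"
  by (rule ideal_mult_least[OF submodule_ideal_mult[OF assms(1,2)]])
     (use assms(3) ideal_mult_mem in blast)

end

lemma ideal_mult_image:
  assumes M: "module R M" and N: "module R N" and f: "f \<in> linear_maps R M N"
    and I: "I \<subseteq> carrier R" and L: "L \<subseteq> carrier M"
  shows "f ` ideal_mult R I M L = ideal_mult R I N (f ` L)"
proof
  interpret M: module R M by fact
  interpret N: module R N by fact
  have fL: "f ` L \<subseteq> carrier N" using L lin_closed[OF f] by auto
  have "ideal_mult R I M L \<subseteq> {x \<in> carrier M. f x \<in> ideal_mult R I N (f ` L)}"
  proof (rule M.ideal_mult_least)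
    show "submodule {x \<in> carrier M. f x \<in> ideal_mult R I N (f ` L)} R M"
      by (rule submodule_vimage[OF M N f M.carrier_is_submodule N.submodule_ideal_mult[OF I fL]])
    show "a \<odot>\<^bsub>M\<^esub> x \<in> {x \<in> carrier M. f x \<in> ideal_mult R I N (f ` L)}" if "a \<in> I" "x \<in> L" for a x
      using that I L N.ideal_mult_mem[of a I "f x" "f ` L"] lin_smult[OF f, of a x]
      by (auto simp: subset_iff)
  qed
  then show "f ` ideal_mult R I M L \<subseteq> ideal_mult R I N (f ` L)" by auto
  show "ideal_mult R I N (f ` L) \<subseteq> f ` ideal_mult R I M L"
  proof (rule N.ideal_mult_least)
    show "submodule (f ` ideal_mult R I M L) R N"
      by (rule submodule_image[OF M N f M.submodule_ideal_mult[OF I L]])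
    show "a \<odot>\<^bsub>N\<^esub> x \<in> f ` ideal_mult R I M L" if "a \<in> I" "x \<in> f ` L" for a x
    proof -
      from \<open>x \<in> f ` L\<close> obtain y where y: "y \<in> L" "x = f y" by blast
      then have "a \<odot>\<^bsub>N\<^esub> x = f (a \<odot>\<^bsub>M\<^esub> y)"
        using lin_smult[OF f subsetD[OF I \<open>a \<in> I\<close>] subsetD[OF L y(1)]] by simp
      then show ?thesis using M.ideal_mult_mem[OF \<open>a \<in> I\<close> y(1)] by simp
    qed
  qed
qed

text \<open>Encoded exactly like \<open>free_module\<close> with M in place of R. Free modules are
  then an instance (\<open>free_module_eq\<close>), and so are the powers of M that stand for Hom
  from a free module to M.\<close>

definition direct_power :: "('a, 'm, 'z) module_scheme \<Rightarrow> 'x set \<Rightarrow> ('a, 'x \<Rightarrow> 'm) module" where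
  "direct_power M X =
     \<lparr>carrier = {f. (\<forall>x. f x \<in> carrier M) \<and> (\<forall>x. x \<notin> X \<longrightarrow> f x = \<zero>\<^bsub>M\<^esub>) \<and> finite {x. f x \<noteq> \<zero>\<^bsub>M\<^esub>}},
      monoid.mult = undefined, one = undefined, ring.zero = (\<lambda>_. \<zero>\<^bsub>M\<^esub>),
      add = (\<lambda>f g x. f x \<oplus>\<^bsub>M\<^esub> g x), smult = (\<lambda>a f x. a \<odot>\<^bsub>M\<^esub> f x)\<rparr>"

lemma free_module_eq: "free_module R X = direct_power (regular_module R) X"
  by (simp add: free_module_def direct_power_def)

lemma direct_power_simps [simp]:
  "\<zero>\<^bsub>direct_power M X\<^esub> = (\<lambda>_. \<zero>\<^bsub>M\<^esub>)"
  "f \<oplus>\<^bsub>direct_power M X\<^esub> g = (\<lambda>x. f x \<oplus>\<^bsub>M\<^esub> g x)"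
  "a \<odot>\<^bsub>direct_power M X\<^esub> f = (\<lambda>x. a \<odot>\<^bsub>M\<^esub> f x)"
  by (simp_all add: direct_power_def)

lemma direct_power_carrier:
  "f \<in> carrier (direct_power M X) \<longleftrightarrow>
     (\<forall>x. f x \<in> carrier M) \<and> (\<forall>x. x \<notin> X \<longrightarrow> f x = \<zero>\<^bsub>M\<^esub>) \<and> finite {x. f x \<noteq> \<zero>\<^bsub>M\<^esub>}"
  by (simp add: direct_power_def)

lemma direct_power_carrier_finite:
  "finite X \<Longrightarrow> f \<in> carrier (direct_power M X) \<longleftrightarrow>
     (\<forall>x. f x \<in> carrier M) \<and> (\<forall>x. x \<notin> X \<longrightarrow> f x = \<zero>\<^bsub>M\<^esub>)"
  unfolding direct_power_carrier by (auto intro: finite_subset[of _ X])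

definition power_submodule :: "('a, 'm, 'z) module_scheme \<Rightarrow> 'x set \<Rightarrow> 'm set \<Rightarrow> ('x \<Rightarrow> 'm) set" where
  "power_submodule M X A = {f \<in> carrier (direct_power M X). \<forall>x. f x \<in> A}"

definition single :: "('a, 'm, 'z) module_scheme \<Rightarrow> 'x \<Rightarrow> 'm \<Rightarrow> 'x \<Rightarrow> 'm" where
  "single M x v = (\<lambda>y. if y = x then v else \<zero>\<^bsub>M\<^esub>)"

lemma single_simps [simp]: "single M x v x = v" "y \<noteq> x \<Longrightarrow> single M x v y = \<zero>\<^bsub>M\<^esub>"
  by (simp_all add: single_def)

section \<open>Coordinatewise submodules of direct powers and their lengths\<close>

context module
begin

lemma direct_power_is_module:
  fixes X :: "'x set"
  shows "module R (direct_power M X)"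
proof (rule moduleI)
  have fin_add: "finite {x. f x \<oplus>\<^bsub>M\<^esub> g x \<noteq> \<zero>\<^bsub>M\<^esub>}"
    if "finite {x. f x \<noteq> \<zero>\<^bsub>M\<^esub>}" "finite {x. g x \<noteq> \<zero>\<^bsub>M\<^esub>}" for f g :: "'x \<Rightarrow> 'c"
    by (rule finite_subset[OF _ finite_UnI[OF that]]) auto
  have fin_neg: "finite {x. \<ominus>\<^bsub>M\<^esub> f x \<noteq> \<zero>\<^bsub>M\<^esub>}" if "finite {x. f x \<noteq> \<zero>\<^bsub>M\<^esub>}" for f :: "'x \<Rightarrow> 'c"
    by (rule finite_subset[OF _ that]) auto
  show "abelian_group (direct_power M X)"
  proof (rule abelian_groupI)
    fix f assume f: "f \<in> carrier (direct_power M X)"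
    then show "\<exists>g\<in>carrier (direct_power M X). g \<oplus>\<^bsub>direct_power M X\<^esub> f = \<zero>\<^bsub>direct_power M X\<^esub>"
      by (intro bexI[of _ "\<lambda>x. \<ominus>\<^bsub>M\<^esub> f x"]) (auto simp: direct_power_carrier M.l_neg fin_neg)
  qed (auto simp: direct_power_carrier fin_add M.a_assoc intro!: ext M.a_comm)
  have "finite {x. a \<odot>\<^bsub>M\<^esub> f x \<noteq> \<zero>\<^bsub>M\<^esub>}" if "a \<in> carrier R" "finite {x. f x \<noteq> \<zero>\<^bsub>M\<^esub>}" for a and f :: "'x \<Rightarrow> 'c"
    by (rule finite_subset[OF _ that(2)]) (use that(1) in auto)
  then show "a \<odot>\<^bsub>direct_power M X\<^esub> f \<in> carrier (direct_power M X)"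
    if "a \<in> carrier R" "f \<in> carrier (direct_power M X)" for a f
    using that by (auto simp: direct_power_carrier)
qed (auto simp: direct_power_carrier R.is_cring smult_l_distr smult_r_distr smult_assoc1)

lemma submodule_power_submodule:
  assumes "submodule A R M"
  shows "submodule (power_submodule M X A) R (direct_power M X)"
proof -
  interpret P: module R "direct_power M X" by (rule direct_power_is_module)
  show ?thesis
    unfolding submodule_iff[OF P.module_axioms] power_submodule_def
    using P.zero_closed P.a_closed P.smult_closed
    by (auto simp del: P.zero_closed P.a_closed P.smult_closed
        intro: submodule_zero_mem[OF assms] submodule_add[OF assms] submodule_smult[OF assms])
qed

lemma power_submodule_carrier: "power_submodule M X (carrier M) = carrier (direct_power M X)"
  by (auto simp: power_submodule_def direct_power_carrier)

lemma power_submodule_mono: "A \<subseteq> B \<Longrightarrow> power_submodule M X A \<subseteq> power_submodule M X B"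
  by (auto simp: power_submodule_def)

lemma power_submodule_zero: "power_submodule M X {\<zero>\<^bsub>M\<^esub>} = {\<zero>\<^bsub>direct_power M X\<^esub>}"
  by (auto simp: power_submodule_def direct_power_carrier)

lemma lin_single: "x \<in> X \<Longrightarrow> single M x \<in> linear_maps R M (direct_power M X)"
  by (rule linear_mapsI) (auto simp: direct_power_carrier single_def)

lemma lin_coordinate: "(\<lambda>f. f x) \<in> linear_maps R (direct_power M X) M"
  by (rule linear_mapsI) (auto simp: direct_power_carrier)

text \<open>An element is the finite sum of its coordinate parts; the induction erases one point of
  the support at a time.\<close>

lemma direct_power_memI:
  assumes C: "submodule C R (direct_power M X)" and f: "f \<in> carrier (direct_power M X)"
    and single: "\<And>x. x \<in> X \<Longrightarrow> single M x (f x) \<in> C"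
  shows "f \<in> C"
proof -
  interpret P: module R "direct_power M X" by (rule direct_power_is_module)
  have "f \<in> C"
    if "finite Y" "Y \<subseteq> X" "f \<in> carrier (direct_power M X)" "\<And>x. x \<notin> Y \<Longrightarrow> f x = \<zero>\<^bsub>M\<^esub>"
      "\<And>x. x \<in> Y \<Longrightarrow> single M x (f x) \<in> C" for f Y
    using that
  proof (induction Y arbitrary: f rule: finite_induct)
    case empty
    then have "f = \<zero>\<^bsub>direct_power M X\<^esub>" by auto
    then show ?case using P.submodule_zero_mem[OF C] by simp
  next
    case (insert z Y)
    let ?g = "f(z := \<zero>\<^bsub>M\<^esub>)"
    have g: "?g \<in> carrier (direct_power M X)"
    proof -
      have "finite {x. ?g x \<noteq> \<zero>\<^bsub>M\<^esub>}"
        by (rule finite_subset[of _ "{x. f x \<noteq> \<zero>\<^bsub>M\<^esub>}"])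
           (use insert.prems(2) in \<open>auto simp: direct_power_carrier\<close>)
      then show ?thesis using insert.prems(2) by (simp add: direct_power_carrier)
    qed
    have "?g \<in> C"
    proof (rule insert.IH)
      show "single M x (?g x) \<in> C" if "x \<in> Y" for x
        using insert.prems(4)[of x] insert.hyps that by auto
    next
      show "?g \<in> carrier (direct_power M X)" by (rule g)
    qed (use insert.prems in auto)
    then have "?g \<oplus>\<^bsub>direct_power M X\<^esub> single M z (f z) \<in> C"
      using insert.prems(4)[of z] P.submodule_add[OF C] by blast
    moreover have "?g \<oplus>\<^bsub>direct_power M X\<^esub> single M z (f z) = f"
      using insert.prems(2) by (auto simp: direct_power_carrier single_def)
    ultimately show ?case by simp
  qed
  note this[of "{x. f x \<noteq> \<zero>\<^bsub>M\<^esub>}" f]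
  moreover have "{x. f x \<noteq> \<zero>\<^bsub>M\<^esub>} \<subseteq> X" "finite {x. f x \<noteq> \<zero>\<^bsub>M\<^esub>}"
    using f by (auto simp: direct_power_carrier)
  ultimately show ?thesis using f single by blast
qed

text \<open>The inclusion of the right side needs finite supports: each coordinate part lies in the
  image of I N under a coordinate embedding, and \<open>direct_power_memI\<close> reassembles the
  parts.\<close>

lemma ideal_mult_power:
  assumes I: "I \<subseteq> carrier R" and N: "submodule N R M"
  shows "ideal_mult R I (direct_power M X) (power_submodule M X N) =
           power_submodule M X (ideal_mult R I M N)"
proof
  interpret P: module R "direct_power M X" by (rule direct_power_is_module)
  have sub: "N \<subseteq> carrier M" using submodule_sub[OF N] by auto
  have subP: "power_submodule M X N \<subseteq> carrier (direct_power M X)"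
    by (auto simp: power_submodule_def)
  show "ideal_mult R I (direct_power M X) (power_submodule M X N) \<subseteq>
      power_submodule M X (ideal_mult R I M N)"
  proof (rule P.ideal_mult_least[OF submodule_power_submodule[OF submodule_ideal_mult[OF I sub]]])
    fix a f assume a: "a \<in> I" and f: "f \<in> power_submodule M X N"
    then have "a \<odot>\<^bsub>direct_power M X\<^esub> f \<in> carrier (direct_power M X)"
      using P.smult_closed[of a f] I subP by blast
    then show "a \<odot>\<^bsub>direct_power M X\<^esub> f \<in> power_submodule M X (ideal_mult R I M N)"
      using f ideal_mult_mem[OF a] by (auto simp: power_submodule_def)
  qed
  show "power_submodule M X (ideal_mult R I M N) \<subseteq>
      ideal_mult R I (direct_power M X) (power_submodule M X N)"
  proof
    fix f assume f: "f \<in> power_submodule M X (ideal_mult R I M N)"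
    show "f \<in> ideal_mult R I (direct_power M X) (power_submodule M X N)"
    proof (rule direct_power_memI[OF P.submodule_ideal_mult[OF I subP]])
      fix x assume x: "x \<in> X"
      have "f x \<in> ideal_mult R I M N" using f by (auto simp: power_submodule_def)
      then have "single M x (f x) \<in> single M x ` ideal_mult R I M N" by simp
      also have "\<dots> = ideal_mult R I (direct_power M X) (single M x ` N)"
        by (rule ideal_mult_image[OF module_axioms P.module_axioms lin_single[OF x] I sub])
      also have "\<dots> \<subseteq> ideal_mult R I (direct_power M X) (power_submodule M X N)"
      proof (rule P.ideal_mult_mono[OF I subP])
        show "single M x ` N \<subseteq> power_submodule M X N"
          using lin_closed[OF lin_single[OF x]] sub submodule_zero_mem[OF N]
          by (auto simp: power_submodule_def single_def)
      qed
      finally show "single M x (f x) \<in> ideal_mult R I (direct_power M X) (power_submodule M X N)" .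
    qed (use f in \<open>simp add: power_submodule_def\<close>)
  qed
qed

text \<open>Induction on the number of coordinates, with the interval from A^(n+1) to B^(n+1) cut at
  the tuples whose last coordinate lies in A. Above the cut the last coordinate map sees B / A,
  below it dropping that coordinate sees the case n.\<close>

lemma interval_length_power:
  assumes A: "submodule A R M" and B: "submodule B R M" and AB: "A \<subseteq> B"
  shows "interval_length R (direct_power M {..<n::nat}) (power_submodule M {..<n} A)
           (power_submodule M {..<n} B) = enat n * interval_length R M A B"
proof (induction n)
  case 0
  have eq: "power_submodule M {..<0::nat} A = power_submodule M {..<0} B"
    using submodule_zero_mem[OF A] submodule_zero_mem[OF B]
    by (auto simp: power_submodule_def direct_power_carrier_finite)
  interpret P: module R "direct_power M {..<0::nat}" by (rule direct_power_is_module)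
  show ?case unfolding eq P.interval_length_self by (simp add: zero_enat_def[symmetric])
next
  case (Suc n)
  let ?P = "direct_power M {..<Suc n}" and ?P' = "direct_power M {..<n}"
  let ?s = "power_submodule M {..<Suc n}" and ?s' = "power_submodule M {..<n}"
  interpret P: module R ?P by (rule direct_power_is_module)
  interpret P': module R ?P' by (rule direct_power_is_module)
  let ?C = "{f \<in> ?s B. f n \<in> A}"
  have sA: "submodule (?s A) R ?P" and sB: "submodule (?s B) R ?P"
    using A B by (auto intro: submodule_power_submodule)
  have C: "submodule ?C R ?P"
    by (rule submodule_vimage[OF P.module_axioms module_axioms lin_coordinate sB A])
  have subB: "x \<in> carrier M" if "x \<in> B" for x using submodule_sub[OF B that] .
  have "interval_length R ?P ?C (?s B) = interval_length R M A B"
  proof -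
    have "(\<lambda>f. f n) ` ?s B = B"
    proof
      show "B \<subseteq> (\<lambda>f. f n) ` ?s B"
      proof
        fix x assume x: "x \<in> B"
        then have "single M n x \<in> ?s B"
          using submodule_zero_mem[OF B] subB[OF x]
          by (auto simp: power_submodule_def direct_power_carrier_finite single_def)
        then show "x \<in> (\<lambda>f. f n) ` ?s B" by (force intro: image_eqI[of _ _ "single M n x"])
      qed
    qed (auto simp: power_submodule_def)
    moreover have "?s B = {f \<in> ?s B. f n \<in> B}" by (auto simp: power_submodule_def)
    ultimately show ?thesis
      using interval_length_image[OF P.module_axioms module_axioms lin_coordinate[of n] sB A AB] by simp
  qed
  moreover have "interval_length R ?P (?s A) ?C = interval_length R ?P' (?s' A) (?s' B)"
  proof -
    \<comment> \<open>Elements are functions on all of \<open>nat\<close>, so dropping coordinate n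
      means overwriting it by zero.\<close>
    let ?t = "\<lambda>f. f(n := \<zero>\<^bsub>M\<^esub>)"
    have t: "?t \<in> linear_maps R ?P ?P'"
      by (rule linear_mapsI) (auto simp: direct_power_carrier_finite)
    have "?s' B \<subseteq> ?t ` ?C"
    proof
      fix f assume f: "f \<in> ?s' B"
      show "f \<in> ?t ` ?C"
      proof (rule image_eqI[where x = f])
        show "f = ?t f" using f by (auto simp: power_submodule_def direct_power_carrier_finite)
        show "f \<in> ?C"
          using f submodule_zero_mem[OF A] by (auto simp: power_submodule_def direct_power_carrier_finite)
      qed
    qed
    from interval_length_image[OF P.module_axioms P'.module_axioms t C
      submodule_power_submodule[OF A] power_submodule_mono[OF AB] this]
    have "interval_length R ?P {f \<in> ?C. ?t f \<in> ?s' A} {f \<in> ?C. ?t f \<in> ?s' B} =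
        interval_length R ?P' (?s' A) (?s' B)" .
    moreover have iff: "?t f \<in> ?s' D \<longleftrightarrow> (\<forall>x. x \<noteq> n \<longrightarrow> f x \<in> D)"
      if "submodule D R M" "f \<in> carrier ?P" for f D
      using submodule_zero_mem[OF that(1)] that(2)
      by (auto simp: power_submodule_def direct_power_carrier_finite split: if_splits)
    have "{f \<in> ?C. ?t f \<in> ?s' A} = ?s A"
    proof (rule Set.set_eqI)
      fix f
      show "f \<in> {f \<in> ?C. ?t f \<in> ?s' A} \<longleftrightarrow> f \<in> ?s A"
        using iff[OF A, of f] AB unfolding power_submodule_def[of M "{..<Suc n}"]
        by (auto simp del: fun_upd_apply)
    qed
    moreover have "{f \<in> ?C. ?t f \<in> ?s' B} = ?C"
    proof (rule Set.set_eqI)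
      fix f
      show "f \<in> {f \<in> ?C. ?t f \<in> ?s' B} \<longleftrightarrow> f \<in> ?C"
        using iff[OF B, of f] unfolding power_submodule_def[of M "{..<Suc n}"]
        by (auto simp del: fun_upd_apply)
    qed
    ultimately show ?thesis by simp
  qed
  moreover have "interval_length R ?P (?s A) (?s B) =
      interval_length R ?P (?s A) ?C + interval_length R ?P ?C (?s B)"
    by (rule P.interval_length_add[OF sA C sB]) (use AB in \<open>auto simp: power_submodule_def\<close>)
  moreover have "enat (Suc n) * interval_length R M A B = enat n * interval_length R M A B + interval_length R M A B"
    by (simp add: eSuc_enat[symmetric] mult_eSuc add.commute)
  ultimately show ?case using Suc.IH by simp
qed

end

section \<open>Universal property and projectivity of free modules\<close>

lemma free_module_lin_eq:
  assumes "cring R" and N: "module R N" and f: "f \<in> linear_maps R (free_module R X) N"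
    and g: "g \<in> linear_maps R (free_module R X) N"
    and eq: "\<And>x. x \<in> X \<Longrightarrow> f (single (regular_module R) x \<one>\<^bsub>R\<^esub>) = g (single (regular_module R) x \<one>\<^bsub>R\<^esub>)"
    and u: "u \<in> carrier (free_module R X)"
  shows "f u = g u"
proof -
  interpret Reg: module R "regular_module R" by (rule regular_module_is_module) fact
  interpret N: module R N by fact
  interpret F: module R "free_module R X" by (rule free_module_is_module) fact
  have C: "submodule {u \<in> carrier (free_module R X). f u \<ominus>\<^bsub>N\<^esub> g u \<in> {\<zero>\<^bsub>N\<^esub>}} R (free_module R X)"
    by (rule submodule_vimage[OF F.module_axioms N lin_diff[OF N f g] F.carrier_is_submodule N.submodule_zero])
  have "u \<in> {u \<in> carrier (free_module R X). f u \<ominus>\<^bsub>N\<^esub> g u \<in> {\<zero>\<^bsub>N\<^esub>}}"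
    unfolding free_module_eq
  proof (rule Reg.direct_power_memI[OF C[unfolded free_module_eq]], goal_cases)
    case 1
    show ?case using u by (simp add: free_module_eq)
  next
    case (2 x)
    let ?e = "single (regular_module R) x \<one>\<^bsub>R\<^esub>"
    have e: "?e \<in> carrier (free_module R X)"
      using lin_closed[OF Reg.lin_single[OF 2], of "\<one>\<^bsub>R\<^esub>"] by (simp add: free_module_eq)
    have ux: "u x \<in> carrier R" using u by (simp add: free_module_def)
    have s: "single (regular_module R) x (u x) = u x \<odot>\<^bsub>free_module R X\<^esub> ?e"
      using ux by (auto simp: free_module_eq single_def)
    have "f (single (regular_module R) x (u x)) = g (single (regular_module R) x (u x))"
      unfolding s using lin_smult[OF f ux e] lin_smult[OF g ux e] eq[OF 2] by simp
    moreover have "single (regular_module R) x (u x) \<in> carrier (free_module R X)"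
      unfolding s using ux e by simp
    ultimately show ?case
      using lin_closed[OF f] lin_closed[OF g] by (simp add: N.minus_eq_zero_iff free_module_eq)
  qed
  then show ?thesis using u lin_closed[OF f] lin_closed[OF g] by (simp add: N.minus_eq_zero_iff)
qed

lemma free_module_lift:
  assumes N: "module R N" and y: "\<And>x. x \<in> X \<Longrightarrow> y x \<in> carrier N"
  shows "\<exists>h \<in> linear_maps R (free_module R X) N.
           \<forall>x\<in>X. h (single (regular_module R) x \<one>\<^bsub>R\<^esub>) = y x"
proof -
  interpret N: module R N by fact
  interpret F: module R "free_module R X" by (rule free_module_is_module) (rule N.R.is_cring)
  define h where "h f = (\<Oplus>\<^bsub>N\<^esub>x\<in>{x. f x \<noteq> \<zero>\<^bsub>R\<^esub>}. f x \<odot>\<^bsub>N\<^esub> y x)" for f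
  have F: "\<And>x. f x \<in> carrier R" "\<And>x. x \<notin> X \<Longrightarrow> f x = \<zero>\<^bsub>R\<^esub>" "finite {x. f x \<noteq> \<zero>\<^bsub>R\<^esub>}"
    if "f \<in> carrier (free_module R X)" for f
    using that by (auto simp: free_module_def)
  have h_eq: "h f = (\<Oplus>\<^bsub>N\<^esub>x\<in>A. f x \<odot>\<^bsub>N\<^esub> y x)"
    if "f \<in> carrier (free_module R X)" "finite A" "{x. f x \<noteq> \<zero>\<^bsub>R\<^esub>} \<subseteq> A" "A \<subseteq> X" for f A
    unfolding h_def
    by (rule N.M.add.finprod_mono_neutral_cong_left)
       (use F[OF that(1)] that y in \<open>auto simp: subset_iff\<close>)
  have "h \<in> linear_maps R (free_module R X) N"
  proof (rule linear_mapsI)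
    show "h f \<in> carrier N" if "f \<in> carrier (free_module R X)" for f
      unfolding h_def by (rule N.M.finsum_closed) (use F[OF that] y in blast)
  next
    fix f g assume f: "f \<in> carrier (free_module R X)" and g: "g \<in> carrier (free_module R X)"
    let ?A = "{x. f x \<noteq> \<zero>\<^bsub>R\<^esub>} \<union> {x. g x \<noteq> \<zero>\<^bsub>R\<^esub>}"
    have A: "finite ?A" "?A \<subseteq> X" using F[OF f] F[OF g] by auto
    have "{x. (f \<oplus>\<^bsub>free_module R X\<^esub> g) x \<noteq> \<zero>\<^bsub>R\<^esub>} \<subseteq> ?A" by (auto simp: free_module_def)
    then have "h (f \<oplus>\<^bsub>free_module R X\<^esub> g) = (\<Oplus>\<^bsub>N\<^esub>x\<in>?A. (f \<oplus>\<^bsub>free_module R X\<^esub> g) x \<odot>\<^bsub>N\<^esub> y x)"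
      using h_eq[OF F.M.a_closed[OF f g] A(1) _ A(2)] by blast
    also have "\<dots> = (\<Oplus>\<^bsub>N\<^esub>x\<in>?A. f x \<odot>\<^bsub>N\<^esub> y x \<oplus>\<^bsub>N\<^esub> g x \<odot>\<^bsub>N\<^esub> y x)"
      by (rule N.M.finsum_cong')
         (use A F(1)[OF f] F(1)[OF g] y in \<open>auto simp: free_module_def N.smult_l_distr\<close>)
    also have "\<dots> = (\<Oplus>\<^bsub>N\<^esub>x\<in>?A. f x \<odot>\<^bsub>N\<^esub> y x) \<oplus>\<^bsub>N\<^esub> (\<Oplus>\<^bsub>N\<^esub>x\<in>?A. g x \<odot>\<^bsub>N\<^esub> y x)"
      by (rule N.M.finsum_addf) (use A F[OF f] F[OF g] y in blast)+
    also have "\<dots> = h f \<oplus>\<^bsub>N\<^esub> h g" using h_eq[OF f A(1) _ A(2)] h_eq[OF g A(1) _ A(2)] by auto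
    finally show "h (f \<oplus>\<^bsub>free_module R X\<^esub> g) = h f \<oplus>\<^bsub>N\<^esub> h g" .
  next
    fix a f assume a: "a \<in> carrier R" and f: "f \<in> carrier (free_module R X)"
    let ?A = "{x. f x \<noteq> \<zero>\<^bsub>R\<^esub>}"
    have A: "finite ?A" "?A \<subseteq> X" using F[OF f] by auto
    have "{x. (a \<odot>\<^bsub>free_module R X\<^esub> f) x \<noteq> \<zero>\<^bsub>R\<^esub>} \<subseteq> ?A" using a by (auto simp: free_module_def)
    then have "h (a \<odot>\<^bsub>free_module R X\<^esub> f) = (\<Oplus>\<^bsub>N\<^esub>x\<in>?A. (a \<odot>\<^bsub>free_module R X\<^esub> f) x \<odot>\<^bsub>N\<^esub> y x)"
      using h_eq[OF F.smult_closed[OF a f] A(1) _ A(2)] by blast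
    also have "\<dots> = (\<Oplus>\<^bsub>N\<^esub>x\<in>?A. a \<odot>\<^bsub>N\<^esub> (f x \<odot>\<^bsub>N\<^esub> y x))"
      by (rule N.M.finsum_cong')
         (use a A F(1)[OF f] y in \<open>auto simp: free_module_def N.smult_assoc1\<close>)
    also have "\<dots> = a \<odot>\<^bsub>N\<^esub> h f"
      unfolding h_def by (rule N.finsum_smult_ldistr[symmetric]) (use a A F[OF f] y in blast)+
    finally show "h (a \<odot>\<^bsub>free_module R X\<^esub> f) = a \<odot>\<^bsub>N\<^esub> h f" .
  qed
  moreover have "h (single (regular_module R) x \<one>\<^bsub>R\<^esub>) = y x" if x: "x \<in> X" for x
  proof -
    let ?e = "single (regular_module R) x \<one>\<^bsub>R\<^esub>"
    have "?e \<in> carrier (free_module R X)"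
      using x by (auto simp: free_module_def single_def)
    then have "h ?e = (\<Oplus>\<^bsub>N\<^esub>z\<in>{x}. ?e z \<odot>\<^bsub>N\<^esub> y z)"
      by (rule h_eq) (use x in \<open>auto simp: single_def\<close>)
    also have "\<dots> = y x" using y[OF x] by simp
    finally show ?thesis .
  qed
  ultimately show ?thesis by blast
qed

text \<open>The map p need not be onto; it is enough that f lands in its image. This is the form
  required when p is a differential and f takes values in the cycles.\<close>

lemma free_module_projective:
  assumes L: "module R L" and N: "module R N" and f: "f \<in> linear_maps R (free_module R X) N"
    and p: "p \<in> linear_maps R L N" and sub: "f ` carrier (free_module R X) \<subseteq> p ` carrier L"
  shows "\<exists>h \<in> linear_maps R (free_module R X) L. \<forall>u\<in>carrier (free_module R X). p (h u) = f u"
proof -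
  interpret L: module R L by fact
  let ?e = "\<lambda>x. single (regular_module R) x \<one>\<^bsub>R\<^esub>"
  have e: "?e x \<in> carrier (free_module R X)" if "x \<in> X" for x
    using that by (auto simp: free_module_def single_def)
  have "\<exists>z. z \<in> carrier L \<and> p z = f (?e x)" if "x \<in> X" for x
  proof -
    have "f (?e x) \<in> p ` carrier L" using e[OF that] sub by blast
    then show ?thesis by (metis imageE)
  qed
  then obtain y where y: "\<And>x. x \<in> X \<Longrightarrow> y x \<in> carrier L \<and> p (y x) = f (?e x)" by metis
  from free_module_lift[OF L, of X y] y
  obtain h where h: "h \<in> linear_maps R (free_module R X) L" "\<And>x. x \<in> X \<Longrightarrow> h (?e x) = y x" by blast
  have "p (h u) = f u" if "u \<in> carrier (free_module R X)" for u
    by (rule free_module_lin_eq[OF L.R.is_cring N lin_comp[OF h(1) p] f _ that]) (simp add: h(2) y)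
  then show ?thesis using h(1) by blast
qed

section \<open>Local rings with vanishing cube of the maximal ideal\<close>

locale cube_zero_local_ring = noetherian_local_ring R \<mm> for R (structure) and \<mm> +
  assumes cube_zero: "\<mm> [^]\<^bsub>ideals_set R\<^esub> (3::nat) = {\<zero>}"
begin

abbreviation "Reg \<equiv> regular_module R"
text \<open>The square of m, as a submodule of the regular module; the power in
  \<open>ideals_set\<close> that occurs in the hypotheses is reached elementwise through
  \<open>m_mult_mem_sq\<close>.\<close>

abbreviation "msq \<equiv> ideal_mult R \<mm> Reg \<mm>"
abbreviation F :: "nat \<Rightarrow> ('a, nat \<Rightarrow> 'a) module" where "F n \<equiv> free_module R {..<n}"
abbreviation mF :: "nat \<Rightarrow> (nat \<Rightarrow> 'a) set" where "mF n \<equiv> power_submodule Reg {..<n} \<mm>"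
abbreviation m2F :: "nat \<Rightarrow> (nat \<Rightarrow> 'a) set" where "m2F n \<equiv> power_submodule Reg {..<n} msq"

sublocale Reg: module R Reg
  by (rule regular_module_is_module[OF is_cring])

sublocale m: maximalideal \<mm> R by (rule maximalideal)

lemma m_carrier: "a \<in> \<mm> \<Longrightarrow> a \<in> carrier R"
  using m.a_subset by auto

lemma m_subset: "\<mm> \<subseteq> carrier R"
  using m.a_subset .

lemma submodule_m: "submodule \<mm> R Reg"
  using submodule_regular_iff[OF is_cring] m.is_ideal by simp

lemma submodule_msq: "submodule msq R Reg"
  by (rule Reg.submodule_ideal_mult) (simp_all add: m_subset)

lemma F_module: "module R (F n)"
  by (rule free_module_is_module[OF is_cring])

lemma m_mult_mem_sq: "a \<in> \<mm> \<Longrightarrow> b \<in> \<mm> \<Longrightarrow> a \<otimes> b \<in> \<mm> [^]\<^bsub>ideals_set R\<^esub> (2::nat)"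
proof -
  assume ab: "a \<in> \<mm>" "b \<in> \<mm>"
  interpret I: comm_monoid "ideals_set R" by (rule ideals_set_is_comm_monoid)
  have "\<mm> \<in> carrier (ideals_set R)" using m.is_ideal by (simp add: ideals_set_def)
  then have "\<mm> [^]\<^bsub>ideals_set R\<^esub> (2::nat) = ideal_prod R \<mm> \<mm>"
    using ideal_prod_commute[OF oneideal m.is_ideal] ideal_prod_one[OF m.is_ideal]
    by (simp add: numeral_2_eq_2 ideals_set_def)
  then show ?thesis using ideal_prod.prod[OF ab] by simp
qed

lemma m_mult3: "a \<in> \<mm> \<Longrightarrow> b \<in> \<mm> \<Longrightarrow> c \<in> \<mm> \<Longrightarrow> a \<otimes> b \<otimes> c = \<zero>"
proof -
  assume abc: "a \<in> \<mm>" "b \<in> \<mm>" "c \<in> \<mm>"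
  interpret I: comm_monoid "ideals_set R" by (rule ideals_set_is_comm_monoid)
  have "\<mm> [^]\<^bsub>ideals_set R\<^esub> (3::nat) = ideal_prod R (\<mm> [^]\<^bsub>ideals_set R\<^esub> (2::nat)) \<mm>"
    by (simp only: numeral_3_eq_3 numeral_2_eq_2 nat_pow_Suc) (simp add: ideals_set_def)
  then show ?thesis using ideal_prod.prod[OF m_mult_mem_sq[OF abc(1,2)] abc(3)] cube_zero by auto
qed

text \<open>Maximality gives 1 = a + r x with a in m, and r x = 1 - a is inverted by the geometric
  sum 1 + a + a^2, because a^3 = 0.\<close>

lemma unit_if_notin_m:
  assumes x: "x \<in> carrier R" "x \<notin> \<mm>"
  shows "\<exists>y\<in>carrier R. y \<otimes> x = \<one>"
proof -
  let ?J = "\<mm> <+>\<^bsub>R\<^esub> PIdl x"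
  have J: "ideal ?J R" using add_ideals[OF m.is_ideal cgenideal_ideal[OF x(1)]] .
  have sub: "\<mm> \<subseteq> ?J"
  proof
    fix a assume a: "a \<in> \<mm>"
    have "\<zero> \<in> PIdl x" using additive_subgroup.zero_closed ideal.axioms(1) cgenideal_ideal[OF x(1)] by blast
    then show "a \<in> ?J" unfolding set_add_def'
      by (intro UN_I[OF a] UN_I[of \<zero>]) (use m_carrier[OF a] in auto)
  qed
  have "x \<in> ?J"
    unfolding set_add_def'
    by (intro UN_I[OF m.zero_closed] UN_I[OF cgenideal_self[OF x(1)]]) (use x in auto)
  with x have "?J \<noteq> \<mm>" by auto
  then have "?J = carrier R" using m.I_maximal[OF J sub] ideal.Icarr[OF J] by auto
  then have "\<one> \<in> ?J" by simp
  then obtain a r where a: "a \<in> \<mm>" and r: "r \<in> carrier R" and eq: "\<one> = a \<oplus> r \<otimes> x"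
    unfolding set_add_def' cgenideal_def by auto
  note ac = m_carrier[OF a]
  have "r \<otimes> x = \<one> \<ominus> a" unfolding eq using ac r x by algebra
  then have "((\<one> \<oplus> a \<oplus> a \<otimes> a) \<otimes> r) \<otimes> x = (\<one> \<oplus> a \<oplus> a \<otimes> a) \<otimes> (\<one> \<ominus> a)"
    using ac r x by (simp add: m_assoc)
  also have "\<dots> = \<one> \<ominus> a \<otimes> a \<otimes> a" using ac by algebra
  also have "\<dots> = \<one>" unfolding m_mult3[OF a a a] by (simp add: minus_eq)
  finally show ?thesis using ac r by (intro bexI[of _ "(\<one> \<oplus> a \<oplus> a \<otimes> a) \<otimes> r"]) auto
qed

lemma one_notin_m: "\<one> \<notin> \<mm>"
  using m.I_notcarr m.one_imp_carrier by blast

lemma smult_unit_cancel: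
  assumes "module R M" "submodule N R M" "x \<in> carrier M" "c \<in> carrier R" "c \<notin> \<mm>" "c \<odot>\<^bsub>M\<^esub> x \<in> N"
  shows "x \<in> N"
proof -
  interpret M: module R M by fact
  obtain y where y: "y \<in> carrier R" "y \<otimes> c = \<one>" using unit_if_notin_m assms by blast
  have "x = y \<odot>\<^bsub>M\<^esub> (c \<odot>\<^bsub>M\<^esub> x)"
    using y assms by (simp flip: M.smult_assoc1)
  then show ?thesis using M.submodule_smult[OF assms(2) y(1) assms(6)] by simp
qed

lemma smult_m3:
  assumes "module R M" "a \<in> \<mm>" "b \<in> \<mm>" "c \<in> \<mm>" "x \<in> carrier M"
  shows "a \<odot>\<^bsub>M\<^esub> (b \<odot>\<^bsub>M\<^esub> (c \<odot>\<^bsub>M\<^esub> x)) = \<zero>\<^bsub>M\<^esub>"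
proof -
  interpret M: module R M by fact
  have "a \<odot>\<^bsub>M\<^esub> (b \<odot>\<^bsub>M\<^esub> (c \<odot>\<^bsub>M\<^esub> x)) = (a \<otimes> b \<otimes> c) \<odot>\<^bsub>M\<^esub> x"
    using assms m_carrier by (simp add: M.smult_assoc1)
  then show ?thesis using m_mult3[OF assms(2-4)] assms(5) by simp
qed

lemma m_msq:
  assumes "a \<in> \<mm>" "b \<in> msq" shows "a \<otimes> b = \<zero>"
proof -
  have "msq \<subseteq> {b \<in> carrier R. a \<odot>\<^bsub>Reg\<^esub> b \<in> {\<zero>\<^bsub>Reg\<^esub>}}"
  proof (rule Reg.ideal_mult_least)
    show "submodule {b \<in> carrier R. a \<odot>\<^bsub>Reg\<^esub> b \<in> {\<zero>\<^bsub>Reg\<^esub>}} R Reg"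
      using submodule_vimage[OF Reg.module_axioms Reg.module_axioms
          lin_smult_left[OF Reg.module_axioms m_carrier[OF assms(1)]] Reg.carrier_is_submodule Reg.submodule_zero]
      by simp
    show "b \<odot>\<^bsub>Reg\<^esub> c \<in> {b \<in> carrier R. a \<odot>\<^bsub>Reg\<^esub> b \<in> {\<zero>\<^bsub>Reg\<^esub>}}" if "b \<in> \<mm>" "c \<in> \<mm>" for b c
      using m_mult3[OF assms(1) that] that m_carrier assms(1) by (simp add: m_assoc)
  qed
  then show ?thesis using assms(2) by auto
qed

lemma msq_subset: "msq \<subseteq> \<mm>"
  by (rule Reg.ideal_mult_subset[OF m_subset submodule_m])

text \<open>The quotient of A + R x by A is a copy of the residue field: an element a + c x outside
  A has a coefficient c outside m, and cancelling this unit recovers x.\<close>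

lemma interval_length_step:
  assumes "module R M" "submodule A R M" "x \<in> carrier M" "x \<notin> A" "\<And>a. a \<in> \<mm> \<Longrightarrow> a \<odot>\<^bsub>M\<^esub> x \<in> A"
  shows "interval_length R M A (A <+>\<^bsub>M\<^esub> (\<lambda>a. a \<odot>\<^bsub>M\<^esub> x) ` carrier R) = 1"
proof -
  interpret M: module R M by fact
  let ?C = "(\<lambda>a. a \<odot>\<^bsub>M\<^esub> x) ` carrier R"
  let ?B = "A <+>\<^bsub>M\<^esub> ?C"
  note C = M.submodule_cyclic[OF assms(3)]
  note sub = M.subset_set_add[OF assms(2) C(1)]
  show ?thesis
  proof (rule M.interval_length_simple[OF assms(2) M.submodule_set_add[OF assms(2) C(1)]])
    show "A \<subset> ?B" using sub C(2) assms(4) by blast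
    fix N assume N: "submodule N R M" "A \<subseteq> N" "N \<subseteq> ?B"
    show "N = A \<or> N = ?B"
    proof (cases "N \<subseteq> A")
      case True then show ?thesis using N by blast
    next
      case False
      then obtain y where y: "y \<in> N" "y \<notin> A" by blast
      then obtain a c where ac: "a \<in> A" "c \<in> carrier R" "y = a \<oplus>\<^bsub>M\<^esub> c \<odot>\<^bsub>M\<^esub> x"
        using N(3) by (auto simp: set_add_def')
      have "c \<notin> \<mm>" using ac y M.submodule_add[OF assms(2) ac(1)] assms(5)[of c] by blast
      moreover have "c \<odot>\<^bsub>M\<^esub> x \<in> N"
        using M.submodule_cancel_left[OF N(1), of a "c \<odot>\<^bsub>M\<^esub> x"] ac y(1) N(2) assms(3) by auto
      ultimately have "x \<in> N" using smult_unit_cancel[OF assms(1) N(1) assms(3) ac(2)] by blast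
      then have "?C \<subseteq> N" using M.submodule_smult[OF N(1)] by auto
      then have "?B \<subseteq> N" by (rule M.set_add_least[OF N(1,2)])
      then show ?thesis using N(3) by blast
    qed
  qed
qed

text \<open>Otherwise every element of L outside A could be multiplied by some element of m and stay
  outside A. Doing this three times contradicts m^3 = 0.\<close>

lemma exists_relative_socle_element:
  assumes "module R M" "submodule A R M" "submodule L R M" "A \<subset> L"
  shows "\<exists>x\<in>L. x \<notin> A \<and> (\<forall>a\<in>\<mm>. a \<odot>\<^bsub>M\<^esub> x \<in> A)"
proof (rule ccontr)
  assume "\<not> ?thesis"
  then have *: "\<exists>a\<in>\<mm>. a \<odot>\<^bsub>M\<^esub> x \<notin> A" if "x \<in> L" "x \<notin> A" for x using that by blast
  interpret M: module R M by fact
  have L: "a \<odot>\<^bsub>M\<^esub> x \<in> L" if "a \<in> \<mm>" "x \<in> L" for a x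
    using M.submodule_smult[OF assms(3) m_carrier[OF that(1)] that(2)] .
  obtain x where x: "x \<in> L" "x \<notin> A" using assms(4) by blast
  obtain a where a: "a \<in> \<mm>" "a \<odot>\<^bsub>M\<^esub> x \<notin> A" using *[OF x] by blast
  obtain b where b: "b \<in> \<mm>" "b \<odot>\<^bsub>M\<^esub> (a \<odot>\<^bsub>M\<^esub> x) \<notin> A" using *[OF L[OF a(1) x(1)] a(2)] by blast
  obtain c where c: "c \<in> \<mm>" "c \<odot>\<^bsub>M\<^esub> (b \<odot>\<^bsub>M\<^esub> (a \<odot>\<^bsub>M\<^esub> x)) \<notin> A"
    using *[OF L[OF b(1) L[OF a(1) x(1)]] b(2)] by blast
  then show False
    using smult_m3[OF assms(1) c(1) b(1) a(1) M.submodule_sub[OF assms(3) x(1)]]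
      M.submodule_zero_mem[OF assms(2)] by simp
qed

text \<open>A nonempty chain of ideals contains its union, by \<open>ideal_chain_is_trivial\<close>,
  so Zorn provides a maximal ideal among the counterexamples.\<close>

lemma ideal_noetherian_induct:
  assumes "ideal I R" and step: "\<And>I. ideal I R \<Longrightarrow> (\<And>J. ideal J R \<Longrightarrow> I \<subset> J \<Longrightarrow> P J) \<Longrightarrow> P I"
  shows "P I"
proof (rule ccontr)
  assume "\<not> P I"
  define S where "S = {I. ideal I R \<and> \<not> P I}"
  have "\<exists>U\<in>S. \<forall>X\<in>C. X \<subseteq> U" if "subset.chain S C" for C
  proof (cases "C = {}")
    case True
    then show ?thesis using assms(1) \<open>\<not> P I\<close> by (auto simp: S_def)
  next
    case False
    have "subset.chain {I. ideal I R} C" "C \<subseteq> S"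
      using that by (auto simp: subset.chain_def S_def)
    then show ?thesis using ideal_chain_is_trivial[OF False] by blast
  qed
  then have "\<exists>K\<in>S. \<forall>X\<in>S. K \<subseteq> X \<longrightarrow> X = K" by (rule subset_Zorn)
  then obtain K where K: "K \<in> S" "\<And>X. X \<in> S \<Longrightarrow> K \<subseteq> X \<Longrightarrow> X = K" by blast
  have "P K" by (rule step) (use K in \<open>auto simp: S_def\<close>)
  then show False using K by (auto simp: S_def)
qed

text \<open>A composition series from I up to R in the form of an induction: each step enlarges I by
  one relative socle element, so the quotient is simple. Both finiteness of length R and the length
  formula for E are proved along it.\<close>

lemma submodule_induct [consumes 1, case_names top step]:
  assumes "submodule I R Reg"
    and top: "P (carrier R)"
    and step: "\<And>I x. submodule I R Reg \<Longrightarrow> x \<in> carrier R \<Longrightarrow> x \<notin> I \<Longrightarrow> (\<And>a. a \<in> \<mm> \<Longrightarrow> a \<otimes> x \<in> I) \<Longrightarrow>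
       P (I <+>\<^bsub>Reg\<^esub> (\<lambda>a. a \<otimes> x) ` carrier R) \<Longrightarrow> P I"
  shows "P I"
proof (rule ideal_noetherian_induct)
  show "ideal I R" using assms(1) submodule_regular_iff[OF is_cring] by blast
next
  fix I assume "ideal I R" and IH: "\<And>J. ideal J R \<Longrightarrow> I \<subset> J \<Longrightarrow> P J"
  then have I: "submodule I R Reg" using submodule_regular_iff[OF is_cring] by blast
  show "P I"
  proof (cases "I = carrier R")
    case True then show ?thesis using top by simp
  next
    case False
    then have "I \<subset> carrier Reg" using Reg.submodule_sub[OF I] by auto
    from exists_relative_socle_element[OF Reg.module_axioms I Reg.carrier_is_submodule this]
    obtain x where x: "x \<in> carrier R" "x \<notin> I" "\<And>a. a \<in> \<mm> \<Longrightarrow> a \<otimes> x \<in> I" by auto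
    let ?C = "(\<lambda>a. a \<otimes> x) ` carrier R"
    have C: "submodule ?C R Reg" "x \<in> ?C" using Reg.submodule_cyclic[of x] x by auto
    have "ideal (I <+>\<^bsub>Reg\<^esub> ?C) R"
      using Reg.submodule_set_add[OF I C(1)] submodule_regular_iff[OF is_cring] by blast
    moreover have "I \<subset> I <+>\<^bsub>Reg\<^esub> ?C"
      using Reg.subset_set_add[OF I C(1)] C(2) x(2) by blast
    ultimately show ?thesis using step[OF I x] IH by blast
  qed
qed

lemma length_quotient_finite: "submodule I R Reg \<Longrightarrow> interval_length R Reg I (carrier R) \<noteq> \<infinity>"
proof (induction rule: submodule_induct)
  case top
  then show ?case by simp
next
  case (step I x)
  let ?C = "(\<lambda>a. a \<otimes> x) ` carrier R"
  have C: "submodule ?C R Reg" "x \<in> ?C" using Reg.submodule_cyclic[of x] step(2) by auto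
  have J: "submodule (I <+>\<^bsub>Reg\<^esub> ?C) R Reg" by (rule Reg.submodule_set_add[OF step(1) C(1)])
  have "interval_length R Reg I (I <+>\<^bsub>Reg\<^esub> ?C) = 1"
    using interval_length_step[OF Reg.module_axioms step(1), of x] step by simp
  moreover have "interval_length R Reg I (carrier R) =
     interval_length R Reg I (I <+>\<^bsub>Reg\<^esub> ?C) + interval_length R Reg (I <+>\<^bsub>Reg\<^esub> ?C) (carrier R)"
    using Reg.interval_length_add[OF step(1) J Reg.carrier_is_submodule Reg.subset_set_add(1)[OF step(1) C(1)]]
      Reg.submodule_sub[OF J] by auto
  ultimately show ?case using step(5) by (simp add: plus_eq_infty_iff_enat)
qed

text \<open>The truncation by \<open>the_enat\<close> is harmless here and for \<open>sqdim\<close>,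
  since \<open>length_R\<close> shows both lengths to be finite.\<close>

definition embdim :: nat where "embdim = the_enat (interval_length R Reg msq \<mm>)"
definition sqdim :: nat where "sqdim = the_enat (interval_length R Reg {\<zero>} msq)"

lemma length_m_R: "interval_length R Reg \<mm> (carrier R) = 1"
proof (rule Reg.interval_length_simple[OF submodule_m])
  show "submodule (carrier R) R Reg" using Reg.carrier_is_submodule by simp
  show "\<mm> \<subset> carrier R" using m_subset one_notin_m by blast
  show "N = \<mm> \<or> N = carrier R" if "submodule N R Reg" "\<mm> \<subseteq> N" "N \<subseteq> carrier R" for N
    using that m.I_maximal submodule_regular_iff[OF is_cring] by blast
qed

lemma length_R:
  "interval_length R Reg {\<zero>} msq = enat sqdim"
  "interval_length R Reg msq \<mm> = enat embdim"
  "interval_length R Reg {\<zero>} (carrier R) = enat (1 + embdim + sqdim)"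
proof -
  have z: "{\<zero>} \<subseteq> msq" using Reg.submodule_zero_mem[OF submodule_msq] by simp
  have R: "submodule (carrier R) R Reg" using Reg.carrier_is_submodule by simp
  have 0: "submodule {\<zero>} R Reg" using Reg.submodule_zero by simp
  have mc: "msq \<subseteq> carrier R" using msq_subset m_subset by blast
  have a: "interval_length R Reg {\<zero>} (carrier R) =
      interval_length R Reg {\<zero>} msq + interval_length R Reg msq (carrier R)"
    by (rule Reg.interval_length_add[OF 0 submodule_msq R z mc])
  have b: "interval_length R Reg msq (carrier R) =
      interval_length R Reg msq \<mm> + interval_length R Reg \<mm> (carrier R)"
    by (rule Reg.interval_length_add[OF submodule_msq submodule_m R msq_subset m_subset])
  have "interval_length R Reg {\<zero>} (carrier R) \<noteq> \<infinity>" by (rule length_quotient_finite[OF 0])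
  with a b show 1: "interval_length R Reg {\<zero>} msq = enat sqdim"
    and 2: "interval_length R Reg msq \<mm> = enat embdim"
    by (auto simp: sqdim_def embdim_def plus_eq_infty_iff_enat)
  show "interval_length R Reg {\<zero>} (carrier R) = enat (1 + embdim + sqdim)"
    unfolding a b 1 2 length_m_R by (simp add: one_enat_def)
qed

lemma length_F: "interval_length R (F n) {\<zero>\<^bsub>F n\<^esub>} (carrier (F n)) = enat (n * (1 + embdim + sqdim))"
proof -
  have "submodule {\<zero>} R Reg" "submodule (carrier R) R Reg"
    using Reg.submodule_zero Reg.carrier_is_submodule by simp_all
  from Reg.interval_length_power[OF this, of n] show ?thesis
    using Reg.power_submodule_zero[of "{..<n}"] Reg.power_submodule_carrier[of "{..<n}"]
    by (simp add: length_R free_module_eq)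
qed

lemma length_m2F: "interval_length R (F n) {\<zero>\<^bsub>F n\<^esub>} (m2F n) = enat (n * sqdim)"
proof -
  have "submodule {\<zero>} R Reg" "{\<zero>} \<subseteq> msq"
    using Reg.submodule_zero Reg.submodule_zero_mem[OF submodule_msq] by simp_all
  from Reg.interval_length_power[OF this(1) submodule_msq this(2), of n] show ?thesis
    using Reg.power_submodule_zero[of "{..<n}"] by (simp add: length_R free_module_eq)
qed

lemma length_F_mod_mF: "interval_length R (F n) (mF n) (carrier (F n)) = enat n"
proof -
  have "submodule (carrier R) R Reg" using Reg.carrier_is_submodule by simp
  from Reg.interval_length_power[OF submodule_m this m_subset, of n] show ?thesis
    using Reg.power_submodule_carrier[of "{..<n}"] by (simp add: length_m_R free_module_eq)
qed

lemma ideal_mult_m_R: "ideal_mult R \<mm> Reg (carrier R) = \<mm>"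
proof
  show "ideal_mult R \<mm> Reg (carrier R) \<subseteq> \<mm>"
    by (rule Reg.ideal_mult_least[OF submodule_m]) (use m.I_r_closed in auto)
  show "\<mm> \<subseteq> ideal_mult R \<mm> Reg (carrier R)"
    using Reg.ideal_mult_mem[of _ \<mm> \<one> "carrier R"] m_carrier by force
qed

lemma submodule_mF: "submodule (mF n) R (F n)"
  using Reg.submodule_power_submodule[OF submodule_m] by (simp add: free_module_eq)

lemma submodule_m2F: "submodule (m2F n) R (F n)"
  using Reg.submodule_power_submodule[OF submodule_msq] by (simp add: free_module_eq)

lemma mF_eq: "ideal_mult R \<mm> (F n) (carrier (F n)) = mF n"
  using Reg.ideal_mult_power[OF m_subset Reg.carrier_is_submodule, of "{..<n}"]
    Reg.power_submodule_carrier[of "{..<n}"]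
  by (simp add: free_module_eq ideal_mult_m_R)

lemma m2F_eq: "ideal_mult R \<mm> (F n) (mF n) = m2F n"
  using Reg.ideal_mult_power[OF m_subset submodule_m, of "{..<n}"] by (simp add: free_module_eq)

lemma mF_iff: "u \<in> mF n \<longleftrightarrow> u \<in> carrier (F n) \<and> (\<forall>i. u i \<in> \<mm>)"
  by (simp add: power_submodule_def free_module_eq)

lemma F_carrier: "u \<in> carrier (F n) \<longleftrightarrow> (\<forall>i. u i \<in> carrier R) \<and> (\<forall>i\<ge>n. u i = \<zero>)"
  by (auto simp: free_module_eq direct_power_carrier_finite)

subsection \<open>Minimal covers by free modules\<close>

text \<open>A finite set whose span has the greatest possible length must span everything, since
  adjoining any further element cannot lengthen the span.\<close>

lemma finite_length_imp_finitely_generated: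
  assumes M: "module R M" and fin: "interval_length R M {\<zero>\<^bsub>M\<^esub>} (carrier M) \<noteq> \<infinity>"
  shows "finitely_generated R M"
proof -
  interpret M: module R M by fact
  let ?l = "\<lambda>A. interval_length R M {\<zero>\<^bsub>M\<^esub>} (span_module R M A)"
  have sub: "span_module R M A \<subseteq> carrier M" if "A \<subseteq> carrier M" for A
    using M.submodule_sub[OF M.submodule_span[OF that]] by auto
  obtain b where b: "interval_length R M {\<zero>\<^bsub>M\<^esub>} (carrier M) = enat b" using fin by auto
  have le: "?l A \<le> enat b" if "A \<subseteq> carrier M" for A
    unfolding b[symmetric] by (rule interval_length_mono) (use sub[OF that] in auto)
  let ?P = "\<lambda>A. A \<subseteq> carrier M \<and> finite A"
  have "\<exists>A. ?P A \<and> (\<forall>B. ?P B \<longrightarrow> the_enat (?l B) \<le> the_enat (?l A))"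
  \<comment> \<open>The rule wants a strict upper bound, hence the successor of the length b of
    M.\<close>
  proof (rule ex_has_greatest_nat[of ?P "{}" _ "Suc b"])
    show "\<forall>A. ?P A \<longrightarrow> the_enat (?l A) < Suc b"
    proof (intro allI impI)
      fix A assume "?P A"
      then show "the_enat (?l A) < Suc b" using le[of A] by (cases "?l A") auto
    qed
  qed auto
  then obtain A where A: "A \<subseteq> carrier M" "finite A"
    and max: "\<And>B. B \<subseteq> carrier M \<Longrightarrow> finite B \<Longrightarrow> the_enat (?l B) \<le> the_enat (?l A)" by blast
  have "carrier M \<subseteq> span_module R M A"
  proof
    fix z assume z: "z \<in> carrier M"
    let ?B = "insert z A"
    have B: "?B \<subseteq> carrier M" "finite ?B" using A z by auto
    have AB: "span_module R M A \<subseteq> span_module R M ?B"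
      by (rule M.span_least[OF M.submodule_span[OF B(1)]]) (use M.span_superset[of ?B] in blast)
    have "the_enat (?l ?B) \<le> the_enat (?l A)" by (rule max[OF B])
    moreover have "?l ?B \<noteq> \<infinity>" "?l A \<noteq> \<infinity>" using enat_ile[OF le[OF B(1)]] enat_ile[OF le[OF A(1)]] by auto
    ultimately have "?l ?B \<le> ?l A" "?l A \<noteq> \<infinity>" by (cases "?l ?B"; cases "?l A"; simp)+
    then have "span_module R M A = span_module R M ?B"
      by (intro M.interval_length_eq_imp_eq[OF M.submodule_zero M.submodule_span[OF A(1)]
            M.submodule_span[OF B(1)] _ AB])
         (use M.submodule_zero_mem[OF M.submodule_span[OF A(1)]] in auto)
    then show "z \<in> span_module R M A" using M.span_superset[of ?B] by blast
  qed
  then show ?thesis unfolding finitely_generated_def using A sub[OF A(1)] by blast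
qed

text \<open>If a relation among a smallest generating set had a coefficient outside m, that
  coefficient would be a unit and its generator would lie in the span of the others, giving a
  smaller generating set.\<close>

lemma minimal_cover:
  assumes N: "module R N" and fg: "finitely_generated R N"
  shows "\<exists>p \<in> linear_maps R (F (min_generators R N)) N.
           p ` carrier (F (min_generators R N)) = carrier N \<and>
           (\<forall>u \<in> carrier (F (min_generators R N)). p u = \<zero>\<^bsub>N\<^esub> \<longrightarrow> u \<in> mF (min_generators R N))"
proof -
  interpret N: module R N by fact
  define n where "n = min_generators R N"
  interpret Fn: module R "F n" by (rule F_module)
  let ?G = "\<lambda>n. \<exists>A. A \<subseteq> carrier N \<and> finite A \<and> card A = n \<and> span_module R N A = carrier N"
  have "?G n" unfolding n_def min_generators_def
    by (rule LeastI_ex) (use fg in \<open>auto simp: finitely_generated_def\<close>)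
  then obtain A where A: "A \<subseteq> carrier N" "finite A" "card A = n" "span_module R N A = carrier N" by blast
  obtain h where h: "bij_betw h {..<n} A" using A(2,3) by (metis ex_bij_betw_nat_finite atLeast0LessThan)
  have hA: "h x \<in> carrier N" if "x \<in> {..<n}" for x using h A(1) that by (auto simp: bij_betw_def)
  let ?e = "\<lambda>x. single Reg x \<one>"
  have e: "?e x \<in> carrier (F n)" if "x \<in> {..<n}" for x
    using that by (auto simp: F_carrier single_def)
  obtain p where p: "p \<in> linear_maps R (F n) N" "\<And>x. x \<in> {..<n} \<Longrightarrow> p (?e x) = h x"
    using free_module_lift[OF N, of "{..<n}" h] hA by auto
  have img: "submodule (p ` carrier (F n)) R N"
    by (rule submodule_image[OF F_module N p(1) Fn.carrier_is_submodule])
  have "A \<subseteq> p ` carrier (F n)"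
  proof
    fix y assume "y \<in> A"
    then obtain x where "x \<in> {..<n}" "y = h x" using h by (auto simp: bij_betw_def)
    then show "y \<in> p ` carrier (F n)" using p(2)[of x] e[of x] by (metis imageI)
  qed
  then have "p ` carrier (F n) = carrier N"
    using N.span_least[OF img \<open>A \<subseteq> p ` carrier (F n)\<close>] A(4) N.submodule_sub[OF img] by blast
  moreover have "u \<in> mF n" if u: "u \<in> carrier (F n)" "p u = \<zero>\<^bsub>N\<^esub>" for u
  proof (rule ccontr)
    assume "u \<notin> mF n"
    then obtain i where i: "u i \<notin> \<mm>" using u by (auto simp: mF_iff)
    have ui: "u i \<in> carrier R" using u by (simp add: F_carrier)
    have "i < n" using i u(1) by (metis F_carrier linorder_not_less m.zero_closed)
    then have hi: "h i \<in> A" using h by (auto simp: bij_betw_def)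
    let ?A = "A - {h i}"
    have A': "?A \<subseteq> carrier N" using A by auto
    let ?S = "span_module R N ?A"
    have S: "submodule ?S R N" by (rule N.submodule_span[OF A'])
    \<comment> \<open>The relation without its i-th term: its image is a combination of the
      remaining generators, so the i-th term alone must lie in their span as well.\<close>
    let ?v = "u(i := \<zero>)"
    have v: "?v \<in> carrier (F n)" using u by (simp add: F_carrier)
    have "?v \<in> {v \<in> carrier (F n). p v \<in> ?S}"
    proof (rule Reg.direct_power_memI[where X = "{..<n}"])
      show "submodule {v \<in> carrier (F n). p v \<in> ?S} R (direct_power Reg {..<n})"
        using submodule_vimage[OF F_module N p(1) Fn.carrier_is_submodule S] by (simp add: free_module_eq)
      show "?v \<in> carrier (direct_power Reg {..<n})" using v by (simp add: free_module_eq)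
      fix x assume x: "x \<in> {..<n}"
      have vx: "?v x \<in> carrier R" using v by (simp add: F_carrier)
      have s: "single Reg x (?v x) = ?v x \<odot>\<^bsub>F n\<^esub> ?e x"
        unfolding free_module_eq direct_power_simps regular_module_simps single_def
        by (intro ext) (metis r_null r_one vx)
      have "?v x \<odot>\<^bsub>N\<^esub> h x \<in> ?S"
      proof (cases "x = i")
        case True
        then show ?thesis using hA[OF x] N.submodule_zero_mem[OF S] by simp
      next
        case False
        then have "h x \<noteq> h i" using h x \<open>i < n\<close> by (auto simp: bij_betw_def inj_on_def)
        then have "h x \<in> ?A" using h x by (auto simp: bij_betw_def)
        then have "h x \<in> ?S" by (rule subsetD[OF N.span_superset])
        then show ?thesis by (rule N.submodule_smult[OF S vx])
      qed
      then have "p (single Reg x (?v x)) \<in> ?S"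
        unfolding s using lin_smult[OF p(1) vx e[OF x]] p(2)[OF x] by simp
      moreover have "single Reg x (?v x) \<in> carrier (F n)"
        unfolding s by (rule Fn.smult_closed[OF vx e[OF x]])
      ultimately show "single Reg x (?v x) \<in> {v \<in> carrier (F n). p v \<in> ?S}" by blast
    qed
    then have pv: "p ?v \<in> ?S" by simp
    have uv: "u = ?v \<oplus>\<^bsub>F n\<^esub> u i \<odot>\<^bsub>F n\<^esub> ?e i"
      using u by (auto simp: free_module_eq single_def F_carrier fun_eq_iff direct_power_carrier_finite)
    have in': "i \<in> {..<n}" using \<open>i < n\<close> by simp
    have "p u = p ?v \<oplus>\<^bsub>N\<^esub> u i \<odot>\<^bsub>N\<^esub> h i"
      by (subst uv) (use lin_add[OF p(1) v Fn.smult_closed[OF ui e[OF in']]]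
          lin_smult[OF p(1) ui e[OF in']] p(2)[OF in'] in simp)
    then have "p ?v \<oplus>\<^bsub>N\<^esub> u i \<odot>\<^bsub>N\<^esub> h i \<in> ?S" using u(2) N.submodule_zero_mem[OF S] by simp
    then have "u i \<odot>\<^bsub>N\<^esub> h i \<in> ?S"
      using N.submodule_cancel_left[OF S pv] ui hA[OF in'] by blast
    then have "h i \<in> ?S" by (rule smult_unit_cancel[OF N S hA[OF in'] ui i])
    then have "A \<subseteq> ?S" using N.span_superset[of ?A] by blast
    then have "span_module R N ?A = carrier N"
      using N.span_least[OF S \<open>A \<subseteq> ?S\<close>] A(4) N.submodule_sub[OF S] by blast
    then have "?G (n - 1)" using A A' hi by (intro exI[of _ ?A]) auto
    moreover have "n - 1 < n" using \<open>i < n\<close> by auto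
    ultimately show False unfolding n_def min_generators_def using not_less_Least by blast
  qed
  ultimately show ?thesis unfolding n_def[symmetric] using p(1) by blast
qed

text \<open>Because the kernel lies in \<open>mF n\<close>, the preimage of m times the image is
  \<open>mF n\<close> itself. Hence the image modulo m corresponds to \<open>F n\<close> modulo
  \<open>mF n\<close>, which makes n an invariant of the image.\<close>

lemma minimal_cover_length:
  assumes M: "module R M" and p: "p \<in> linear_maps R (F n) M"
    and ker: "\<And>u. u \<in> carrier (F n) \<Longrightarrow> p u = \<zero>\<^bsub>M\<^esub> \<Longrightarrow> u \<in> mF n"
  shows "interval_length R M (ideal_mult R \<mm> M (p ` carrier (F n))) (p ` carrier (F n)) = enat n"
    and "\<And>u. u \<in> carrier (F n) \<Longrightarrow> p u \<in> ideal_mult R \<mm> M (p ` carrier (F n)) \<Longrightarrow> u \<in> mF n"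
    and "ideal_mult R \<mm> M (p ` carrier (F n)) = p ` mF n"
proof -
  interpret M: module R M by fact
  interpret Fn: module R "F n" by (rule F_module)
  let ?Z = "p ` carrier (F n)"
  have Z: "submodule ?Z R M" by (rule submodule_image[OF F_module M p Fn.carrier_is_submodule])
  have mZ: "submodule (ideal_mult R \<mm> M ?Z) R M"
    by (rule M.submodule_ideal_mult[OF m_subset]) (use M.submodule_sub[OF Z] in auto)
  show img: "ideal_mult R \<mm> M ?Z = p ` mF n"
    using ideal_mult_image[OF F_module M p m_subset, of "carrier (F n)"] mF_eq by simp
  show vim: "u \<in> mF n" if u: "u \<in> carrier (F n)" "p u \<in> ideal_mult R \<mm> M ?Z" for u
  proof -
    obtain w where w: "w \<in> mF n" "p u = p w" using u(2) img by auto
    then have wF: "w \<in> carrier (F n)" by (simp add: mF_iff)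
    have "p (u \<ominus>\<^bsub>F n\<^esub> w) = \<zero>\<^bsub>M\<^esub>"
      using w(2) lin_closed[OF p wF] unfolding lin_minus[OF F_module M p u(1) wF]
      by (simp add: M.minus_eq_zero_iff)
    then have "u \<ominus>\<^bsub>F n\<^esub> w \<in> mF n" using ker[of "u \<ominus>\<^bsub>F n\<^esub> w"] u(1) wF by simp
    then have "w \<oplus>\<^bsub>F n\<^esub> (u \<ominus>\<^bsub>F n\<^esub> w) \<in> mF n" by (rule Fn.submodule_add[OF submodule_mF w(1)])
    also have "w \<oplus>\<^bsub>F n\<^esub> (u \<ominus>\<^bsub>F n\<^esub> w) = u"
      using u(1) wF by (simp add: a_minus_def Fn.a_lcomm[of w u] Fn.r_neg)
    finally show ?thesis .
  qed
  have eq: "{u \<in> carrier (F n). p u \<in> ideal_mult R \<mm> M ?Z} = mF n"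
    using vim img by (auto simp: mF_iff)
  have eq': "{u \<in> carrier (F n). p u \<in> ?Z} = carrier (F n)" by auto
  show "interval_length R M (ideal_mult R \<mm> M ?Z) ?Z = enat n"
    using interval_length_image[OF F_module M p Fn.carrier_is_submodule mZ
        M.ideal_mult_subset[OF m_subset Z] order_refl] length_F_mod_mF[of n]
    unfolding eq eq' by simp
qed

lemma minimal_cover_submodule:
  assumes M: "module R M" and Z: "submodule Z R M" and fin: "interval_length R M {\<zero>\<^bsub>M\<^esub>} Z \<noteq> \<infinity>"
  shows "\<exists>n p. p \<in> linear_maps R (F n) M \<and> p ` carrier (F n) = Z \<and>
           (\<forall>u \<in> carrier (F n). p u = \<zero>\<^bsub>M\<^esub> \<longrightarrow> u \<in> mF n)"
proof -
  interpret M: module R M by fact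
  let ?Z = "M\<lparr>carrier := Z\<rparr>"
  have ZM: "module R ?Z" by (rule submodule.submodule_is_module[OF Z M])
  have "finitely_generated R ?Z"
    by (rule finite_length_imp_finitely_generated[OF ZM])
       (use fin interval_length_carrier_update[OF M Z order_refl] in simp)
  from minimal_cover[OF ZM this] obtain n p where p: "p \<in> linear_maps R (F n) ?Z"
    "p ` carrier (F n) = Z" "\<forall>u \<in> carrier (F n). p u = \<zero>\<^bsub>M\<^esub> \<longrightarrow> u \<in> mF n" by auto
  have "p \<in> linear_maps R (F n) M"
    using p(1) M.submodule_sub[OF Z] by (auto simp: linear_maps_def Pi_iff)
  then show ?thesis using p by blast
qed

end

section \<open>The injective hull of the residue field\<close>

lemma enat_eq_add_imp_0: "enat n = l + enat n \<Longrightarrow> l = 0"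
  by (cases l) (auto simp: zero_enat_def)

text \<open>Transport of structure along j. Test modules of injectivity and terms of injective
  resolutions have prescribed element types, and R has to be moved into them.\<close>

definition copy_module :: "('a, 'm, 'z) module_scheme \<Rightarrow> ('m \<Rightarrow> 'n) \<Rightarrow> ('a, 'n) module" where
  "copy_module M j =
     \<lparr>carrier = j ` carrier M, monoid.mult = undefined, one = undefined, ring.zero = j \<zero>\<^bsub>M\<^esub>,
      add = (\<lambda>x y. j (inv_into (carrier M) j x \<oplus>\<^bsub>M\<^esub> inv_into (carrier M) j y)),
      smult = (\<lambda>a x. j (a \<odot>\<^bsub>M\<^esub> inv_into (carrier M) j x))\<rparr>"

lemma copy_module:
  assumes M: "module R M" and j: "inj_on j (carrier M)"
  shows "module R (copy_module M j)"
    and "j \<in> linear_maps R M (copy_module M j)"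
    and "inv_into (carrier M) j \<in> linear_maps R (copy_module M j) M"
proof -
  interpret module R M by fact
  note [simp] = inv_into_f_f[OF j]
  show "module R (copy_module M j)"
  proof (rule moduleI)
    show "abelian_group (copy_module M j)"
    proof (rule abelian_groupI)
      fix x assume "x \<in> carrier (copy_module M j)"
      then obtain u where "u \<in> carrier M" "x = j u" by (auto simp: copy_module_def)
      then show "\<exists>y\<in>carrier (copy_module M j). y \<oplus>\<^bsub>copy_module M j\<^esub> x = \<zero>\<^bsub>copy_module M j\<^esub>"
        by (intro bexI[of _ "j (\<ominus>\<^bsub>M\<^esub> u)"]) (auto simp: copy_module_def M.l_neg)
    qed (auto simp: copy_module_def M.a_ac)
  qed (auto simp: copy_module_def R.is_cring smult_l_distr smult_r_distr smult_assoc1)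
  show "j \<in> linear_maps R M (copy_module M j)"
    by (rule linear_mapsI) (auto simp: copy_module_def)
  show "inv_into (carrier M) j \<in> linear_maps R (copy_module M j) M"
    by (rule linear_mapsI) (auto simp: copy_module_def)
qed

lemma injective_module_retract:
  assumes E: "injective_module R E" and I: "module R I"
    and \<alpha>: "\<alpha> \<in> linear_maps R I E" and \<beta>: "\<beta> \<in> linear_maps R E I"
    and retract: "\<And>x. x \<in> carrier I \<Longrightarrow> \<beta> (\<alpha> x) = x"
  shows "injective_module R I"
  unfolding injective_module_def
proof (intro conjI allI impI)
  fix B :: "('a, 'a list) module" and A f
  assume *: "module R B \<and> submodule A R B \<and> f \<in> linear_maps R (B\<lparr>carrier := A\<rparr>) I"
  then have f: "f \<in> linear_maps R (B\<lparr>carrier := A\<rparr>) I" by blast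
  have "\<exists>g \<in> linear_maps R B E. \<forall>x\<in>A. g x = \<alpha> (f x)"
    using E * lin_comp[OF f \<alpha>] unfolding injective_module_def by blast
  then obtain g where g: "g \<in> linear_maps R B E" "\<And>x. x \<in> A \<Longrightarrow> g x = \<alpha> (f x)" by blast
  show "\<exists>g \<in> linear_maps R B I. \<forall>x\<in>A. g x = f x"
    using lin_comp[OF g(1) \<beta>] g(2) retract lin_closed[OF f]
    by (intro bexI[of _ "\<lambda>x. \<beta> (g x)"]) auto
qed (rule I)

text \<open>R is copied into \<open>'a list\<close> by singleton lists and used as the test module
  there. An extension of f to R is multiplication onto the image y of the unit.\<close>

lemma injective_module_baer:
  fixes R :: "('a, 'r) ring_scheme"
  assumes E: "injective_module R E" and J: "submodule J R (regular_module R)"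
    and f: "f \<in> linear_maps R ((regular_module R)\<lparr>carrier := J\<rparr>) E"
  shows "\<exists>y\<in>carrier E. \<forall>a\<in>J. f a = a \<odot>\<^bsub>E\<^esub> y"
proof -
  interpret E: module R E using E by (simp add: injective_module_def)
  interpret Reg: module R "regular_module R" by (rule regular_module_is_module[OF E.R.is_cring])
  define j :: "'a \<Rightarrow> 'a list" where "j = (\<lambda>x. [x])"
  have j: "inj_on j (carrier (regular_module R))" by (auto simp: j_def inj_on_def)
  let ?B = "copy_module (regular_module R) j"
  let ?g = "inv_into (carrier (regular_module R)) j"
  note B = copy_module[OF Reg.module_axioms j]
  have A: "submodule (j ` J) R ?B" by (rule submodule_image[OF Reg.module_axioms B(1,2) J])
  have gj: "?g (j x) = x" if "x \<in> J" for x
    using inv_into_f_f[OF j] Reg.submodule_sub[OF J that] by blast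
  have "(\<lambda>x. f (?g x)) \<in> linear_maps R (?B\<lparr>carrier := j ` J\<rparr>) E"
  proof (rule linear_mapsI)
    fix x y assume "x \<in> carrier (?B\<lparr>carrier := j ` J\<rparr>)" "y \<in> carrier (?B\<lparr>carrier := j ` J\<rparr>)"
    then have xy: "x \<in> carrier ?B" "y \<in> carrier ?B" "?g x \<in> J" "?g y \<in> J"
      using gj Reg.submodule_sub[OF J] by (auto simp: copy_module_def)
    then show "f (?g (x \<oplus>\<^bsub>?B\<lparr>carrier := j ` J\<rparr>\<^esub> y)) = f (?g x) \<oplus>\<^bsub>E\<^esub> f (?g y)"
      using lin_add[OF B(3) xy(1,2)] lin_add[OF f, of "?g x" "?g y"] by simp
  next
    fix a x assume "a \<in> carrier R" "x \<in> carrier (?B\<lparr>carrier := j ` J\<rparr>)"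
    then have xy: "a \<in> carrier R" "x \<in> carrier ?B" "?g x \<in> J"
      using gj Reg.submodule_sub[OF J] by (auto simp: copy_module_def)
    then show "f (?g (a \<odot>\<^bsub>?B\<lparr>carrier := j ` J\<rparr>\<^esub> x)) = a \<odot>\<^bsub>E\<^esub> f (?g x)"
      using lin_smult[OF B(3) xy(1,2)] lin_smult[OF f, of a "?g x"] by simp
  qed (use gj lin_closed[OF f] in auto)
  with A B(1) have "module R ?B \<and> submodule (j ` J) R ?B \<and>
      (\<lambda>x. f (?g x)) \<in> linear_maps R (?B\<lparr>carrier := j ` J\<rparr>) E" by blast
  with E have "\<exists>h \<in> linear_maps R ?B E. \<forall>x\<in>j ` J. h x = f (?g x)"
    unfolding injective_module_def by presburger
  then obtain h where h: "h \<in> linear_maps R ?B E" "\<And>x. x \<in> j ` J \<Longrightarrow> h x = f (?g x)" by blast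
  have hj: "(\<lambda>x. h (j x)) \<in> linear_maps R (regular_module R) E" by (rule lin_comp[OF B(2) h(1)])
  show ?thesis
  proof (intro bexI ballI)
    show "h (j \<one>\<^bsub>R\<^esub>) \<in> carrier E" using lin_closed[OF hj, of "\<one>\<^bsub>R\<^esub>"] by simp
    fix a assume a: "a \<in> J"
    then have "f a = h (j a)" using h(2) gj by simp
    then show "f a = a \<odot>\<^bsub>E\<^esub> h (j \<one>\<^bsub>R\<^esub>)"
      using lin_smult[OF hj, of a "\<one>\<^bsub>R\<^esub>"] Reg.submodule_sub[OF J a] by simp
  qed
qed

text \<open>The resolution has R in degree zero and nothing afterwards, so the injective dimension
  is at most zero.\<close>

lemma gorenstein_if_self_injective:
  fixes R :: "('a, 'r) ring_scheme"
  assumes R: "noetherian_local_ring R \<mm>" and inj: "injective_module R (regular_module R)"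
  shows "gorenstein R \<mm>"
proof -
  have Reg: "module R (regular_module R)" using inj by (simp add: injective_module_def)
  \<comment> \<open>Any injection into the index type would do; here both entry types are the type
    of ring elements.\<close>
  define j :: "'a \<Rightarrow> ('a, 'a) resolution_index" where "j = (\<lambda>x. [(0, x, x)])"
  have j: "inj_on j (carrier (regular_module R))" by (auto simp: j_def inj_on_def)
  define J where "J = copy_module (regular_module R) j"
  note J = copy_module[OF Reg j, folded J_def]
  interpret J: module R J by (rule J(1))
  have J_inj: "injective_module R J"
    by (rule injective_module_retract[OF inj J(1) J(3) J(2)])
       (auto simp: J_def copy_module_def inv_into_f_f[OF j, simplified])
  \<comment> \<open>The later terms are the zero submodule of J, so all terms share one type and one
    zero, and the constant map to it serves as every differential.\<close>
  define Z where "Z = J\<lparr>carrier := {\<zero>\<^bsub>J\<^esub>}\<rparr>"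
  have Z: "module R Z" unfolding Z_def
    by (rule submodule.submodule_is_module[OF J.submodule_zero J(1)])
  have Z_inj: "injective_module R Z"
    by (rule injective_module_retract[OF J_inj Z, of "\<lambda>x. x" "\<lambda>_. \<zero>\<^bsub>J\<^esub>"])
       (auto simp: Z_def linear_maps_def)
  define I where "I n = (if n = 0 then J else Z)" for n :: nat
  have "injective_resolution R (regular_module R) I (\<lambda>_ _. \<zero>\<^bsub>J\<^esub>) j"
    unfolding injective_resolution_def
  proof (intro conjI allI)
    show "injective_module R (I n)" for n using J_inj Z_inj by (simp add: I_def)
    show "j \<in> linear_maps R (regular_module R) (I 0)" using J(2) by (simp add: I_def)
    show "(\<lambda>_. \<zero>\<^bsub>J\<^esub>) \<in> linear_maps R (I n) (I (Suc n))" for n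
      by (auto simp: I_def Z_def linear_maps_def)
    show "j ` carrier (regular_module R) = a_kernel (I 0) (I 1) (\<lambda>_. \<zero>\<^bsub>J\<^esub>)"
      by (simp add: a_kernel_def' I_def Z_def) (simp add: J_def copy_module_def)
    show "(\<lambda>_. \<zero>\<^bsub>J\<^esub>) ` carrier (I n) = a_kernel (I (Suc n)) (I (Suc (Suc n))) (\<lambda>_. \<zero>\<^bsub>J\<^esub>)" for n
    proof -
      have "carrier (I n) \<noteq> {}" using J.zero_closed by (auto simp: I_def Z_def)
      then show ?thesis by (auto simp: a_kernel_def' I_def Z_def)
    qed
  qed (rule j)
  moreover have "\<forall>i>0. zero_module (I i)" by (auto simp: zero_module_def I_def Z_def)
  ultimately have "injective_dimension R (regular_module R) \<le> enat 0"
    unfolding injective_dimension_def by (intro Inf_lower) blast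
  then show ?thesis using R enat_ile by (fastforce simp: gorenstein_def)
qed

section \<open>Socles, annihilators and cyclic modules\<close>

context cube_zero_local_ring
begin

definition socle :: "('a, 'm, 'z) module_scheme \<Rightarrow> 'm set" where
  "socle M = {x \<in> carrier M. \<forall>a\<in>\<mm>. a \<odot>\<^bsub>M\<^esub> x = \<zero>\<^bsub>M\<^esub>}"

definition annihilated :: "('a, 'm, 'z) module_scheme \<Rightarrow> 'a set \<Rightarrow> 'm set" where
  "annihilated M I = {x \<in> carrier M. \<forall>a\<in>I. a \<odot>\<^bsub>M\<^esub> x = \<zero>\<^bsub>M\<^esub>}"

lemma submodule_annihilated:
  assumes "module R M" "I \<subseteq> carrier R"
  shows "submodule (annihilated M I) R M"
proof -
  interpret M: module R M by fact
  have "a \<odot>\<^bsub>M\<^esub> (b \<odot>\<^bsub>M\<^esub> x) = b \<odot>\<^bsub>M\<^esub> (a \<odot>\<^bsub>M\<^esub> x)"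
    if "a \<in> carrier R" "b \<in> carrier R" "x \<in> carrier M" for a b x
    using that by (simp add: M.smult_assoc1[symmetric] m_comm)
  then show ?thesis
    unfolding submodule_iff[OF assms(1)] annihilated_def using assms(2)
    by (auto simp: M.smult_r_distr subset_iff)
qed

lemma socle_eq: "socle M = annihilated M \<mm>"
  by (simp add: socle_def annihilated_def)

lemma submodule_socle: "module R M \<Longrightarrow> submodule (socle M) R M"
  unfolding socle_eq using submodule_annihilated m_subset by blast

lemma cyclic_image:
  assumes M: "module R M" and p: "p \<in> linear_maps R (F n) M" and "n \<le> 1"
  shows "\<exists>x\<in>carrier M. p ` carrier (F n) = (\<lambda>a. a \<odot>\<^bsub>M\<^esub> x) ` carrier R"
proof -
  interpret M: module R M by fact
  interpret Fn: module R "F n" by (rule F_module)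
  \<comment> \<open>For n = 0 the free module is zero and its generator is the zero vector, so both
    cases yield a cyclic image.\<close>
  define e where "e = single Reg (0::nat) (if n = 0 then \<zero> else \<one>)"
  have e: "e \<in> carrier (F n)" by (auto simp: e_def F_carrier single_def)
  have u: "u = u 0 \<odot>\<^bsub>F n\<^esub> e" if "u \<in> carrier (F n)" for u
  proof
    fix i show "u i = (u 0 \<odot>\<^bsub>F n\<^esub> e) i"
      using that assms(3) unfolding F_carrier
      by (cases "i = 0"; cases "n = 0") (auto simp: e_def single_def free_module_eq)
  qed
  have u': "a \<odot>\<^bsub>F n\<^esub> e \<in> carrier (F n)" if "a \<in> carrier R" for a using that e by simp
  have "p ` carrier (F n) = (\<lambda>a. a \<odot>\<^bsub>M\<^esub> p e) ` carrier R"
  proof safe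
    fix w assume w: "w \<in> carrier (F n)"
    then have w0: "w 0 \<in> carrier R" by (simp add: F_carrier)
    have "p w = w 0 \<odot>\<^bsub>M\<^esub> p e" using u[OF w] lin_smult[OF p w0 e] by simp
    then show "p w \<in> (\<lambda>a. a \<odot>\<^bsub>M\<^esub> p e) ` carrier R" using w0 by blast
  next
    fix a assume a: "a \<in> carrier R"
    show "a \<odot>\<^bsub>M\<^esub> p e \<in> p ` carrier (F n)"
      using lin_smult[OF p a e] u'[OF a] by (metis imageI)
  qed
  then show ?thesis using lin_closed[OF p e] by blast
qed

lemma minimal_cover_m:
  "\<exists>p. p \<in> linear_maps R (F embdim) Reg \<and> p ` carrier (F embdim) = \<mm> \<and>
     (\<forall>u\<in>carrier (F embdim). p u = \<zero> \<longrightarrow> u \<in> mF embdim)"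
proof -
  have "interval_length R Reg {\<zero>\<^bsub>Reg\<^esub>} \<mm> \<le> interval_length R Reg {\<zero>} (carrier R)"
    by (rule interval_length_mono) (use m_subset in auto)
  then have "interval_length R Reg {\<zero>\<^bsub>Reg\<^esub>} \<mm> \<noteq> \<infinity>"
    unfolding length_R using enat_ile by fastforce
  then obtain n p where p: "p \<in> linear_maps R (F n) Reg" "p ` carrier (F n) = \<mm>"
    "\<And>u. u \<in> carrier (F n) \<Longrightarrow> p u = \<zero>\<^bsub>Reg\<^esub> \<Longrightarrow> u \<in> mF n"
    using minimal_cover_submodule[OF Reg.module_axioms submodule_m] by blast
  have "enat embdim = enat n"
    using minimal_cover_length(1)[OF Reg.module_axioms p(1,3)] unfolding p(2) length_R .
  then have "embdim = n" by simp
  with p show ?thesis by auto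
qed

lemma principal_if_embdim_le_1:
  assumes "embdim \<le> 1"
  shows "\<exists>x\<in>\<mm>. \<mm> = (\<lambda>a. a \<otimes> x) ` carrier R"
proof -
  obtain p where p: "p \<in> linear_maps R (F embdim) Reg" "p ` carrier (F embdim) = \<mm>"
    using minimal_cover_m by blast
  from cyclic_image[OF Reg.module_axioms p(1) assms] obtain x where x: "x \<in> carrier R"
    "\<mm> = (\<lambda>a. a \<otimes> x) ` carrier R" unfolding p(2) by auto
  have "\<one> \<otimes> x \<in> \<mm>" unfolding x(2) by blast
  then have "x \<in> \<mm>" using x(1) by simp
  then show ?thesis using x(2) by blast
qed

end

section \<open>Lengths in the injective hull and first criteria for Gorenstein rings\<close>

locale cube_zero_injective_hull = cube_zero_local_ring R \<mm> for R (structure) and \<mm> +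
  fixes E :: "('a, 'e) module"
  assumes hull: "injective_hull R (residue_module R \<mm>) E"
begin

lemma E_injective: "injective_module R E"
  using hull by (simp add: injective_hull_def)

sublocale E: module R E
  using E_injective by (simp add: injective_module_def)

text \<open>The element w is the image of the class of 1. Essentiality puts a nonzero multiple a w
  into every nonzero submodule; m kills w, so a is a unit and w itself is in the submodule.\<close>

lemma exists_socle_generator:
  "\<exists>w\<in>carrier E. w \<noteq> \<zero>\<^bsub>E\<^esub> \<and> (\<forall>a\<in>\<mm>. a \<odot>\<^bsub>E\<^esub> w = \<zero>\<^bsub>E\<^esub>) \<and>
     (\<forall>N. submodule N R E \<longrightarrow> N \<noteq> {\<zero>\<^bsub>E\<^esub>} \<longrightarrow> w \<in> N)"
proof -
  let ?K = "residue_module R \<mm>"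
  obtain \<iota> where \<iota>: "\<iota> \<in> linear_maps R ?K E" "inj_on \<iota> (carrier ?K)"
    and ess: "\<And>N. submodule N R E \<Longrightarrow> N \<inter> \<iota> ` carrier ?K = {\<zero>\<^bsub>E\<^esub>} \<Longrightarrow> N = {\<zero>\<^bsub>E\<^esub>}"
    using hull by (auto simp: injective_hull_def)
  have coset: "X +>\<^bsub>regular_module R\<^esub> a = X +> a" for X a
    by (simp add: a_r_coset_def')
  have carK: "carrier ?K = {\<mm> +> a | a. a \<in> carrier R}"
    by (auto simp: residue_module_def quotient_module_def A_RCOSETS_def' coset)
  have smultK: "a \<odot>\<^bsub>?K\<^esub> (\<mm> +> b) = \<mm> +> (a \<otimes> b)" if a: "a \<in> carrier R" and b: "b \<in> carrier R" for a b
  proof -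
    \<comment> \<open>Scalar multiplication on cosets is a union over representatives; all members
      of this union are the same coset.\<close>
    have "\<mm> +> (a \<otimes> x) = \<mm> +> (a \<otimes> b)" if x: "x \<in> \<mm> +> b" for x
    proof -
      obtain c where c: "c \<in> \<mm>" "x = c \<oplus> b" using x by (auto simp: a_r_coset_def')
      have "a \<otimes> x \<in> \<mm> +> (a \<otimes> b)"
        unfolding a_r_coset_def' using c m.I_l_closed[OF c(1) a] a b m_carrier
        by (auto simp: r_distr intro!: bexI[of _ "a \<otimes> c"])
      then show ?thesis using m.a_repr_independence'[of "a \<otimes> x" "a \<otimes> b"] a b by simp
    qed
    then have "(\<Union>x\<in>\<mm> +> b. \<mm> +> (a \<otimes> x)) = (\<Union>x\<in>\<mm> +> b. \<mm> +> (a \<otimes> b))"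
      by (intro SUP_cong refl)
    also have "\<dots> = \<mm> +> (a \<otimes> b)" using m.a_rcos_self[OF b] by blast
    finally show ?thesis by (simp add: residue_module_def quotient_module_def coset)
  qed
  have zeroK: "\<mm> +> \<zero> = \<mm>" by (rule m.a_rcos_const[OF m.zero_closed])
  define w where "w = \<iota> (\<mm> +> \<one>)"
  have one: "\<mm> +> \<one> \<in> carrier ?K" unfolding carK by blast
  have w: "w \<in> carrier E" unfolding w_def by (rule lin_closed[OF \<iota>(1) one])
  have img: "\<iota> (\<mm> +> a) = a \<odot>\<^bsub>E\<^esub> w" if "a \<in> carrier R" for a
    using lin_smult[OF \<iota>(1) that one] smultK[OF that one_closed] that by (simp add: w_def)
  have "\<iota> \<mm> = \<zero>\<^bsub>E\<^esub>" using img[of \<zero>] w zeroK by simp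
  moreover have "\<mm> \<noteq> \<mm> +> \<one>" using m.a_rcos_self[OF one_closed] one_notin_m by auto
  moreover have "\<mm> \<in> carrier ?K" unfolding carK using zeroK zero_closed by blast
  ultimately have "w \<noteq> \<zero>\<^bsub>E\<^esub>" using inj_onD[OF \<iota>(2), of \<mm> "\<mm> +> \<one>"] one by (auto simp: w_def)
  moreover have mw: "a \<odot>\<^bsub>E\<^esub> w = \<zero>\<^bsub>E\<^esub>" if "a \<in> \<mm>" for a
  proof -
    have "\<mm> +> a = \<mm>" using m.a_rcos_const[OF that] .
    then show ?thesis using img[OF m_carrier[OF that]] \<open>\<iota> \<mm> = \<zero>\<^bsub>E\<^esub>\<close> by simp
  qed
  moreover have "w \<in> N" if N: "submodule N R E" "N \<noteq> {\<zero>\<^bsub>E\<^esub>}" for N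
  proof -
    have "\<zero>\<^bsub>E\<^esub> \<in> N \<inter> \<iota> ` carrier ?K"
      using E.submodule_zero_mem[OF N(1)] \<open>\<iota> \<mm> = \<zero>\<^bsub>E\<^esub>\<close> \<open>\<mm> \<in> carrier ?K\<close> by (metis IntI imageI)
    then obtain v where v: "v \<in> N" "v \<in> \<iota> ` carrier ?K" "v \<noteq> \<zero>\<^bsub>E\<^esub>" using ess[OF N(1)] N(2) by blast
    then obtain a where a: "a \<in> carrier R" "v = a \<odot>\<^bsub>E\<^esub> w" using img by (auto simp: carK)
    then have "a \<notin> \<mm>" using mw v(3) by auto
    then show ?thesis using smult_unit_cancel[OF E.module_axioms N(1) w a(1)] v(1) a(2) by blast
  qed
  ultimately show ?thesis using w by blast
qed

definition w :: 'e where
  "w = (SOME w. w \<in> carrier E \<and> w \<noteq> \<zero>\<^bsub>E\<^esub> \<and> (\<forall>a\<in>\<mm>. a \<odot>\<^bsub>E\<^esub> w = \<zero>\<^bsub>E\<^esub>) \<and>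
     (\<forall>N. submodule N R E \<longrightarrow> N \<noteq> {\<zero>\<^bsub>E\<^esub>} \<longrightarrow> w \<in> N))"

lemma w: "w \<in> carrier E" "w \<noteq> \<zero>\<^bsub>E\<^esub>" "\<And>a. a \<in> \<mm> \<Longrightarrow> a \<odot>\<^bsub>E\<^esub> w = \<zero>\<^bsub>E\<^esub>"
    "\<And>N. submodule N R E \<Longrightarrow> N \<noteq> {\<zero>\<^bsub>E\<^esub>} \<Longrightarrow> w \<in> N"
  using someI_ex[OF exists_socle_generator[unfolded Bex_def], folded w_def] by blast+

lemma length_socle_E: "interval_length R E {\<zero>\<^bsub>E\<^esub>} (socle E) = 1"
proof (rule E.interval_length_simple[OF E.submodule_zero submodule_socle[OF E.module_axioms]])
  show "{\<zero>\<^bsub>E\<^esub>} \<subset> socle E" using w E.submodule_zero_mem[OF submodule_socle[OF E.module_axioms]]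
    by (auto simp: socle_def)
  fix N assume N: "submodule N R E" "{\<zero>\<^bsub>E\<^esub>} \<subseteq> N" "N \<subseteq> socle E"
  show "N = {\<zero>\<^bsub>E\<^esub>} \<or> N = socle E"
  proof (cases "N = {\<zero>\<^bsub>E\<^esub>}")
    case False
    then have wN: "w \<in> N" using w(4)[OF N(1)] by blast
    have "v \<in> N" if v: "v \<in> socle E" for v
    proof (cases "v = \<zero>\<^bsub>E\<^esub>")
      case True then show ?thesis using N(2) by blast
    next
      case False
      have vE: "v \<in> carrier E" using v by (simp add: socle_def)
      note C = E.submodule_cyclic[OF vE]
      have "w \<in> (\<lambda>a. a \<odot>\<^bsub>E\<^esub> v) ` carrier R" by (rule w(4)[OF C(1)]) (use C(2) False in blast)
      then obtain c where c: "c \<in> carrier R" "w = c \<odot>\<^bsub>E\<^esub> v" by blast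
      then have "c \<notin> \<mm>" using v w(2) by (auto simp: socle_def)
      then show ?thesis using smult_unit_cancel[OF E.module_axioms N(1) vE c(1)] c(2) wN by simp
    qed
    then show ?thesis using N(3) by blast
  qed simp
qed

text \<open>Matlis duality at the level of lengths. When I grows to J = I + R x by a simple step,
  multiplication by x maps the annihilator of I in E onto the socle, with kernel the annihilator of
  J; so both sides change by one. Surjectivity is where injectivity of E enters.\<close>

lemma length_annihilated:
  "submodule I R Reg \<Longrightarrow> interval_length R E {\<zero>\<^bsub>E\<^esub>} (annihilated E I) = interval_length R Reg I (carrier R)"
proof (induction rule: submodule_induct)
  case top
  have "annihilated E (carrier R) = {\<zero>\<^bsub>E\<^esub>}"
  proof -
    have "v = \<zero>\<^bsub>E\<^esub>" if "v \<in> annihilated E (carrier R)" for v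
      using that E.smult_one[of v] by (auto simp: annihilated_def)
    moreover have "\<zero>\<^bsub>E\<^esub> \<in> annihilated E (carrier R)" by (simp add: annihilated_def)
    ultimately show ?thesis by blast
  qed
  then show ?case by simp
next
  case (step I x)
  let ?C = "(\<lambda>a. a \<otimes> x) ` carrier R"
  let ?J = "I <+>\<^bsub>Reg\<^esub> ?C"
  have sI: "a \<in> carrier R" if "a \<in> I" for a using Reg.submodule_sub[OF step(1) that] by simp
  have C: "submodule ?C R Reg" "x \<in> ?C" using Reg.submodule_cyclic[of x] step(2) by auto
  have J: "submodule ?J R Reg" by (rule Reg.submodule_set_add[OF step(1) C(1)])
  have IJ: "I \<subseteq> ?J" "?C \<subseteq> ?J" using Reg.subset_set_add[OF step(1) C(1)] by auto
  have JR: "?J \<subseteq> carrier R" using Reg.submodule_sub[OF J] by auto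
  have len_IJ: "interval_length R Reg I ?J = 1"
    using interval_length_step[OF Reg.module_axioms step(1), of x] step by simp
  have L: "submodule (annihilated E I) R E"
    by (rule submodule_annihilated[OF E.module_axioms]) (use sI in blast)
  have x: "(\<lambda>v. x \<odot>\<^bsub>E\<^esub> v) \<in> linear_maps R E E" by (rule lin_smult_left[OF E.module_axioms step(2)])
  have ker: "{v \<in> annihilated E I. x \<odot>\<^bsub>E\<^esub> v = \<zero>\<^bsub>E\<^esub>} = annihilated E ?J"
  proof
    show "annihilated E ?J \<subseteq> {v \<in> annihilated E I. x \<odot>\<^bsub>E\<^esub> v = \<zero>\<^bsub>E\<^esub>}"
      using IJ C(2) by (auto simp: annihilated_def)
    show "{v \<in> annihilated E I. x \<odot>\<^bsub>E\<^esub> v = \<zero>\<^bsub>E\<^esub>} \<subseteq> annihilated E ?J"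
    proof
      fix v assume v: "v \<in> {v \<in> annihilated E I. x \<odot>\<^bsub>E\<^esub> v = \<zero>\<^bsub>E\<^esub>}"
      have "a \<odot>\<^bsub>E\<^esub> v = \<zero>\<^bsub>E\<^esub>" if a: "a \<in> ?J" for a
      proof -
        obtain i c where "i \<in> I" "c \<in> carrier R" "a = i \<oplus> c \<otimes> x" using a by (auto simp: set_add_def')
        then show ?thesis
          using v sI step(2) by (simp add: annihilated_def E.smult_l_distr E.smult_assoc1)
      qed
      then show "v \<in> annihilated E ?J" using v by (auto simp: annihilated_def)
    qed
  qed
  have img: "(\<lambda>v. x \<odot>\<^bsub>E\<^esub> v) ` annihilated E I = socle E"
  proof safe
    fix v assume v: "v \<in> annihilated E I"
    then have "a \<odot>\<^bsub>E\<^esub> (x \<odot>\<^bsub>E\<^esub> v) = \<zero>\<^bsub>E\<^esub>" if "a \<in> \<mm>" for a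
      using step(2) step(4)[OF that] m_carrier[OF that]
      by (simp add: annihilated_def E.smult_assoc1[symmetric])
    then show "x \<odot>\<^bsub>E\<^esub> v \<in> socle E" using v step(2) by (simp add: socle_def annihilated_def)
  next
    fix s assume s: "s \<in> socle E"
    then have sE: "s \<in> carrier E" by (simp add: socle_def)
    \<comment> \<open>c is a possible coefficient of x in z. Sending z to c s is a map from J to E
      that kills I and takes x to s; by Baer it is multiplication onto some y, and then x y =
      s.\<close>
    define P where "P z c \<longleftrightarrow> c \<in> carrier R \<and> (\<exists>i\<in>I. z = i \<oplus> c \<otimes> x)" for z c
    define f where "f z = (SOME c. P z c) \<odot>\<^bsub>E\<^esub> s" for z
    have f: "f z = c \<odot>\<^bsub>E\<^esub> s" if zc: "P z c" for z c
    proof -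
      define d where "d = (SOME d. P z d)"
      have zd: "P z d" unfolding d_def using zc by (rule someI)
      obtain i k where ik: "i \<in> I" "z = i \<oplus> c \<otimes> x" "k \<in> I" "z = k \<oplus> d \<otimes> x"
        "c \<in> carrier R" "d \<in> carrier R" using zc zd by (auto simp: P_def)
      have eq: "i \<oplus> c \<otimes> x = k \<oplus> d \<otimes> x" using ik by simp
      have "(c \<ominus> d) \<otimes> x = (i \<oplus> c \<otimes> x) \<ominus> i \<ominus> d \<otimes> x"
        using ik(5,6) sI[OF ik(1)] step(2) by algebra
      also have "\<dots> = (k \<oplus> d \<otimes> x) \<ominus> i \<ominus> d \<otimes> x" using eq by simp
      also have "\<dots> = k \<ominus> i"
        using ik(5,6) sI[OF ik(1)] sI[OF ik(3)] step(2) by algebra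
      finally have cx: "(c \<ominus> d) \<otimes> x = k \<ominus> i" .
      have "ideal I R" using step(1) submodule_regular_iff[OF is_cring] by blast
      then have "k \<ominus> i \<in> I" using ik unfolding minus_eq
        by (meson additive_subgroup.a_closed additive_subgroup.a_inv_closed ideal.axioms(1))
      then have "(c \<ominus> d) \<odot>\<^bsub>Reg\<^esub> x \<in> I" using cx by simp
      \<comment> \<open>Otherwise c - d would be a unit and x would lie in I. So two coefficients of
        the same z differ by an element of m, which kills the socle element s.\<close>
      then have "c \<ominus> d \<in> \<mm>"
        using smult_unit_cancel[OF Reg.module_axioms step(1), of x "c \<ominus> d"] step(2,3) ik by auto
      then have 0: "(c \<ominus> d) \<odot>\<^bsub>E\<^esub> s = \<zero>\<^bsub>E\<^esub>" using s by (simp add: socle_def)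
      have "c = (c \<ominus> d) \<oplus> d" using ik(5,6) by algebra
      then have "c \<odot>\<^bsub>E\<^esub> s = (c \<ominus> d) \<odot>\<^bsub>E\<^esub> s \<oplus>\<^bsub>E\<^esub> d \<odot>\<^bsub>E\<^esub> s"
        using ik sE by (metis E.smult_l_distr minus_closed)
      also have "\<dots> = d \<odot>\<^bsub>E\<^esub> s" using 0 ik(6) sE by simp
      finally show ?thesis unfolding f_def d_def[symmetric] by (rule sym)
    qed
    have PJ: "\<exists>c. P z c" if "z \<in> ?J" for z using that by (auto simp: set_add_def' P_def)
    have addP: "P (y \<oplus> z) (c \<oplus> d)" if yz: "P y c" "P z d" for y z c d
    proof -
      obtain i k where ik: "i \<in> I" "y = i \<oplus> c \<otimes> x" "k \<in> I" "z = k \<oplus> d \<otimes> x"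
        "c \<in> carrier R" "d \<in> carrier R" using yz by (auto simp: P_def)
      have "y \<oplus> z = (i \<oplus> k) \<oplus> (c \<oplus> d) \<otimes> x"
        unfolding ik(2,4) using ik(5,6) sI[OF ik(1)] sI[OF ik(3)] step(2) by algebra
      moreover have "i \<oplus> k \<in> I" using Reg.submodule_add[OF step(1) ik(1,3)] by simp
      ultimately show ?thesis using ik by (auto simp: P_def)
    qed
    have smultP: "P (a \<otimes> y) (a \<otimes> c)" if yc: "P y c" and a: "a \<in> carrier R" for a y c
    proof -
      obtain i where ik: "i \<in> I" "y = i \<oplus> c \<otimes> x" "c \<in> carrier R" using yc by (auto simp: P_def)
      have "a \<otimes> y = (a \<otimes> i) \<oplus> (a \<otimes> c) \<otimes> x"
        unfolding ik(2) using ik(3) sI[OF ik(1)] step(2) a by algebra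
      moreover have "a \<otimes> i \<in> I" using Reg.submodule_smult[OF step(1) a ik(1)] by simp
      ultimately show ?thesis using ik a by (auto simp: P_def)
    qed
    have "f \<in> linear_maps R (Reg\<lparr>carrier := ?J\<rparr>) E"
    proof (rule linear_mapsI)
      show "f z \<in> carrier E" if z: "z \<in> carrier (Reg\<lparr>carrier := ?J\<rparr>)" for z
      proof -
        obtain c where c: "P z c" using z PJ[of z] by auto
        then show ?thesis using f[OF c] sE by (auto simp: P_def)
      qed
      show "f (y \<oplus>\<^bsub>Reg\<lparr>carrier := ?J\<rparr>\<^esub> z) = f y \<oplus>\<^bsub>E\<^esub> f z"
        if yz: "y \<in> carrier (Reg\<lparr>carrier := ?J\<rparr>)" "z \<in> carrier (Reg\<lparr>carrier := ?J\<rparr>)" for y z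
      proof -
        obtain c d where cd: "P y c" "P z d" using yz PJ[of y] PJ[of z] by auto
        then have "c \<in> carrier R" "d \<in> carrier R" by (auto simp: P_def)
        then show ?thesis using f[OF addP[OF cd]] f[OF cd(1)] f[OF cd(2)] sE
          by (simp add: E.smult_l_distr)
      qed
      show "f (a \<odot>\<^bsub>Reg\<lparr>carrier := ?J\<rparr>\<^esub> z) = a \<odot>\<^bsub>E\<^esub> f z"
        if z: "a \<in> carrier R" "z \<in> carrier (Reg\<lparr>carrier := ?J\<rparr>)" for a z
      proof -
        obtain c where c: "P z c" using z PJ[of z] by auto
        then have "c \<in> carrier R" by (auto simp: P_def)
        then show ?thesis using f[OF smultP[OF c z(1)]] f[OF c] sE z(1)
          by (simp add: E.smult_assoc1)
      qed
    qed
    from injective_module_baer[OF E_injective J this]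
    obtain y where y: "y \<in> carrier E" "\<And>a. a \<in> ?J \<Longrightarrow> f a = a \<odot>\<^bsub>E\<^esub> y" by blast
    have "P i \<zero>" if "i \<in> I" for i using that sI step(2) by (auto simp: P_def)
    then have "y \<in> annihilated E I"
      using y f[of _ \<zero>] IJ(1) sE by (auto simp: annihilated_def subset_iff) metis
    moreover have "P x \<one>"
      using step(2) Reg.submodule_zero_mem[OF step(1)] by (auto simp: P_def intro!: bexI[of _ \<zero>])
    then have "x \<odot>\<^bsub>E\<^esub> y = s" using f[of x \<one>] y(2)[of x] IJ(2) C(2) sE by auto
    ultimately show "s \<in> (\<lambda>v. x \<odot>\<^bsub>E\<^esub> v) ` annihilated E I" by blast
  qed
  have "interval_length R E {\<zero>\<^bsub>E\<^esub>} (annihilated E I) =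
      interval_length R E {\<zero>\<^bsub>E\<^esub>} (annihilated E ?J) + 1"
    using interval_length_rank_nullity[OF E.module_axioms E.module_axioms x L]
    unfolding ker img length_socle_E .
  moreover have "interval_length R Reg I (carrier R) =
     interval_length R Reg I ?J + interval_length R Reg ?J (carrier R)"
    using Reg.interval_length_add[OF step(1) J Reg.carrier_is_submodule IJ(1)] JR by simp
  ultimately show ?case using step(5) len_IJ by (simp add: add.commute)
qed

lemma length_E: "interval_length R E {\<zero>\<^bsub>E\<^esub>} (carrier E) = enat (1 + embdim + sqdim)"
proof -
  have "annihilated E {\<zero>} = carrier E" by (auto simp: annihilated_def)
  then show ?thesis using length_annihilated[of "{\<zero>}"] Reg.submodule_zero length_R by simp
qed

text \<open>If a kills E, the annihilator of R a in E is all of E. Comparing lengths, R / R a is as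
  long as R, so R a = 0.\<close>

lemma E_faithful:
  assumes a: "a \<in> carrier R" and "\<And>v. v \<in> carrier E \<Longrightarrow> a \<odot>\<^bsub>E\<^esub> v = \<zero>\<^bsub>E\<^esub>"
  shows "a = \<zero>"
proof -
  let ?I = "(\<lambda>b. b \<otimes> a) ` carrier R"
  have I: "submodule ?I R Reg" "a \<in> ?I" using Reg.submodule_cyclic[of a] a by auto
  have "annihilated E ?I = carrier E" using assms by (auto simp: annihilated_def E.smult_assoc1)
  then have len: "interval_length R Reg ?I (carrier R) = enat (1 + embdim + sqdim)"
    using length_annihilated[OF I(1)] length_E by simp
  have z: "{\<zero>} \<subseteq> ?I" using Reg.submodule_zero_mem[OF I(1)] by simp
  have R: "submodule (carrier R) R Reg" using Reg.carrier_is_submodule by simp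
  have 0: "submodule {\<zero>} R Reg" using Reg.submodule_zero by simp
  have "interval_length R Reg {\<zero>} (carrier R) =
      interval_length R Reg {\<zero>} ?I + interval_length R Reg ?I (carrier R)"
    by (rule Reg.interval_length_add[OF 0 I(1) R z]) (use a in auto)
  then have "interval_length R Reg {\<zero>} ?I = 0"
    unfolding len length_R by (rule enat_eq_add_imp_0)
  then show ?thesis using Reg.interval_length_eq_0_iff[OF 0 I(1) z] I(2) by auto
qed

text \<open>Sending 1 to the generator y maps R onto E. The lengths are equal, so the map is
  bijective and R inherits injectivity.\<close>

lemma gorenstein_if_cyclic:
  assumes y: "y \<in> carrier E" "carrier E = (\<lambda>a. a \<odot>\<^bsub>E\<^esub> y) ` carrier R"
  shows "gorenstein R \<mm>"
proof (rule gorenstein_if_self_injective)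
  show "noetherian_local_ring R \<mm>" by (rule noetherian_local_ring_axioms)
  let ?f = "\<lambda>a. a \<odot>\<^bsub>E\<^esub> y"
  have f: "?f \<in> linear_maps R Reg E" by (rule lin_smult_right[OF E.module_axioms y(1)])
  have K: "submodule {a \<in> carrier R. ?f a \<in> {\<zero>\<^bsub>E\<^esub>}} R Reg"
    using submodule_vimage[OF Reg.module_axioms E.module_axioms f Reg.carrier_is_submodule E.submodule_zero]
    by simp
  have z: "{\<zero>} \<subseteq> {a \<in> carrier R. ?f a \<in> {\<zero>\<^bsub>E\<^esub>}}" using y by simp
  have "interval_length R Reg {\<zero>} (carrier R) =
      interval_length R Reg {\<zero>} {a \<in> carrier R. ?f a \<in> {\<zero>\<^bsub>E\<^esub>}} +
      interval_length R E {\<zero>\<^bsub>E\<^esub>} (carrier E)"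
    using interval_length_rank_nullity[OF Reg.module_axioms E.module_axioms f Reg.carrier_is_submodule] y(2)
    by simp
  then have "interval_length R Reg {\<zero>} {a \<in> carrier R. ?f a \<in> {\<zero>\<^bsub>E\<^esub>}} = 0"
    unfolding length_E length_R by (rule enat_eq_add_imp_0)
  moreover have "submodule {\<zero>} R Reg" using Reg.submodule_zero by simp
  ultimately have ker: "a = \<zero>" if "a \<in> carrier R" "?f a = \<zero>\<^bsub>E\<^esub>" for a
    using Reg.interval_length_eq_0_iff[OF _ K z] that by auto
  have "\<exists>h \<in> linear_maps R (E\<lparr>carrier := ?f ` carrier Reg\<rparr>) Reg. \<forall>a\<in>carrier Reg. h (?f a) = a"
  proof (rule lin_factor[OF Reg.module_axioms E.module_axioms Reg.module_axioms f])
    show "(\<lambda>a. a) \<in> linear_maps R Reg Reg" by (rule linear_mapsI) auto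
  qed (use ker in auto)
  moreover have "E\<lparr>carrier := ?f ` carrier Reg\<rparr> = E" using y(2) by simp
  ultimately obtain h where h: "h \<in> linear_maps R E Reg" "\<And>a. a \<in> carrier R \<Longrightarrow> h (?f a) = a"
    by auto
  show "injective_module R Reg"
    by (rule injective_module_retract[OF E_injective Reg.module_axioms f h(1)]) (simp add: h(2))
qed

lemma minimal_cover_E:
  "\<exists>n p. p \<in> linear_maps R (F n) E \<and> p ` carrier (F n) = carrier E \<and>
         (\<forall>u \<in> carrier (F n). p u = \<zero>\<^bsub>E\<^esub> \<longrightarrow> u \<in> mF n)"
  by (rule minimal_cover_submodule[OF E.module_axioms E.carrier_is_submodule]) (simp add: length_E)

text \<open>With m = R x, multiplication by x on E has kernel the socle, of length one, and image m
  E. Hence E / m E has length one too, and E is cyclic.\<close>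

lemma gorenstein_if_embdim_le_1:
  assumes "embdim \<le> 1"
  shows "gorenstein R \<mm>"
proof -
  obtain x where x: "x \<in> \<mm>" "\<mm> = (\<lambda>a. a \<otimes> x) ` carrier R"
    using principal_if_embdim_le_1[OF assms] by blast
  have xR: "x \<in> carrier R" using m_carrier[OF x(1)] .
  let ?f = "\<lambda>v. x \<odot>\<^bsub>E\<^esub> v"
  have f: "?f \<in> linear_maps R E E" by (rule lin_smult_left[OF E.module_axioms xR])
  have m_x: "\<exists>b\<in>carrier R. a = b \<otimes> x" if "a \<in> \<mm>" for a using that x(2) by blast
  have ker: "{v \<in> carrier E. x \<odot>\<^bsub>E\<^esub> v = \<zero>\<^bsub>E\<^esub>} = socle E"
  proof
    show "{v \<in> carrier E. x \<odot>\<^bsub>E\<^esub> v = \<zero>\<^bsub>E\<^esub>} \<subseteq> socle E"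
      using m_x xR by (fastforce simp: socle_def E.smult_assoc1)
  qed (use x(1) in \<open>auto simp: socle_def\<close>)
  have img: "ideal_mult R \<mm> E (carrier E) = ?f ` carrier E"
  proof
    show "ideal_mult R \<mm> E (carrier E) \<subseteq> ?f ` carrier E"
    proof (rule E.ideal_mult_least)
      show "submodule (?f ` carrier E) R E"
        by (rule submodule_image[OF E.module_axioms E.module_axioms f E.carrier_is_submodule])
      fix a v assume a: "a \<in> \<mm>" and v: "v \<in> carrier E"
      obtain b where b: "b \<in> carrier R" "a = b \<otimes> x" using m_x[OF a] by blast
      then have "a \<odot>\<^bsub>E\<^esub> v = x \<odot>\<^bsub>E\<^esub> (b \<odot>\<^bsub>E\<^esub> v)"
        using v xR by (simp add: E.smult_assoc1[symmetric] m_comm)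
      then show "a \<odot>\<^bsub>E\<^esub> v \<in> ?f ` carrier E" using b v by blast
    qed
    show "?f ` carrier E \<subseteq> ideal_mult R \<mm> E (carrier E)"
      using E.ideal_mult_mem[OF x(1)] by blast
  qed
  obtain n p where p: "p \<in> linear_maps R (F n) E" "p ` carrier (F n) = carrier E"
    "\<And>u. u \<in> carrier (F n) \<Longrightarrow> p u = \<zero>\<^bsub>E\<^esub> \<Longrightarrow> u \<in> mF n" using minimal_cover_E by blast
  have n: "interval_length R E (?f ` carrier E) (carrier E) = enat n"
    using minimal_cover_length(1)[OF E.module_axioms p(1,3)] unfolding p(2) img .
  have sub: "submodule (?f ` carrier E) R E"
    by (rule submodule_image[OF E.module_axioms E.module_axioms f E.carrier_is_submodule])
  have "interval_length R E {\<zero>\<^bsub>E\<^esub>} (carrier E) = 1 + interval_length R E {\<zero>\<^bsub>E\<^esub>} (?f ` carrier E)"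
    using interval_length_rank_nullity[OF E.module_axioms E.module_axioms f E.carrier_is_submodule]
    unfolding ker length_socle_E .
  moreover have "interval_length R E {\<zero>\<^bsub>E\<^esub>} (carrier E) =
      interval_length R E {\<zero>\<^bsub>E\<^esub>} (?f ` carrier E) + enat n"
    using E.interval_length_add[OF E.submodule_zero sub E.carrier_is_submodule]
      E.submodule_zero_mem[OF sub] E.submodule_sub[OF sub] n by auto
  ultimately have "n = 1"
    unfolding length_E
    by (cases "interval_length R E {\<zero>\<^bsub>E\<^esub>} (?f ` carrier E)") (auto simp: one_enat_def)
  then show ?thesis using cyclic_image[OF E.module_axioms p(1)] p(2) gorenstein_if_cyclic by auto
qed

end

section \<open>Independence of Ext of the free resolution\<close>

text \<open>The kernel condition in degree n, with the augmentation in the role of the differential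
  out of degree zero. This lets the inductive steps below treat all degrees alike.\<close>

definition resolution_cycle ::
    "(nat \<Rightarrow> ('a, 'p) module) \<Rightarrow> (nat \<Rightarrow> 'p \<Rightarrow> 'p) \<Rightarrow> ('a, 'm, 'z) module_scheme \<Rightarrow> ('p \<Rightarrow> 'm) \<Rightarrow> nat \<Rightarrow> 'p \<Rightarrow> bool" where
  "resolution_cycle P d N \<epsilon> n u = (case n of 0 \<Rightarrow> \<epsilon> u = \<zero>\<^bsub>N\<^esub> | Suc k \<Rightarrow> d k u = \<zero>\<^bsub>P k\<^esub>)"

lemma resolution_cycle_simps [simp]:
  "resolution_cycle P d N \<epsilon> 0 u \<longleftrightarrow> \<epsilon> u = \<zero>\<^bsub>N\<^esub>"
  "resolution_cycle P d N \<epsilon> (Suc k) u \<longleftrightarrow> d k u = \<zero>\<^bsub>P k\<^esub>"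
  by (simp_all add: resolution_cycle_def)

lemma free_resolutionD:
  assumes "free_resolution R N X d \<epsilon>"
  shows "\<epsilon> \<in> linear_maps R (free_module R (X 0)) N"
    and "\<epsilon> ` carrier (free_module R (X 0)) = carrier N"
    and "d n \<in> linear_maps R (free_module R (X (Suc n))) (free_module R (X n))"
    and "u \<in> d n ` carrier (free_module R (X (Suc n))) \<longleftrightarrow>
           u \<in> carrier (free_module R (X n)) \<and> resolution_cycle (\<lambda>n. free_module R (X n)) d N \<epsilon> n u"
proof -
  let ?P = "\<lambda>n. free_module R (X n)"
  have *: "\<epsilon> \<in> linear_maps R (?P 0) N" "\<epsilon> ` carrier (?P 0) = carrier N"
    "\<And>n. d n \<in> linear_maps R (?P (Suc n)) (?P n)"
    "d 0 ` carrier (?P (Suc 0)) = a_kernel (?P 0) N \<epsilon>"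
    "\<And>n. d (Suc n) ` carrier (?P (Suc (Suc n))) = a_kernel (?P (Suc n)) (?P n) (d n)"
    using assms unfolding free_resolution_def Let_def by simp_all
  show "\<epsilon> \<in> linear_maps R (?P 0) N" "\<epsilon> ` carrier (?P 0) = carrier N"
    "d n \<in> linear_maps R (?P (Suc n)) (?P n)" by (fact *)+
  show "u \<in> d n ` carrier (?P (Suc n)) \<longleftrightarrow> u \<in> carrier (?P n) \<and> resolution_cycle ?P d N \<epsilon> n u"
    by (cases n) (simp_all only: *(4,5) a_kernel_iff resolution_cycle_simps)
qed

lemma free_resolution_comparison:
  assumes N: "module R N"
    and X: "free_resolution R N X d \<epsilon>" and Y: "free_resolution R N Y d' \<epsilon>'"
  shows "\<exists>\<alpha>. (\<forall>n. \<alpha> n \<in> linear_maps R (free_module R (X n)) (free_module R (Y n))) \<and>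
            (\<forall>u\<in>carrier (free_module R (X 0)). \<epsilon>' (\<alpha> 0 u) = \<epsilon> u) \<and>
            (\<forall>n. \<forall>u\<in>carrier (free_module R (X (Suc n))). d' n (\<alpha> (Suc n) u) = \<alpha> n (d n u))"
proof -
  interpret N: module R N by fact
  let ?P = "\<lambda>n. free_module R (X n)" and ?Q = "\<lambda>n. free_module R (Y n)"
  have P: "module R (?P n)" and Q: "module R (?Q n)" for n
    by (rule free_module_is_module[OF N.R.is_cring])+
  note X = free_resolutionD[OF X] and Y = free_resolutionD[OF Y]
  let ?cX = "resolution_cycle ?P d N \<epsilon>" and ?cY = "resolution_cycle ?Q d' N \<epsilon>'"
  \<comment> \<open>The invariant is that cycles go to cycles. By exactness the composite with the
    next differential then lands among the boundaries, where it can be lifted.\<close>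
  let ?good = "\<lambda>n a. a \<in> linear_maps R (?P n) (?Q n) \<and> (\<forall>u\<in>carrier (?P n). ?cX n u \<longrightarrow> ?cY n (a u)) \<and>
      (n = 0 \<longrightarrow> (\<forall>u\<in>carrier (?P 0). \<epsilon>' (a u) = \<epsilon> u))"
  let ?next = "\<lambda>n a b. \<forall>u\<in>carrier (?P (Suc n)). d' n (b u) = a (d n u)"
  have "\<exists>\<alpha>. \<forall>n. ?good n (\<alpha> n) \<and> ?next n (\<alpha> n) (\<alpha> (Suc n))"
  proof (rule dependent_nat_choice)
    obtain a where "a \<in> linear_maps R (?P 0) (?Q 0)" "\<forall>u\<in>carrier (?P 0). \<epsilon>' (a u) = \<epsilon> u"
      using free_module_projective[OF Q N X(1) Y(1)] X(2) Y(2) by auto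
    then show "\<exists>a. ?good 0 a" by auto
  next
    fix a n assume a: "?good n a"
    then have aL: "a \<in> linear_maps R (?P n) (?Q n)" by blast
    have "(\<lambda>u. a (d n u)) ` carrier (?P (Suc n)) \<subseteq> d' n ` carrier (?Q (Suc n))"
    proof
      fix v assume "v \<in> (\<lambda>u. a (d n u)) ` carrier (?P (Suc n))"
      then obtain w where w: "w \<in> d n ` carrier (?P (Suc n))" "v = a w" by blast
      then show "v \<in> d' n ` carrier (?Q (Suc n))"
        using a lin_closed[OF aL] unfolding X(4) Y(4) by blast
    qed
    then obtain b where b: "b \<in> linear_maps R (?P (Suc n)) (?Q (Suc n))"
      "\<forall>u\<in>carrier (?P (Suc n)). d' n (b u) = a (d n u)"
      using free_module_projective[OF Q Q lin_comp[OF X(3) aL] Y(3)] by blast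
    then show "\<exists>b. ?good (Suc n) b \<and> ?next n a b"
      using lin_zero[OF P Q aL] by (intro exI[of _ b]) auto
  qed
  then obtain \<alpha> where \<alpha>: "\<And>n. ?good n (\<alpha> n) \<and> ?next n (\<alpha> n) (\<alpha> (Suc n))" by blast
  show ?thesis
    by (rule exI[of _ \<alpha>]) (use \<alpha> in blast)
qed

text \<open>A lift of the identity differs from the identity by d s + s d. It is applied to the
  round trip between two resolutions.\<close>

lemma free_resolution_homotopy:
  assumes N: "module R N" and X: "free_resolution R N X d \<epsilon>"
    and \<theta>: "\<And>n. \<theta> n \<in> linear_maps R (free_module R (X n)) (free_module R (X n))"
    and \<theta>0: "\<And>u. u \<in> carrier (free_module R (X 0)) \<Longrightarrow> \<epsilon> (\<theta> 0 u) = \<epsilon> u"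
    and \<theta>d: "\<And>n u. u \<in> carrier (free_module R (X (Suc n))) \<Longrightarrow> d n (\<theta> (Suc n) u) = \<theta> n (d n u)"
  shows "\<exists>s. (\<forall>n. s n \<in> linear_maps R (free_module R (X n)) (free_module R (X (Suc n)))) \<and>
           (\<forall>n. \<forall>u\<in>carrier (free_module R (X (Suc n))). d (Suc n) (s (Suc n) u) =
              \<theta> (Suc n) u \<ominus>\<^bsub>free_module R (X (Suc n))\<^esub> u \<ominus>\<^bsub>free_module R (X (Suc n))\<^esub> s n (d n u))"
proof -
  interpret N: module R N by fact
  let ?P = "\<lambda>n. free_module R (X n)"
  have P: "module R (?P n)" for n
    by (rule free_module_is_module[OF N.R.is_cring])
  note X = free_resolutionD[OF X]
  let ?c = "resolution_cycle ?P d N \<epsilon>"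
  have idl: "(\<lambda>u. u) \<in> linear_maps R (?P n) (?P n)" for n by (rule linear_mapsI) auto
  \<comment> \<open>On cycles the term with the earlier homotopy drops out. This weaker equation
    suffices for the next step, since boundaries are cycles: it shows that \<open>?r\<close> below
    takes values in cycles.\<close>
  let ?good = "\<lambda>n s. s \<in> linear_maps R (?P n) (?P (Suc n)) \<and>
      (\<forall>u\<in>carrier (?P n). ?c n u \<longrightarrow> d n (s u) = \<theta> n u \<ominus>\<^bsub>?P n\<^esub> u)"
  let ?next = "\<lambda>n s t. \<forall>u\<in>carrier (?P (Suc n)).
      d (Suc n) (t u) = \<theta> (Suc n) u \<ominus>\<^bsub>?P (Suc n)\<^esub> u \<ominus>\<^bsub>?P (Suc n)\<^esub> s (d n u)"
  have "\<exists>s. \<forall>n. ?good n (s n) \<and> ?next n (s n) (s (Suc n))"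
  proof (rule dependent_nat_choice)
    interpret P0: module R "?P 0" by (rule P)
    have "(\<lambda>u. \<theta> 0 u \<ominus>\<^bsub>?P 0\<^esub> u) ` carrier (?P 0) \<subseteq> d 0 ` carrier (?P (Suc 0))"
    proof
      fix v assume "v \<in> (\<lambda>u. \<theta> 0 u \<ominus>\<^bsub>?P 0\<^esub> u) ` carrier (?P 0)"
      then obtain u where u: "u \<in> carrier (?P 0)" "v = \<theta> 0 u \<ominus>\<^bsub>?P 0\<^esub> u" by blast
      have tu: "\<theta> 0 u \<in> carrier (?P 0)" by (rule lin_closed[OF \<theta> u(1)])
      have "\<epsilon> v = \<zero>\<^bsub>N\<^esub>"
        unfolding u(2) lin_minus[OF P N X(1) tu u(1)] \<theta>0[OF u(1)]
        using lin_closed[OF X(1) u(1)] by (simp add: N.minus_eq_zero_iff)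
      then show "v \<in> d 0 ` carrier (?P (Suc 0))" unfolding X(4) using u tu by simp
    qed
    then have "\<exists>s \<in> linear_maps R (?P 0) (?P (Suc 0)). \<forall>u\<in>carrier (?P 0). d 0 (s u) = \<theta> 0 u \<ominus>\<^bsub>?P 0\<^esub> u"
      by (rule free_module_projective[OF P P lin_diff[OF P \<theta> idl] X(3)])
    then show "\<exists>s. ?good 0 s" by blast
  next
    fix s n assume s: "?good n s"
    then have sL: "s \<in> linear_maps R (?P n) (?P (Suc n))" by blast
    interpret Pn: module R "?P n" by (rule P)
    interpret Ps: module R "?P (Suc n)" by (rule P)
    let ?r = "\<lambda>u. \<theta> (Suc n) u \<ominus>\<^bsub>?P (Suc n)\<^esub> u \<ominus>\<^bsub>?P (Suc n)\<^esub> s (d n u)"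
    have r: "?r \<in> linear_maps R (?P (Suc n)) (?P (Suc n))"
      by (rule lin_diff[OF P lin_diff[OF P \<theta> idl] lin_comp[OF X(3) sL]])
    have "?r ` carrier (?P (Suc n)) \<subseteq> d (Suc n) ` carrier (?P (Suc (Suc n)))"
    proof
      fix v assume "v \<in> ?r ` carrier (?P (Suc n))"
      then obtain u where u: "u \<in> carrier (?P (Suc n))" "v = ?r u" by blast
      let ?v = "d n u"
      have tu: "\<theta> (Suc n) u \<in> carrier (?P (Suc n))" by (rule lin_closed[OF \<theta> u(1)])
      have du: "?v \<in> carrier (?P n)" by (rule lin_closed[OF X(3) u(1)])
      have sdu: "s ?v \<in> carrier (?P (Suc n))" by (rule lin_closed[OF sL du])
      have tv: "\<theta> n ?v \<in> carrier (?P n)" by (rule lin_closed[OF \<theta> du])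
      have "?c n ?v" using X(4)[of ?v n] u(1) by blast
      then have ds: "d n (s ?v) = \<theta> n ?v \<ominus>\<^bsub>?P n\<^esub> ?v" using s du by blast
      have tuu: "\<theta> (Suc n) u \<ominus>\<^bsub>?P (Suc n)\<^esub> u \<in> carrier (?P (Suc n))" using tu u(1) by simp
      have "d n v = (\<theta> n ?v \<ominus>\<^bsub>?P n\<^esub> ?v) \<ominus>\<^bsub>?P n\<^esub> (\<theta> n ?v \<ominus>\<^bsub>?P n\<^esub> ?v)"
        unfolding u(2) lin_minus[OF P P X(3) tuu sdu] lin_minus[OF P P X(3) tu u(1)] ds \<theta>d[OF u(1)] ..
      also have "\<dots> = \<zero>\<^bsub>?P n\<^esub>" using tv du by (subst Pn.minus_eq_zero_iff) auto
      finally show "v \<in> d (Suc n) ` carrier (?P (Suc (Suc n)))"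
        unfolding X(4) u(2) using lin_closed[OF r u(1)] by simp
    qed
    then have "\<exists>t \<in> linear_maps R (?P (Suc n)) (?P (Suc (Suc n))).
        \<forall>u\<in>carrier (?P (Suc n)). d (Suc n) (t u) = ?r u"
      by (rule free_module_projective[OF P P r X(3)])
    then obtain t where t: "t \<in> linear_maps R (?P (Suc n)) (?P (Suc (Suc n)))"
      "\<And>u. u \<in> carrier (?P (Suc n)) \<Longrightarrow> d (Suc n) (t u) = ?r u" by blast
    have "d (Suc n) (t u) = \<theta> (Suc n) u \<ominus>\<^bsub>?P (Suc n)\<^esub> u"
      if u: "u \<in> carrier (?P (Suc n))" "d n u = \<zero>\<^bsub>?P n\<^esub>" for u
    proof -
      have "\<theta> (Suc n) u \<in> carrier (?P (Suc n))" by (rule lin_closed[OF \<theta> u(1)])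
      then show ?thesis
        unfolding t(2)[OF u(1)] u(2) lin_zero[OF P P sL] using u(1)
        by (simp add: a_minus_def)
    qed
    then show "\<exists>t. ?good (Suc n) t \<and> ?next n s t" using t by (intro exI[of _ t]) simp
  qed
  then obtain s where s: "\<And>n. ?good n (s n) \<and> ?next n (s n) (s (Suc n))" by blast
  show ?thesis
    by (rule exI[of _ s]) (use s in blast)
qed

text \<open>Vanishing says that the set of coboundaries is the only coset, so it is the coset of f.
  The map is first restricted to the carrier, as elements of \<open>Hom_module\<close> are
  extensional.\<close>

lemma Ext_zero_imp_coboundary:
  assumes N: "module R N" and M: "module R M" and zero: "zero_module (Ext R (Suc k) N M)"
    and res: "some_free_resolution R N = (X, d)"
    and f: "f \<in> linear_maps R (free_module R (X (Suc k))) M"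
    and fd: "\<And>u. u \<in> carrier (free_module R (X (Suc (Suc k)))) \<Longrightarrow> f (d (Suc k) u) = \<zero>\<^bsub>M\<^esub>"
    and d: "\<And>n. d n \<in> linear_maps R (free_module R (X (Suc n))) (free_module R (X n))"
  shows "\<exists>h \<in> linear_maps R (free_module R (X k)) M. \<forall>u\<in>carrier (free_module R (X (Suc k))). f u = h (d k u)"
proof -
  interpret N: module R N by fact
  interpret M: module R M by fact
  let ?P = "\<lambda>n. free_module R (X n)"
  let ?H = "Hom_module R (?P (Suc k)) M"
  let ?B = "coboundaries R ?P d M (Suc k)"
  define f' where "f' = restrict f (carrier (?P (Suc k)))"
  interpret P: module R "?P (Suc k)" by (rule free_module_is_module[OF N.R.is_cring])
  have f': "f' \<in> linear_maps R (?P (Suc k)) M"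
    unfolding f'_def by (rule linear_mapsI) (simp_all add: lin_closed[OF f] lin_add[OF f] lin_smult[OF f])
  have "f' \<in> cocycles R ?P d M (Suc k)"
  proof -
    have "compose (carrier (?P (Suc (Suc k)))) f' (d (Suc k)) = (\<lambda>x\<in>carrier (?P (Suc (Suc k))). \<zero>\<^bsub>M\<^esub>)"
      using fd lin_closed[OF d[of "Suc k"]] by (auto simp: compose_def f'_def fun_eq_iff)
    then show ?thesis using f' by (auto simp: cocycles_def Hom_module_def f'_def)
  qed
  then have "?B +>\<^bsub>?H\<lparr>carrier := cocycles R ?P d M (Suc k)\<rparr>\<^esub> f' \<in>
      carrier (Hom_cohomology R ?P d M (Suc k))"
    unfolding Hom_cohomology_def quotient_module_def A_RCOSETS_def' by auto
  moreover have "carrier (Hom_cohomology R ?P d M (Suc k)) = {?B}"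
    using zero res unfolding zero_module_def Ext_def by (simp add: Hom_cohomology_def quotient_module_def)
  ultimately have coset: "?B +>\<^bsub>?H\<lparr>carrier := cocycles R ?P d M (Suc k)\<rparr>\<^esub> f' = ?B" by blast
  \<comment> \<open>The zero map is a coboundary, so \<open>f'\<close> is a member of its own
    coset.\<close>
  have "(\<lambda>x\<in>carrier (?P (Suc k)). \<zero>\<^bsub>M\<^esub>) \<in> ?B"
  proof -
    have "(\<lambda>x\<in>carrier (?P k). \<zero>\<^bsub>M\<^esub>) \<in> carrier (Hom_module R (?P k) M)"
    proof -
      interpret Pk: module R "?P k" by (rule free_module_is_module[OF N.R.is_cring])
      show ?thesis by (auto simp: Hom_module_def linear_maps_def)
    qed
    moreover have "compose (carrier (?P (Suc k))) (\<lambda>x\<in>carrier (?P k). \<zero>\<^bsub>M\<^esub>) (d k) =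
        (\<lambda>x\<in>carrier (?P (Suc k)). \<zero>\<^bsub>M\<^esub>)"
      using lin_closed[OF d[of k]] by (auto simp: compose_def fun_eq_iff)
    ultimately show ?thesis
      unfolding coboundaries.simps by (intro image_eqI[of _ _ "\<lambda>x\<in>carrier (?P k). \<zero>\<^bsub>M\<^esub>"]) (simp_all only:)
  qed
  then have "(\<lambda>x\<in>carrier (?P (Suc k)). \<zero>\<^bsub>M\<^esub>) \<oplus>\<^bsub>?H\<^esub> f' \<in>
      ?B +>\<^bsub>?H\<lparr>carrier := cocycles R ?P d M (Suc k)\<rparr>\<^esub> f'"
    unfolding a_r_coset_def' by auto
  moreover have "(\<lambda>x\<in>carrier (?P (Suc k)). \<zero>\<^bsub>M\<^esub>) \<oplus>\<^bsub>?H\<^esub> f' = f'"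
    using lin_closed[OF f] by (auto simp: Hom_module_def f'_def fun_eq_iff)
  ultimately have "f' \<in> ?B" using coset by simp
  then obtain h where h: "h \<in> linear_maps R (?P k) M" "f' = compose (carrier (?P (Suc k))) h (d k)"
    by (auto simp: Hom_module_def)
  have "f u = h (d k u)" if "u \<in> carrier (?P (Suc k))" for u
    using fun_cong[OF h(2), of u] that by (simp add: compose_def f'_def)
  then show ?thesis using h(1) by blast
qed

text \<open>\<open>Ext\<close> uses a chosen resolution, whereas Betti numbers need a minimal one.
  On the chosen resolution the cocycle f \<beta> equals h d. Applying f to the homotopy identity for
  \<beta> \<alpha> kills the term starting with \<open>d'\<close> and leaves f = (h \<alpha> - f s)
  \<open>d'\<close>.\<close>

lemma Ext_zero_imp_coboundary_any_resolution:
  fixes N :: "('a, 'n, 'y) module_scheme"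
  assumes N: "module R N" and M: "module R M" and zero: "zero_module (Ext R (Suc k) N M)"
    and Y: "free_resolution R N Y d' \<epsilon>'"
    and f: "f \<in> linear_maps R (free_module R (Y (Suc k))) M"
    and fd: "\<And>u. u \<in> carrier (free_module R (Y (Suc (Suc k)))) \<Longrightarrow> f (d' (Suc k) u) = \<zero>\<^bsub>M\<^esub>"
  shows "\<exists>h \<in> linear_maps R (free_module R (Y k)) M. \<forall>u\<in>carrier (free_module R (Y (Suc k))). f u = h (d' k u)"
proof -
  interpret N: module R N by fact
  interpret M: module R M by fact
  obtain X d where Xd: "some_free_resolution R N = (X, d)" by fastforce
  have "\<exists>\<epsilon>. free_resolution R N X d \<epsilon>"
  proof -
    obtain X' :: "nat \<Rightarrow> ('a, 'n) resolution_index set" and d0 e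
      where "free_resolution R N X' d0 e" using free_resolution_exists[OF N] by blast
    then have "case (X', d0) of (X, d) \<Rightarrow> \<exists>\<epsilon>. free_resolution R N X d \<epsilon>" by auto
    then have "case some_free_resolution R N of (X, d) \<Rightarrow> \<exists>\<epsilon>. free_resolution R N X d \<epsilon>"
      unfolding some_free_resolution_def by (rule someI)
    then show ?thesis by (simp add: Xd)
  qed
  then obtain \<epsilon> where X: "free_resolution R N X d \<epsilon>" by blast
  let ?P = "\<lambda>n. free_module R (X n)" and ?Q = "\<lambda>n. free_module R (Y n)"
  have P: "module R (?P n)" and Q: "module R (?Q n)" for n
    by (rule free_module_is_module[OF N.R.is_cring])+
  note Xr = free_resolutionD[OF X] and Yr = free_resolutionD[OF Y]
  obtain \<alpha> where \<alpha>: "\<And>n. \<alpha> n \<in> linear_maps R (?Q n) (?P n)"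
    "\<And>u. u \<in> carrier (?Q 0) \<Longrightarrow> \<epsilon> (\<alpha> 0 u) = \<epsilon>' u"
    "\<And>n u. u \<in> carrier (?Q (Suc n)) \<Longrightarrow> d n (\<alpha> (Suc n) u) = \<alpha> n (d' n u)"
    using free_resolution_comparison[OF N Y X] by blast
  obtain \<beta> where \<beta>: "\<And>n. \<beta> n \<in> linear_maps R (?P n) (?Q n)"
    "\<And>u. u \<in> carrier (?P 0) \<Longrightarrow> \<epsilon>' (\<beta> 0 u) = \<epsilon> u"
    "\<And>n u. u \<in> carrier (?P (Suc n)) \<Longrightarrow> d' n (\<beta> (Suc n) u) = \<beta> n (d n u)"
    using free_resolution_comparison[OF N X Y] by blast
  let ?\<theta> = "\<lambda>n u. \<beta> n (\<alpha> n u)"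
  have "\<exists>s. (\<forall>n. s n \<in> linear_maps R (?Q n) (?Q (Suc n))) \<and>
           (\<forall>n. \<forall>u\<in>carrier (?Q (Suc n)). d' (Suc n) (s (Suc n) u) =
              ?\<theta> (Suc n) u \<ominus>\<^bsub>?Q (Suc n)\<^esub> u \<ominus>\<^bsub>?Q (Suc n)\<^esub> s n (d' n u))"
    by (rule free_resolution_homotopy[OF N Y lin_comp[OF \<alpha>(1) \<beta>(1)]])
       (use \<alpha> \<beta> lin_closed[OF \<alpha>(1)] in auto)
  then obtain s where s: "\<And>n. s n \<in> linear_maps R (?Q n) (?Q (Suc n))"
    "\<And>n u. u \<in> carrier (?Q (Suc n)) \<Longrightarrow> d' (Suc n) (s (Suc n) u) =
              ?\<theta> (Suc n) u \<ominus>\<^bsub>?Q (Suc n)\<^esub> u \<ominus>\<^bsub>?Q (Suc n)\<^esub> s n (d' n u)" by blast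
  have "\<exists>h \<in> linear_maps R (?P k) M. \<forall>u\<in>carrier (?P (Suc k)). f (\<beta> (Suc k) u) = h (d k u)"
  proof (rule Ext_zero_imp_coboundary[OF N M zero Xd lin_comp[OF \<beta>(1) f] _ Xr(3)])
    fix u assume u: "u \<in> carrier (?P (Suc (Suc k)))"
    then show "f (\<beta> (Suc k) (d (Suc k) u)) = \<zero>\<^bsub>M\<^esub>"
      using \<beta>(3)[OF u] fd lin_closed[OF \<beta>(1) u] by metis
  qed
  then obtain h where h: "h \<in> linear_maps R (?P k) M"
    "\<And>u. u \<in> carrier (?P (Suc k)) \<Longrightarrow> f (\<beta> (Suc k) u) = h (d k u)" by blast
  let ?g = "\<lambda>v. h (\<alpha> k v) \<ominus>\<^bsub>M\<^esub> f (s k v)"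
  show ?thesis
  proof (intro bexI ballI)
    show "?g \<in> linear_maps R (?Q k) M"
      by (rule lin_diff[OF M lin_comp[OF \<alpha>(1) h(1)] lin_comp[OF s(1) f]])
    fix u assume u: "u \<in> carrier (?Q (Suc k))"
    interpret Qk: module R "?Q (Suc k)" by (rule Q)
    have du: "d' k u \<in> carrier (?Q k)" by (rule lin_closed[OF Yr(3) u])
    have c: "\<alpha> (Suc k) u \<in> carrier (?P (Suc k))" "?\<theta> (Suc k) u \<in> carrier (?Q (Suc k))"
      "s k (d' k u) \<in> carrier (?Q (Suc k))" "s (Suc k) u \<in> carrier (?Q (Suc (Suc k)))"
      using lin_closed[OF \<alpha>(1) u] lin_closed[OF \<beta>(1)] lin_closed[OF s(1) du] lin_closed[OF s(1) u] by auto
    have c': "?\<theta> (Suc k) u \<ominus>\<^bsub>?Q (Suc k)\<^esub> u \<in> carrier (?Q (Suc k))" using c u by simp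
    have "\<zero>\<^bsub>M\<^esub> = f (d' (Suc k) (s (Suc k) u))" using fd[OF c(4)] by simp
    also have "\<dots> = f (?\<theta> (Suc k) u) \<ominus>\<^bsub>M\<^esub> f u \<ominus>\<^bsub>M\<^esub> f (s k (d' k u))"
      unfolding s(2)[OF u] lin_minus[OF Q M f c' c(3)] lin_minus[OF Q M f c(2) u] ..
    also have "f (?\<theta> (Suc k) u) = h (\<alpha> k (d' k u))" using h(2)[OF c(1)] \<alpha>(3)[OF u] by simp
    finally have eq: "h (\<alpha> k (d' k u)) \<ominus>\<^bsub>M\<^esub> f u \<ominus>\<^bsub>M\<^esub> f (s k (d' k u)) = \<zero>\<^bsub>M\<^esub>" by simp
    have cM: "h (\<alpha> k (d' k u)) \<in> carrier M" "f u \<in> carrier M" "f (s k (d' k u)) \<in> carrier M"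
      using lin_closed[OF h(1) lin_closed[OF \<alpha>(1) du]] lin_closed[OF f u] lin_closed[OF f c(3)] .
    then have "h (\<alpha> k (d' k u)) \<ominus>\<^bsub>M\<^esub> f u = f (s k (d' k u))"
      using eq by (subst (asm) M.minus_eq_zero_iff) auto
    then show "f u = ?g (d' k u)"
      using cM by (metis M.add.inv_closed M.add.inv_solve_right M.add.m_comm M.minus_closed a_minus_def)
  qed
qed

section \<open>The minimal resolution of the injective hull\<close>

context cube_zero_injective_hull
begin

text \<open>Each kernel is covered minimally. The state of the dependent choice also records that
  the kernel of the current map lies in m times its source, since this is what puts the next
  differential into \<open>mF\<close>.\<close>

lemma minimal_resolution_exists:
  "\<exists>b d \<epsilon>. free_resolution R E (\<lambda>n. {..<b n}) d \<epsilon> \<and>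
     (\<forall>n. \<forall>u\<in>carrier (F (b (Suc n))). d n u \<in> mF (b n))"
proof -
  obtain b0 \<epsilon> where \<epsilon>: "\<epsilon> \<in> linear_maps R (F b0) E" "\<epsilon> ` carrier (F b0) = carrier E"
    "\<And>u. u \<in> carrier (F b0) \<Longrightarrow> \<epsilon> u = \<zero>\<^bsub>E\<^esub> \<Longrightarrow> u \<in> mF b0" using minimal_cover_E by blast
  have step: "\<exists>n' d. d \<in> linear_maps R (F n') (F n) \<and> d ` carrier (F n') = K \<and>
      (\<forall>u\<in>carrier (F n'). d u = \<zero>\<^bsub>F n\<^esub> \<longrightarrow> u \<in> mF n')"
    if K: "submodule K R (F n)" for n K
  proof (rule minimal_cover_submodule[OF F_module K])
    have "K \<subseteq> carrier (F n)" using module.submodule_sub[OF F_module K] by blast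
    then have "interval_length R (F n) {\<zero>\<^bsub>F n\<^esub>} K \<le> interval_length R (F n) {\<zero>\<^bsub>F n\<^esub>} (carrier (F n))"
      by (intro interval_length_mono) auto
    then show "interval_length R (F n) {\<zero>\<^bsub>F n\<^esub>} K \<noteq> \<infinity>"
      unfolding length_F using enat_ile by fastforce
  qed
  let ?good = "\<lambda>(n, n', d). d \<in> linear_maps R (F n') (F n) \<and> d ` carrier (F n') \<subseteq> mF n \<and>
      (\<forall>u\<in>carrier (F n'). d u = \<zero>\<^bsub>F n\<^esub> \<longrightarrow> u \<in> mF n')"
  let ?next = "\<lambda>(n, n', d) (k, k', d'). k = n' \<and> d' ` carrier (F k') = a_kernel (F n') (F n) d"
  let ?start = "\<lambda>(n, n', d). n = b0 \<and> d ` carrier (F n') = a_kernel (F b0) E \<epsilon>"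
  have "\<exists>s. \<forall>n. (?good (s n) \<and> (n = 0 \<longrightarrow> ?start (s n))) \<and> ?next (s n) (s (Suc n))"
  proof (rule dependent_nat_choice)
    obtain n' d where d: "d \<in> linear_maps R (F n') (F b0)" "d ` carrier (F n') = a_kernel (F b0) E \<epsilon>"
      "\<forall>u\<in>carrier (F n'). d u = \<zero>\<^bsub>F b0\<^esub> \<longrightarrow> u \<in> mF n'"
      using step[OF submodule_kernel[OF F_module E.module_axioms \<epsilon>(1)]] by blast
    moreover have "d ` carrier (F n') \<subseteq> mF b0" unfolding d(2) using \<epsilon>(3) by (auto simp: a_kernel_iff)
    ultimately show "\<exists>s. ?good s \<and> (0 = (0 :: nat) \<longrightarrow> ?start s)"
      by (intro exI[of _ "(b0, n', d)"]) simp
  next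
    fix s and n :: nat
    assume good: "?good s \<and> (n = 0 \<longrightarrow> ?start s)"
    obtain k k' d where s: "s = (k, k', d)" by (cases s)
    with good have d: "d \<in> linear_maps R (F k') (F k)" "\<forall>u\<in>carrier (F k'). d u = \<zero>\<^bsub>F k\<^esub> \<longrightarrow> u \<in> mF k'"
      by simp_all
    obtain l d' where d': "d' \<in> linear_maps R (F l) (F k')" "d' ` carrier (F l) = a_kernel (F k') (F k) d"
      "\<forall>u\<in>carrier (F l). d' u = \<zero>\<^bsub>F k'\<^esub> \<longrightarrow> u \<in> mF l"
      using step[OF submodule_kernel[OF F_module F_module d(1)]] by blast
    moreover have "d' ` carrier (F l) \<subseteq> mF k'" unfolding d'(2) using d(2) by (auto simp: a_kernel_iff)
    ultimately show "\<exists>t. (?good t \<and> (Suc n = 0 \<longrightarrow> ?start t)) \<and> ?next s t"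
      by (intro exI[of _ "(k', l, d')"]) (simp add: s)
  qed
  then obtain s
    where s: "\<And>n. (?good (s n) \<and> (n = 0 \<longrightarrow> ?start (s n))) \<and> ?next (s n) (s (Suc n))"
    by (elim exE) (rule that, erule spec)
  have good: "?good (s n)" for n using s[of n] by (elim conjE)
  have next': "?next (s n) (s (Suc n))" for n using s[of n] by (elim conjE)
  have start: "?start (s 0)" by (rule mp[OF conjunct2[OF conjunct1[OF s[of 0]]] refl])
  define b where "b n = fst (s n)" for n
  define d where "d n = snd (snd (s n))" for n
  have "fst (snd (s n)) = b (Suc n)" for n
    using next'[of n] by (simp add: b_def split: prod.splits)
  then have s_eq: "s n = (b n, b (Suc n), d n)" for n
    by (simp add: b_def d_def prod_eq_iff)
  have b0: "b 0 = b0" using start by (simp add: s_eq)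
  have "free_resolution R E (\<lambda>n. {..<b n}) d \<epsilon>"
    unfolding free_resolution_def Let_def
    using \<epsilon> start good next' by (simp add: s_eq b0)
  moreover have "d n u \<in> mF (b n)" if "u \<in> carrier (F (b (Suc n)))" for n u
    using good[of n] that by (auto simp: s_eq)
  ultimately show ?thesis by blast
qed

end

locale minimal_hull_resolution = cube_zero_injective_hull R \<mm> E for R (structure) and \<mm> and E :: "('a, 'e) module" +
  fixes b :: "nat \<Rightarrow> nat" and d :: "nat \<Rightarrow> (nat \<Rightarrow> 'a) \<Rightarrow> (nat \<Rightarrow> 'a)" and \<epsilon> :: "(nat \<Rightarrow> 'a) \<Rightarrow> 'e"
  assumes resolution: "free_resolution R E (\<lambda>n. {..<b n}) d \<epsilon>"
    and minimal: "u \<in> carrier (F (b (Suc n))) \<Longrightarrow> d n u \<in> mF (b n)"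
begin

lemmas resolutionD = free_resolutionD[OF resolution]

lemma lin_d: "d n \<in> linear_maps R (F (b (Suc n))) (F (b n))"
  by (rule resolutionD(3))

text \<open>Indices are shifted: \<open>Z n \<subseteq> F (b n)\<close> is the \<open>(n + 1)\<close>-st syzygy.\<close>

definition Z :: "nat \<Rightarrow> (nat \<Rightarrow> 'a) set" where "Z n = d n ` carrier (F (b (Suc n)))"
definition mZ :: "nat \<Rightarrow> (nat \<Rightarrow> 'a) set" where "mZ n = ideal_mult R \<mm> (F (b n)) (Z n)"
definition z :: "nat \<Rightarrow> nat" where "z n = the_enat (interval_length R (F (b n)) {\<zero>\<^bsub>F (b n)\<^esub>} (Z n))"
definition c :: "nat \<Rightarrow> nat" where "c n = the_enat (interval_length R (F (b n)) {\<zero>\<^bsub>F (b n)\<^esub>} (mZ n))"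

lemma Z_0: "u \<in> Z 0 \<longleftrightarrow> u \<in> carrier (F (b 0)) \<and> \<epsilon> u = \<zero>\<^bsub>E\<^esub>"
  unfolding Z_def resolutionD(4) by simp

lemma Z_Suc: "u \<in> Z (Suc n) \<longleftrightarrow> u \<in> carrier (F (b (Suc n))) \<and> d n u = \<zero>\<^bsub>F (b n)\<^esub>"
  unfolding Z_def resolutionD(4) by simp

lemma submodule_Z: "submodule (Z n) R (F (b n))"
  unfolding Z_def by (rule submodule_image[OF F_module F_module lin_d module.carrier_is_submodule[OF F_module]])

lemma Z_subset_mF: "Z n \<subseteq> mF (b n)"
  unfolding Z_def using minimal by blast

lemma mF_subset_F: "mF n \<subseteq> carrier (F n)"
  by (auto simp: mF_iff)

lemma Z_subset_F: "Z n \<subseteq> carrier (F (b n))"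
  using Z_subset_mF mF_subset_F by blast

lemma submodule_mZ: "submodule (mZ n) R (F (b n))"
  unfolding mZ_def by (rule module.submodule_ideal_mult[OF F_module m_subset Z_subset_F])

lemma mZ_subset_Z: "mZ n \<subseteq> Z n"
  unfolding mZ_def by (rule module.ideal_mult_subset[OF F_module m_subset submodule_Z])

lemma mZ_subset_m2F: "mZ n \<subseteq> m2F (b n)"
  unfolding mZ_def m2F_eq[symmetric]
  by (rule module.ideal_mult_mono[OF F_module m_subset mF_subset_F Z_subset_mF])

lemma mZ_eq: "mZ n = d n ` mF (b (Suc n))"
  unfolding mZ_def Z_def
proof (rule minimal_cover_length(3)[OF F_module lin_d])
  fix u assume u: "u \<in> carrier (F (b (Suc n)))" "d n u = \<zero>\<^bsub>F (b n)\<^esub>"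
  then have "u \<in> Z (Suc n)" by (simp add: Z_Suc)
  then show "u \<in> mF (b (Suc n))" using Z_subset_mF by blast
qed

lemma length_Z_mod_mZ: "interval_length R (F (b n)) (mZ n) (Z n) = enat (b (Suc n))"
  unfolding mZ_def Z_def
proof (rule minimal_cover_length(1)[OF F_module lin_d])
  fix u assume u: "u \<in> carrier (F (b (Suc n)))" "d n u = \<zero>\<^bsub>F (b n)\<^esub>"
  then have "u \<in> Z (Suc n)" by (simp add: Z_Suc)
  then show "u \<in> mF (b (Suc n))" using Z_subset_mF by blast
qed

lemma length_finite: "A \<subseteq> carrier (F n) \<Longrightarrow> interval_length R (F n) {\<zero>\<^bsub>F n\<^esub>} A \<noteq> \<infinity>"
  using interval_length_mono[of "{\<zero>\<^bsub>F n\<^esub>}" "{\<zero>\<^bsub>F n\<^esub>}" A "carrier (F n)" R "F n"]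
  unfolding length_F using enat_ile by fastforce

lemma length_Z: "interval_length R (F (b n)) {\<zero>\<^bsub>F (b n)\<^esub>} (Z n) = enat (z n)"
  unfolding z_def using length_finite[OF Z_subset_F, of n]
  by (cases "interval_length R (F (b n)) {\<zero>\<^bsub>F (b n)\<^esub>} (Z n)") simp_all

lemma length_mZ: "interval_length R (F (b n)) {\<zero>\<^bsub>F (b n)\<^esub>} (mZ n) = enat (c n)"
  unfolding c_def using length_finite[OF order_trans[OF mZ_subset_Z Z_subset_F], of n]
  by (cases "interval_length R (F (b n)) {\<zero>\<^bsub>F (b n)\<^esub>} (mZ n)") simp_all

lemma zero_subset: "submodule A R (F n) \<Longrightarrow> {\<zero>\<^bsub>F n\<^esub>} \<subseteq> A"
  using module.submodule_zero_mem[OF F_module] by blast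

lemma z_eq: "z n = b (Suc n) + c n"
  using module.interval_length_add[OF F_module module.submodule_zero[OF F_module] submodule_mZ
      submodule_Z zero_subset[OF submodule_mZ] mZ_subset_Z, of n]
  unfolding length_Z length_mZ length_Z_mod_mZ by simp

text \<open>Rank and nullity of \<open>d n\<close>, whose kernel is the next syzygy and whose image
  is the current one.\<close>

lemma z_Suc: "z (Suc n) + z n = b (Suc n) * (1 + embdim + sqdim)"
proof -
  have eq: "{u \<in> carrier (F (b (Suc n))). d n u = \<zero>\<^bsub>F (b n)\<^esub>} = Z (Suc n)" using Z_Suc by blast
  show ?thesis
    using interval_length_rank_nullity[OF F_module F_module lin_d module.carrier_is_submodule[OF F_module], of n]
    unfolding eq length_F Z_def[symmetric] length_Z by simp
qed

text \<open>The second summand is length E, which equals length R; this fixes the start of the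
  recursion.\<close>

lemma z_0: "z 0 + (1 + embdim + sqdim) = b 0 * (1 + embdim + sqdim)"
proof -
  have eq: "{u \<in> carrier (F (b 0)). \<epsilon> u = \<zero>\<^bsub>E\<^esub>} = Z 0" using Z_0 by blast
  show ?thesis
    using interval_length_rank_nullity[OF F_module E.module_axioms resolutionD(1)
        module.carrier_is_submodule[OF F_module]]
    unfolding eq length_F resolutionD(2) length_Z length_E by simp
qed

lemma c_le: "c n \<le> b n * sqdim"
proof -
  have "enat (c n) \<le> enat (b n * sqdim)"
    unfolding length_mZ[symmetric] length_m2F[symmetric]
    by (rule interval_length_mono) (use mZ_subset_m2F in auto)
  then show ?thesis by simp
qed

lemma mZ_eq_m2F_if: "c n = b n * sqdim \<Longrightarrow> mZ n = m2F (b n)"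
  by (rule module.interval_length_eq_imp_eq[OF F_module module.submodule_zero[OF F_module]
        submodule_mZ submodule_m2F zero_subset[OF submodule_mZ] mZ_subset_m2F])
     (simp_all add: length_mZ length_m2F)

lemma m_m2F: "ideal_mult R \<mm> (F n) (m2F n) = {\<zero>\<^bsub>F n\<^esub>}"
proof -
  have "ideal_mult R \<mm> (F n) (m2F n) \<subseteq> {\<zero>\<^bsub>F n\<^esub>}"
    by (rule module.ideal_mult_least[OF F_module module.submodule_zero[OF F_module]])
       (auto simp: power_submodule_def free_module_eq m_msq)
  moreover have "submodule (ideal_mult R \<mm> (F n) (m2F n)) R (F n)"
    by (rule module.submodule_ideal_mult[OF F_module m_subset])
       (auto simp: power_submodule_def free_module_eq)
  ultimately show ?thesis using zero_subset by blast
qed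

text \<open>By minimality \<open>d n\<close> maps m^2 times its source into m^3 times its target,
  which is zero.\<close>

lemma m2F_subset_Z: "m2F (b (Suc n)) \<subseteq> Z (Suc n)"
proof
  fix v assume v: "v \<in> m2F (b (Suc n))"
  have "d n ` m2F (b (Suc n)) = ideal_mult R \<mm> (F (b n)) (mZ n)"
    unfolding m2F_eq[symmetric] mZ_eq by (rule ideal_mult_image[OF F_module F_module lin_d m_subset mF_subset_F])
  also have "\<dots> \<subseteq> ideal_mult R \<mm> (F (b n)) (m2F (b n))"
    by (rule module.ideal_mult_mono[OF F_module m_subset _ mZ_subset_m2F])
       (auto simp: power_submodule_def free_module_eq)
  finally have "d n v = \<zero>\<^bsub>F (b n)\<^esub>" using v unfolding m_m2F by blast
  then show "v \<in> Z (Suc n)" using v by (simp add: Z_Suc power_submodule_def free_module_eq)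
qed

text \<open>An element v = d y of m^2 F outside m Z would be a minimal generator of the syzygy
  killed by m. The hypothesis excludes this in terms of the lift y, which lives one degree
  higher.\<close>

lemma c_eq_if_no_socle_generator:
  assumes "\<And>y. y \<in> carrier (F (b (Suc (Suc n)))) \<Longrightarrow>
      (\<And>a. a \<in> \<mm> \<Longrightarrow> a \<odot>\<^bsub>F (b (Suc (Suc n)))\<^esub> y \<in> Z (Suc (Suc n))) \<Longrightarrow> y \<in> mF (b (Suc (Suc n)))"
  shows "c (Suc n) = b (Suc n) * sqdim"
proof -
  interpret F1: module R "F (b (Suc n))" by (rule F_module)
  interpret F2: module R "F (b (Suc (Suc n)))" by (rule F_module)
  have "m2F (b (Suc n)) \<subseteq> mZ (Suc n)"
  proof
    fix v assume v: "v \<in> m2F (b (Suc n))"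
    then obtain y where y: "y \<in> carrier (F (b (Suc (Suc n))))" "v = d (Suc n) y"
      using m2F_subset_Z by (auto simp: Z_def)
    have "y \<in> mF (b (Suc (Suc n)))"
    proof (rule assms[OF y(1)])
      fix a assume a: "a \<in> \<mm>"
      then have "a \<odot>\<^bsub>F (b (Suc n))\<^esub> v \<in> ideal_mult R \<mm> (F (b (Suc n))) (m2F (b (Suc n)))"
        by (rule F1.ideal_mult_mem) (rule v)
      then have "d (Suc n) (a \<odot>\<^bsub>F (b (Suc (Suc n)))\<^esub> y) = \<zero>\<^bsub>F (b (Suc n))\<^esub>"
        unfolding m_m2F using lin_smult[OF lin_d m_carrier[OF a] y(1)] y(2) by simp
      then show "a \<odot>\<^bsub>F (b (Suc (Suc n)))\<^esub> y \<in> Z (Suc (Suc n))"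
        using y(1) m_carrier[OF a] by (simp add: Z_Suc)
    qed
    then show "v \<in> mZ (Suc n)" unfolding mZ_eq y(2) by blast
  qed
  then have "mZ (Suc n) = m2F (b (Suc n))" using mZ_subset_m2F by blast
  then show ?thesis using length_mZ[of "Suc n"] length_m2F[of "b (Suc n)"] by simp
qed

lemma F_0_carrier: "carrier (F 0) = {\<zero>\<^bsub>F 0\<^esub>}"
proof -
  have "{..<0} = ({} :: nat set)" by simp
  then show ?thesis by (auto simp: free_module_eq direct_power_carrier_finite)
qed

lemma Z_trivial_if: "b (Suc n) = 0 \<Longrightarrow> Z n = {\<zero>\<^bsub>F (b n)\<^esub>}"
  unfolding Z_def using lin_zero[OF F_module F_module lin_d, of n] F_0_carrier by simp

text \<open>Let x be a nonzero socle element of R. Since \<open>d n\<close> maps a basis vector e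
  into \<open>mF\<close>, it kills x e, so the next syzygy is nonzero.\<close>

lemma betti_pos_Suc:
  assumes "b (Suc n) > 0" shows "b (Suc (Suc n)) > 0"
proof (rule ccontr)
  assume "\<not> ?thesis"
  then have Z: "Z (Suc n) = {\<zero>\<^bsub>F (b (Suc n))\<^esub>}" using Z_trivial_if by simp
  have "{\<zero>\<^bsub>Reg\<^esub>} \<subset> carrier Reg" using one_notin_m m.zero_closed one_closed zero_closed
    unfolding regular_module_simps by (metis empty_iff insertE insert_subset empty_subsetI psubsetI)
  from exists_relative_socle_element[OF Reg.module_axioms Reg.submodule_zero Reg.carrier_is_submodule this]
  obtain x where x: "x \<in> carrier R" "x \<noteq> \<zero>" "\<And>a. a \<in> \<mm> \<Longrightarrow> a \<otimes> x = \<zero>" by auto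
  let ?e = "single Reg (0::nat) \<one>"
  have e: "?e \<in> carrier (F (b (Suc n)))" using assms by (auto simp: F_carrier single_def)
  have "d n ?e \<in> mF (b n)" by (rule minimal[OF e])
  then have "x \<odot>\<^bsub>F (b n)\<^esub> d n ?e = \<zero>\<^bsub>F (b n)\<^esub>"
    using x m_carrier by (auto simp: mF_iff free_module_eq m_comm[OF x(1)])
  then have "d n (x \<odot>\<^bsub>F (b (Suc n))\<^esub> ?e) = \<zero>\<^bsub>F (b n)\<^esub>" using lin_smult[OF lin_d x(1) e] by simp
  then have "x \<odot>\<^bsub>F (b (Suc n))\<^esub> ?e \<in> Z (Suc n)"
    using module.smult_closed[OF F_module x(1) e] by (simp add: Z_Suc)
  then have "x \<odot>\<^bsub>F (b (Suc n))\<^esub> ?e = \<zero>\<^bsub>F (b (Suc n))\<^esub>" unfolding Z by simp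
  then have "x \<otimes> \<one> = \<zero>" by (auto simp: free_module_eq dest: fun_cong[of _ _ 0])
  then show False using x by simp
qed

lemma gorenstein_if_b0_le_1: "b 0 \<le> 1 \<Longrightarrow> gorenstein R \<mm>"
  using cyclic_image[OF E.module_axioms resolutionD(1)] gorenstein_if_cyclic
  unfolding resolutionD(2) by blast

text \<open>With vanishing first syzygy E is free of rank \<open>b 0\<close>, and length E = length
  R makes this rank one.\<close>

lemma gorenstein_if_b1_0:
  assumes "b (Suc 0) = 0" shows "gorenstein R \<mm>"
proof -
  have "z 0 = 0" using length_Z[of 0] unfolding Z_trivial_if[OF assms]
    by (simp add: module.interval_length_self[OF F_module] zero_enat_def)
  then have "b 0 * (1 + embdim + sqdim) = 1 * (1 + embdim + sqdim)"
    using z_0 by (simp only: add_0 mult_1)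
  then have "b 0 = 1" unfolding mult_cancel2 by linarith
  then show ?thesis using gorenstein_if_b0_le_1 by simp
qed

end

section \<open>Vanishing of Ext and the growth of Betti numbers\<close>

text \<open>The pairing that identifies a tuple t in M^n with the linear map from R^n to M taking
  the j-th basis vector to \<open>t j\<close>.\<close>

definition dot :: "('a, 'm, 'z) module_scheme \<Rightarrow> nat \<Rightarrow> (nat \<Rightarrow> 'm) \<Rightarrow> (nat \<Rightarrow> 'a) \<Rightarrow> 'm" where
  "dot M n t u = (\<Oplus>\<^bsub>M\<^esub>j\<in>{..<n}. u j \<odot>\<^bsub>M\<^esub> t j)"

context module
begin

lemma dot_single:
  assumes t: "t \<in> carrier (direct_power M {..<n})" and l: "l < n"
  shows "dot M n t (single (regular_module R) l \<one>) = t l"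
proof -
  have tM: "t j \<in> carrier M" for j using t by (simp add: direct_power_carrier)
  have "dot M n t (single (regular_module R) l \<one>) = (\<Oplus>\<^bsub>M\<^esub>j\<in>{..<n}. if l = j then t j else \<zero>\<^bsub>M\<^esub>)"
    unfolding dot_def by (rule M.finsum_cong') (auto simp: single_def tM)
  also have "\<dots> = t l"
    by (rule M.finsum_singleton) (use l tM in auto)
  finally show ?thesis .
qed

lemma lin_dot_right:
  assumes t: "t \<in> carrier (direct_power M {..<n})"
  shows "dot M n t \<in> linear_maps R (free_module R {..<n}) M"
proof -
  have tM: "t j \<in> carrier M" for j using t by (simp add: direct_power_carrier)
  show ?thesis
  proof (rule linear_mapsI)
    show "dot M n t u \<in> carrier M" if "u \<in> carrier (free_module R {..<n})" for u
      unfolding dot_def by (rule M.finsum_closed) (use that tM in \<open>auto simp: free_module_def\<close>)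
    show "dot M n t (u \<oplus>\<^bsub>free_module R {..<n}\<^esub> v) = dot M n t u \<oplus>\<^bsub>M\<^esub> dot M n t v"
      if "u \<in> carrier (free_module R {..<n})" "v \<in> carrier (free_module R {..<n})" for u v
      unfolding dot_def using that tM
      by (subst M.finsum_addf[symmetric]) (auto simp: free_module_def smult_l_distr intro!: M.finsum_cong')
    show "dot M n t (a \<odot>\<^bsub>free_module R {..<n}\<^esub> u) = a \<odot>\<^bsub>M\<^esub> dot M n t u"
      if "a \<in> carrier R" "u \<in> carrier (free_module R {..<n})" for a u
      unfolding dot_def using that tM
      by (subst finsum_smult_ldistr) (auto simp: free_module_def smult_assoc1 intro!: M.finsum_cong')
  qed
qed

lemma lin_dot_left:
  assumes u: "u \<in> carrier (free_module R {..<n})"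
  shows "(\<lambda>t. dot M n t u) \<in> linear_maps R (direct_power M {..<n}) M"
proof -
  have uR: "u j \<in> carrier R" for j using u by (simp add: free_module_def)
  show ?thesis
  proof (rule linear_mapsI)
    show "dot M n t u \<in> carrier M" if "t \<in> carrier (direct_power M {..<n})" for t
      unfolding dot_def by (rule M.finsum_closed) (use that uR in \<open>auto simp: direct_power_carrier\<close>)
    show "dot M n (s \<oplus>\<^bsub>direct_power M {..<n}\<^esub> t) u = dot M n s u \<oplus>\<^bsub>M\<^esub> dot M n t u"
      if "s \<in> carrier (direct_power M {..<n})" "t \<in> carrier (direct_power M {..<n})" for s t
      unfolding dot_def using that uR
      by (subst M.finsum_addf[symmetric]) (auto simp: direct_power_carrier smult_r_distr intro!: M.finsum_cong')
    have comm: "b \<odot>\<^bsub>M\<^esub> (a \<odot>\<^bsub>M\<^esub> x) = a \<odot>\<^bsub>M\<^esub> (b \<odot>\<^bsub>M\<^esub> x)"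
      if "a \<in> carrier R" "b \<in> carrier R" "x \<in> carrier M" for a b x
      using that by (simp add: smult_assoc1[symmetric] m_comm)
    show "dot M n (a \<odot>\<^bsub>direct_power M {..<n}\<^esub> t) u = a \<odot>\<^bsub>M\<^esub> dot M n t u"
      if "a \<in> carrier R" "t \<in> carrier (direct_power M {..<n})" for a t
      unfolding dot_def using that uR
      by (subst finsum_smult_ldistr) (auto simp: direct_power_carrier comm intro!: M.finsum_cong')
  qed
qed

lemma dot_zero:
  assumes "\<And>j. u j \<odot>\<^bsub>M\<^esub> t j = \<zero>\<^bsub>M\<^esub>"
  shows "dot M n t u = \<zero>\<^bsub>M\<^esub>"
  unfolding dot_def assms by simp

lemma lin_eq_dot:
  assumes h: "h \<in> linear_maps R (free_module R {..<n}) M"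
  shows "\<exists>t\<in>carrier (direct_power M {..<n}). \<forall>u\<in>carrier (free_module R {..<n}). h u = dot M n t u"
proof -
  let ?e = "\<lambda>j. single (regular_module R) j \<one>"
  define t where "t j = (if j < n then h (?e j) else \<zero>\<^bsub>M\<^esub>)" for j
  have e: "?e j \<in> carrier (free_module R {..<n})" if "j < n" for j
    using that by (auto simp: free_module_def single_def)
  have t: "t \<in> carrier (direct_power M {..<n})"
    using lin_closed[OF h e] by (auto simp: direct_power_carrier_finite t_def)
  have "h u = dot M n t u" if "u \<in> carrier (free_module R {..<n})" for u
    by (rule free_module_lin_eq[OF R.is_cring module_axioms h lin_dot_right[OF t] _ that])
       (simp add: dot_single[OF t], simp add: t_def)
  then show ?thesis using t by blast
qed

end

section \<open>The module M: its numerical invariants and extension of maps from m\<close>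

locale square_zero_module = cube_zero_local_ring R \<mm> for R (structure) and \<mm> +
  fixes M :: "('a, 'm) module"
  assumes M_module: "module R M"
    and M_fg: "finitely_generated R M"
    and M_nonzero: "\<not> zero_module M"
    and M_square_zero: "ideal_smult R (\<mm> [^]\<^bsub>ideals_set R\<^esub> (2::nat)) M = {\<zero>\<^bsub>M\<^esub>}"
    and M_generators: "enat (min_generators R M) \<le> module_length R (M\<lparr>carrier := ideal_smult R \<mm> M\<rparr>)"
begin

sublocale M: module R M by (rule M_module)

definition mM where "mM = ideal_mult R \<mm> M (carrier M)"
definition r :: nat where "r = min_generators R M"
text \<open>The larger side of the hypothesis on generators as a natural number;
  \<open>length_mM\<close> shows that it is finite.\<close>

definition s :: nat where "s = the_enat (interval_length R M {\<zero>\<^bsub>M\<^esub>} mM)"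

lemma submodule_mM: "submodule mM R M"
  unfolding mM_def by (rule M.submodule_ideal_mult[OF m_subset order_refl])

lemma smult_m_m: 
  assumes "a \<in> \<mm>" "b \<in> \<mm>" "x \<in> carrier M"
  shows "a \<odot>\<^bsub>M\<^esub> (b \<odot>\<^bsub>M\<^esub> x) = \<zero>\<^bsub>M\<^esub>"
proof -
  have "(a \<otimes> b) \<odot>\<^bsub>M\<^esub> x \<in> ideal_smult R (\<mm> [^]\<^bsub>ideals_set R\<^esub> (2::nat)) M"
    unfolding ideal_smult_eq by (rule M.ideal_mult_mem[OF m_mult_mem_sq[OF assms(1,2)] assms(3)])
  then show ?thesis using M_square_zero assms m_carrier by (simp add: M.smult_assoc1)
qed

lemma mM_subset_socle: "mM \<subseteq> socle M"
  unfolding mM_def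
  by (rule M.ideal_mult_least[OF submodule_socle[OF M_module]])
     (use m_carrier smult_m_m in \<open>auto simp: socle_def\<close>)

lemma minimal_cover_M:
  "\<exists>p. p \<in> linear_maps R (F r) M \<and> p ` carrier (F r) = carrier M \<and>
     (\<forall>u\<in>carrier (F r). p u = \<zero>\<^bsub>M\<^esub> \<longrightarrow> u \<in> mF r)"
  using minimal_cover[OF M_module M_fg, folded r_def] by blast

lemma length_M_mod_mM: "interval_length R M mM (carrier M) = enat r"
proof -
  obtain p where p: "p \<in> linear_maps R (F r) M" "p ` carrier (F r) = carrier M"
    "\<And>u. u \<in> carrier (F r) \<Longrightarrow> p u = \<zero>\<^bsub>M\<^esub> \<Longrightarrow> u \<in> mF r" using minimal_cover_M by blast
  show ?thesis using minimal_cover_length(1)[OF M_module p(1,3)] unfolding p(2) mM_def .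
qed

lemma length_M_finite: "interval_length R M {\<zero>\<^bsub>M\<^esub>} (carrier M) \<noteq> \<infinity>"
proof -
  obtain p where p: "p \<in> linear_maps R (F r) M" "p ` carrier (F r) = carrier M" using minimal_cover_M by blast
  show ?thesis
    using interval_length_rank_nullity[OF F_module M_module p(1) module.carrier_is_submodule[OF F_module]]
    unfolding p(2) length_F by (cases "interval_length R M {\<zero>\<^bsub>M\<^esub>} (carrier M)") auto
qed

lemma length_submodule_finite:
  assumes "A \<subseteq> carrier M" shows "interval_length R M {\<zero>\<^bsub>M\<^esub>} A \<noteq> \<infinity>"
proof -
  have "interval_length R M {\<zero>\<^bsub>M\<^esub>} A \<le> interval_length R M {\<zero>\<^bsub>M\<^esub>} (carrier M)"
    by (rule interval_length_mono) (use assms in auto)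
  then show ?thesis using length_M_finite by (metis enat_ord_simps(5))
qed

lemma mM_subset: "mM \<subseteq> carrier M"
  using M.submodule_sub[OF submodule_mM] by blast

lemma length_mM: "interval_length R M {\<zero>\<^bsub>M\<^esub>} mM = enat s"
  unfolding s_def using length_submodule_finite[OF mM_subset]
  by (cases "interval_length R M {\<zero>\<^bsub>M\<^esub>} mM") simp_all

lemma r_le_s: "r \<le> s"
  using M_generators
  unfolding ideal_smult_eq mM_def[symmetric] M.module_length_submodule[OF submodule_mM] length_mM
  by (simp add: r_def)

text \<open>If s = 0 then r = 0 as well, so M = m M = 0. Positivity is what permits cancelling s
  later.\<close>

lemma s_pos: "s > 0"
proof (rule ccontr)
  assume "\<not> ?thesis"
  then have "s = 0" "r = 0" using r_le_s by auto
  then have "mM = carrier M"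
    using M.interval_length_eq_0_iff[OF submodule_mM M.carrier_is_submodule mM_subset] length_M_mod_mM
    by (simp add: zero_enat_def)
  moreover have "{\<zero>\<^bsub>M\<^esub>} = mM"
    using M.interval_length_eq_0_iff[OF M.submodule_zero submodule_mM] length_mM \<open>s = 0\<close>
      M.submodule_zero_mem[OF submodule_mM] by (simp add: zero_enat_def)
  ultimately show False using M_nonzero by (simp add: zero_module_def)
qed

text \<open>The socle of \<open>M\<close> has length at least \<open>s \<ge> r\<close>, while injectivity of \<open>M\<close> along
  \<open>\<mm> \<subseteq> R\<close> makes \<open>M / soc M\<close> at least \<open>embdim\<close> times as long as the socle.\<close>

lemma embdim_le_1_if_extends:
  assumes ext: "\<And>f. f \<in> linear_maps R (Reg\<lparr>carrier := \<mm>\<rparr>) M \<Longrightarrow>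
      \<exists>v\<in>carrier M. \<forall>a\<in>\<mm>. f a = a \<odot>\<^bsub>M\<^esub> v"
  shows "embdim \<le> 1"
proof -
  let ?n = embdim
  obtain p where p: "p \<in> linear_maps R (F ?n) Reg" "p ` carrier (F ?n) = \<mm>"
    "\<And>u. u \<in> carrier (F ?n) \<Longrightarrow> p u = \<zero> \<Longrightarrow> u \<in> mF ?n"
    using minimal_cover_m by blast
  let ?S = "socle M"
  let ?P = "direct_power M {..<?n}" and ?PS = "power_submodule M {..<?n} ?S"
  let ?e = "\<lambda>i. single Reg i \<one>"
  have S: "submodule ?S R M" by (rule submodule_socle[OF M_module])
  have P: "module R ?P" by (rule M.direct_power_is_module)
  have e: "?e i \<in> carrier (F ?n)" if "i < ?n" for i using that by (auto simp: F_carrier single_def)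
  \<comment> \<open>\<Phi> multiplies v by each member of a minimal generating set of m, that is, it
    restricts the map a \<mapsto> a v from R to m.\<close>
  define \<Phi> where "\<Phi> v = (\<lambda>i. if i < ?n then p (?e i) \<odot>\<^bsub>M\<^esub> v else \<zero>\<^bsub>M\<^esub>)" for v
  have pe: "p (?e i) \<in> carrier R" "p (?e i) \<in> \<mm>" if "i < ?n" for i
    using p(2) e[OF that] m_carrier by blast+
  have \<Phi>: "\<Phi> \<in> linear_maps R M ?P"
    by (rule linear_mapsI)
       (auto simp: \<Phi>_def direct_power_carrier_finite fun_eq_iff M.smult_r_distr pe
          M.smult_assoc1[symmetric] m_comm)
  have "?PS \<subseteq> \<Phi> ` carrier M"
  proof
    fix t assume t: "t \<in> ?PS"
    then have tP: "t \<in> carrier ?P" and tS: "\<And>i. t i \<in> ?S" by (auto simp: power_submodule_def)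
    have "\<exists>f \<in> linear_maps R (Reg\<lparr>carrier := p ` carrier (F ?n)\<rparr>) M. \<forall>u\<in>carrier (F ?n). f (p u) = dot M ?n t u"
    \<comment> \<open>Any tuple of socle elements prescribes a map on m: relations among minimal
      generators have coefficients in m, and these kill the socle. Its extension to R exhibits the
      tuple as a value of \<Phi>.\<close>
    proof (rule lin_factor[OF F_module Reg.module_axioms M_module p(1) M.lin_dot_right[OF tP]])
      fix u assume "u \<in> carrier (F ?n)" "p u = \<zero>\<^bsub>Reg\<^esub>"
      then have "u j \<in> \<mm>" for j using p(3) by (simp add: mF_iff)
      then show "dot M ?n t u = \<zero>\<^bsub>M\<^esub>" by (intro M.dot_zero) (use tS in \<open>auto simp: socle_def\<close>)
    qed
    then obtain f where f: "f \<in> linear_maps R (Reg\<lparr>carrier := \<mm>\<rparr>) M"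
      "\<And>u. u \<in> carrier (F ?n) \<Longrightarrow> f (p u) = dot M ?n t u" unfolding p(2) by blast
    obtain v where v: "v \<in> carrier M" "\<And>a. a \<in> \<mm> \<Longrightarrow> f a = a \<odot>\<^bsub>M\<^esub> v" using ext[OF f(1)] by blast
    have "t = \<Phi> v"
    proof
      fix i show "t i = \<Phi> v i"
      proof (cases "i < ?n")
        case True
        then show ?thesis
          using f(2)[OF e] M.dot_single[OF tP] v(2) pe by (simp add: \<Phi>_def)
      next
        case False
        then show ?thesis using tP by (simp add: \<Phi>_def direct_power_carrier_finite)
      qed
    qed
    then show "t \<in> \<Phi> ` carrier M" using v(1) by blast
  qed
  then have "interval_length R M {v \<in> carrier M. \<Phi> v \<in> {\<zero>\<^bsub>?P\<^esub>}} {v \<in> carrier M. \<Phi> v \<in> ?PS} =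
      interval_length R ?P {\<zero>\<^bsub>?P\<^esub>} ?PS"
    by (intro interval_length_image[OF M_module P \<Phi> M.carrier_is_submodule module.submodule_zero[OF P]])
       (use module.submodule_zero_mem[OF P M.submodule_power_submodule[OF S]] in auto)
  also have "\<dots> = enat ?n * interval_length R M {\<zero>\<^bsub>M\<^esub>} ?S"
    using M.interval_length_power[OF M.submodule_zero S, of ?n] M.submodule_zero_mem[OF S]
    unfolding M.power_submodule_zero by simp
  finally have "enat ?n * interval_length R M {\<zero>\<^bsub>M\<^esub>} ?S =
      interval_length R M {v \<in> carrier M. \<Phi> v \<in> {\<zero>\<^bsub>?P\<^esub>}} {v \<in> carrier M. \<Phi> v \<in> ?PS}" by simp
  also have "\<dots> \<le> interval_length R M mM (carrier M)"
  proof (rule interval_length_mono)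
    \<comment> \<open>So the socle power is already hit by M / m M, and embdim times the socle
      length is at most r \<le> s, which in turn is at most the socle length.\<close>
    show "mM \<subseteq> {v \<in> carrier M. \<Phi> v \<in> {\<zero>\<^bsub>?P\<^esub>}}"
      using mM_subset_socle pe by (auto simp: \<Phi>_def socle_def fun_eq_iff subset_iff)
  qed auto
  also have "\<dots> \<le> enat s" unfolding length_M_mod_mM using r_le_s by simp
  finally have le: "enat ?n * interval_length R M {\<zero>\<^bsub>M\<^esub>} ?S \<le> enat s" .
  have "enat s \<le> interval_length R M {\<zero>\<^bsub>M\<^esub>} ?S"
    unfolding length_mM[symmetric] by (rule interval_length_mono) (use mM_subset_socle in auto)
  moreover obtain l where l: "interval_length R M {\<zero>\<^bsub>M\<^esub>} ?S = enat l"
    using length_submodule_finite[of ?S] by (auto simp: socle_def)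
  ultimately have "?n * l \<le> s" "s \<le> l" using le by auto
  then have "?n * l \<le> 1 * l" "l > 0" using s_pos unfolding mult_1 by linarith+
  then show ?thesis by (simp only: mult_le_cancel2)
qed

end

text \<open>Vanishing of Ext is recorded as exactness of Hom(minimal resolution, M) in the degrees
  \<open>Suc k\<close> above n0.\<close>

locale Ext_vanishing_setup = minimal_hull_resolution R \<mm> E b d \<epsilon> + square_zero_module R \<mm> M
  for R (structure) and \<mm> and E :: "('a, 'e) module" and b d \<epsilon> and M :: "('a, 'm) module" +
  fixes n0 :: nat
  assumes Ext_vanishing: "k \<ge> n0 \<Longrightarrow> f \<in> linear_maps R (F (b (Suc k))) M \<Longrightarrow>
      (\<And>u. u \<in> carrier (F (b (Suc (Suc k)))) \<Longrightarrow> f (d (Suc k) u) = \<zero>\<^bsub>M\<^esub>) \<Longrightarrow>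
      \<exists>h \<in> linear_maps R (F (b k)) M. \<forall>u\<in>carrier (F (b (Suc k))). f u = h (d k u)"
begin

lemma betti_decreasing:
  assumes k: "k \<ge> n0"
  shows "b (Suc k) \<le> b k"
proof -
  let ?n = "b k" and ?l = "b (Suc k)"
  let ?P = "direct_power M {..<?n}" and ?Q = "direct_power M {..<?l}"
  let ?e = "\<lambda>i. single Reg i \<one>"
  have P: "module R ?P" and Q: "module R ?Q" by (rule M.direct_power_is_module)+
  have e: "?e i \<in> carrier (F ?l)" if "i < ?l" for i using that by (auto simp: F_carrier single_def)
  have de: "d k (?e i) \<in> carrier (F ?n)" if "i < ?l" for i by (rule lin_closed[OF lin_d e[OF that]])
  \<comment> \<open>Hom(d k, M) in coordinates, from M^n to M^l. Entries of differentials lie in m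
    and m kills m M; therefore tuples in m M are cocycles, hence values of \<Phi>, and \<Phi>
    vanishes on such tuples in its source.\<close>
  define \<Phi> where "\<Phi> t = (\<lambda>i. if i < ?l then dot M ?n t (d k (?e i)) else \<zero>\<^bsub>M\<^esub>)" for t
  note dl = M.lin_dot_left[OF de]
  have \<Phi>: "\<Phi> \<in> linear_maps R ?P ?Q"
  proof (rule linear_mapsI)
    show "\<Phi> t \<in> carrier ?Q" if "t \<in> carrier ?P" for t
      using lin_closed[OF dl that] by (simp add: \<Phi>_def direct_power_carrier_finite)
    show "\<Phi> (t \<oplus>\<^bsub>?P\<^esub> t') = \<Phi> t \<oplus>\<^bsub>?Q\<^esub> \<Phi> t'" if "t \<in> carrier ?P" "t' \<in> carrier ?P" for t t'
    proof
      fix i show "\<Phi> (t \<oplus>\<^bsub>?P\<^esub> t') i = (\<Phi> t \<oplus>\<^bsub>?Q\<^esub> \<Phi> t') i"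
        using lin_add[OF dl[of i] that] by (cases "i < ?l") (simp_all add: \<Phi>_def)
    qed
    show "\<Phi> (a \<odot>\<^bsub>?P\<^esub> t) = a \<odot>\<^bsub>?Q\<^esub> \<Phi> t" if "a \<in> carrier R" "t \<in> carrier ?P" for a t
    proof
      fix i show "\<Phi> (a \<odot>\<^bsub>?P\<^esub> t) i = (a \<odot>\<^bsub>?Q\<^esub> \<Phi> t) i"
        using lin_smult[OF dl[of i] that] that(1) by (cases "i < ?l") (simp_all add: \<Phi>_def)
    qed
  qed
  let ?PS = "power_submodule M {..<?n} mM" and ?QS = "power_submodule M {..<?l} mM"
  have mM_m: "a \<odot>\<^bsub>M\<^esub> x = \<zero>\<^bsub>M\<^esub>" if "a \<in> \<mm>" "x \<in> mM" for a x
    using that mM_subset_socle by (auto simp: socle_def)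
  have "?QS \<subseteq> \<Phi> ` carrier ?P"
  proof
    fix t assume t: "t \<in> ?QS"
    then have tQ: "t \<in> carrier ?Q" and tm: "\<And>i. t i \<in> mM" by (auto simp: power_submodule_def)
    have "dot M ?l t (d (Suc k) u) = \<zero>\<^bsub>M\<^esub>" if "u \<in> carrier (F (b (Suc (Suc k))))" for u
      by (rule M.dot_zero) (use minimal[OF that] mM_m tm in \<open>simp add: mF_iff\<close>)
    then obtain h where h: "h \<in> linear_maps R (F ?n) M"
      "\<And>u. u \<in> carrier (F ?l) \<Longrightarrow> dot M ?l t u = h (d k u)"
      using Ext_vanishing[OF k M.lin_dot_right[OF tQ]] by blast
    obtain t' where t': "t' \<in> carrier ?P" "\<And>u. u \<in> carrier (F ?n) \<Longrightarrow> h u = dot M ?n t' u"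
      using M.lin_eq_dot[OF h(1)] by blast
    have "t = \<Phi> t'"
    proof
      fix i show "t i = \<Phi> t' i"
      proof (cases "i < ?l")
        case True
        then show ?thesis
          using h(2)[OF e[OF True]] t'(2)[OF de[OF True]] M.dot_single[OF tQ True] by (simp add: \<Phi>_def)
      next
        case False
        then show ?thesis using tQ by (simp add: \<Phi>_def direct_power_carrier_finite)
      qed
    qed
    then show "t \<in> \<Phi> ` carrier ?P" using t'(1) by blast
  qed
  then have "interval_length R ?P {v \<in> carrier ?P. \<Phi> v \<in> {\<zero>\<^bsub>?Q\<^esub>}} {v \<in> carrier ?P. \<Phi> v \<in> ?QS} =
      interval_length R ?Q {\<zero>\<^bsub>?Q\<^esub>} ?QS"
    by (intro interval_length_image[OF P Q \<Phi> module.carrier_is_submodule[OF P] module.submodule_zero[OF Q]])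
       (use module.submodule_zero_mem[OF Q M.submodule_power_submodule[OF submodule_mM]] in auto)
  also have "\<dots> = enat ?l * enat s"
    using M.interval_length_power[OF M.submodule_zero submodule_mM, of ?l] M.submodule_zero_mem[OF submodule_mM]
    unfolding M.power_submodule_zero length_mM by simp
  finally have "enat ?l * enat s =
      interval_length R ?P {v \<in> carrier ?P. \<Phi> v \<in> {\<zero>\<^bsub>?Q\<^esub>}} {v \<in> carrier ?P. \<Phi> v \<in> ?QS}" by simp
  also have "\<dots> \<le> interval_length R ?P ?PS (power_submodule M {..<?n} (carrier M))"
  proof (rule interval_length_mono)
    show "?PS \<subseteq> {v \<in> carrier ?P. \<Phi> v \<in> {\<zero>\<^bsub>?Q\<^esub>}}"
    proof
      fix t assume t: "t \<in> ?PS"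
      then have tP: "t \<in> carrier ?P" and tm: "\<And>i. t i \<in> mM" by (auto simp: power_submodule_def)
      have "\<Phi> t = \<zero>\<^bsub>?Q\<^esub>"
      proof
        fix i show "\<Phi> t i = \<zero>\<^bsub>?Q\<^esub> i"
          using minimal[OF e[of i]] mM_m tm by (auto simp: \<Phi>_def mF_iff intro!: M.dot_zero)
      qed
      then show "t \<in> {v \<in> carrier ?P. \<Phi> v \<in> {\<zero>\<^bsub>?Q\<^esub>}}" using tP by blast
    qed
  qed (auto simp: M.power_submodule_carrier)
  also have "\<dots> = enat ?n * enat r"
    using M.interval_length_power[OF submodule_mM M.carrier_is_submodule mM_subset, of ?n]
    unfolding length_M_mod_mM .
  finally have "?l * s \<le> ?n * r" by simp
  also have "\<dots> \<le> ?n * s" using r_le_s by simp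
  finally show ?thesis using s_pos by (simp only: mult_le_cancel2)
qed

text \<open>For k > 0 the class of y is a copy of the residue field splitting off the previous
  syzygy; the proof makes this explicit. A coordinate of y is a unit, so some functional p has p y =
  1. For f from m to M, the composite f p d is a cocycle and equals h d with h defined on all of
  \<open>F (b k)\<close>; as a y lies in \<open>Z k\<close>, f a = f (p (a y)) = h (a y) = a h
  y.\<close>

lemma embdim_le_1_if_socle_generator:
  assumes k: "k \<ge> n0" and y: "y \<in> carrier (F (b k))" "y \<notin> mF (b k)"
    and my: "\<And>a. a \<in> \<mm> \<Longrightarrow> a \<odot>\<^bsub>F (b k)\<^esub> y \<in> Z k"
  shows "embdim \<le> 1"
proof (rule embdim_le_1_if_extends)
  fix f assume f: "f \<in> linear_maps R (Reg\<lparr>carrier := \<mm>\<rparr>) M"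
  obtain i where i: "y i \<notin> \<mm>" using y by (auto simp: mF_iff)
  have yi: "y i \<in> carrier R" using y(1) by (simp add: F_carrier)
  obtain w where w: "w \<in> carrier R" "w \<otimes> y i = \<one>" using unit_if_notin_m[OF yi i] by blast
  define p where "p u = u i \<otimes> w" for u :: "nat \<Rightarrow> 'a"
  have pm: "p u \<in> \<mm>" if "u \<in> mF (b k)" for u
    using that w(1) m.I_r_closed by (simp add: p_def mF_iff)
  let ?f = "\<lambda>u. f (p (d k u))"
  have f': "?f \<in> linear_maps R (F (b (Suc k))) M"
  proof (rule linear_mapsI)
    show "?f u \<in> carrier M" if "u \<in> carrier (F (b (Suc k)))" for u
      using lin_closed[OF f] pm[OF minimal[OF that]] by simp
    show "?f (u \<oplus>\<^bsub>F (b (Suc k))\<^esub> v) = ?f u \<oplus>\<^bsub>M\<^esub> ?f v"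
      if "u \<in> carrier (F (b (Suc k)))" "v \<in> carrier (F (b (Suc k)))" for u v
    proof -
      have "p (d k u \<oplus>\<^bsub>F (b k)\<^esub> d k v) = p (d k u) \<oplus> p (d k v)"
        using lin_closed[OF lin_d that(1)] lin_closed[OF lin_d that(2)] w(1)
        by (simp add: p_def free_module_eq direct_power_carrier l_distr)
      then show ?thesis
        using lin_add[OF lin_d that] lin_add[OF f, of "p (d k u)" "p (d k v)"]
          pm[OF minimal[OF that(1)]] pm[OF minimal[OF that(2)]] by simp
    qed
    show "?f (a \<odot>\<^bsub>F (b (Suc k))\<^esub> u) = a \<odot>\<^bsub>M\<^esub> ?f u"
      if "a \<in> carrier R" "u \<in> carrier (F (b (Suc k)))" for a u
    proof -
      have "p (a \<odot>\<^bsub>F (b k)\<^esub> d k u) = a \<otimes> p (d k u)"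
        using lin_closed[OF lin_d that(2)] w(1) that(1)
        by (simp add: p_def free_module_eq direct_power_carrier m_assoc)
      then show ?thesis
        using lin_smult[OF lin_d that] lin_smult[OF f that(1), of "p (d k u)"]
          pm[OF minimal[OF that(2)]] by simp
    qed
  qed
  have "?f (d (Suc k) u) = \<zero>\<^bsub>M\<^esub>" if u: "u \<in> carrier (F (b (Suc (Suc k))))" for u
  proof -
    have "d (Suc k) u \<in> Z (Suc k)" using u by (simp add: Z_def)
    then have "d k (d (Suc k) u) = \<zero>\<^bsub>F (b k)\<^esub>" by (simp add: Z_Suc)
    then have "p (d k (d (Suc k) u)) = \<zero>" using w(1) by (simp add: p_def free_module_eq)
    then show ?thesis
      using lin_zero[OF submodule.submodule_is_module[OF submodule_m Reg.module_axioms] M_module f] by simp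
  qed
  then obtain h where h: "h \<in> linear_maps R (F (b k)) M" "\<And>u. u \<in> carrier (F (b (Suc k))) \<Longrightarrow> ?f u = h (d k u)"
    using Ext_vanishing[OF k f'] by blast
  have "f a = a \<odot>\<^bsub>M\<^esub> h y" if a: "a \<in> \<mm>" for a
  proof -
    obtain u where u: "u \<in> carrier (F (b (Suc k)))" "a \<odot>\<^bsub>F (b k)\<^esub> y = d k u"
      using my[OF a] by (auto simp: Z_def)
    have "a = p (a \<odot>\<^bsub>F (b k)\<^esub> y)"
      using w yi m_carrier[OF a] by (simp add: p_def free_module_eq m_assoc m_comm[of "y i" w])
    then have "f a = h (a \<odot>\<^bsub>F (b k)\<^esub> y)" using h(2)[OF u(1)] u(2) by simp
    then show ?thesis using lin_smult[OF h(1) m_carrier[OF a] y(1)] by simp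
  qed
  then show "\<exists>v\<in>carrier M. \<forall>a\<in>\<mm>. f a = a \<odot>\<^bsub>M\<^esub> v" using lin_closed[OF h(1) y(1)] by blast
qed

end

section \<open>The case of constant Betti number two\<close>

text \<open>Pure arithmetic, with e and g for \<open>embdim\<close> and \<open>sqdim\<close>. The
  behavior far out determines e, and the recursion then restricts the beginning.\<close>

lemma betti_numerics:
  fixes b c z :: "nat \<Rightarrow> nat" and e g n0 :: nat
  assumes z: "\<And>n. z n = b (Suc n) + c n"
    and z_Suc: "\<And>n. z (Suc n) + z n = b (Suc n) * (1 + e + g)"
    and z_0: "z 0 + (1 + e + g) = b 0 * (1 + e + g)"
    and c_le: "\<And>n. c n \<le> b n * g"
    and dec: "\<And>k. k \<ge> n0 \<Longrightarrow> b (Suc k) \<le> b k"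
    and c_eq: "\<And>k. k \<ge> n0 \<Longrightarrow> c (Suc k) = b (Suc k) * g"
    and pos: "\<And>n. b (Suc n) > 0"
    and e: "e \<ge> 2"
  shows "e = Suc g" and "b 0 \<le> 1 \<or> (b 0 = 2 \<and> b 1 = 2 \<and> b 2 = 2 \<and> c 0 = 2 * g \<and> c 1 = 2 * g)"
proof -
  \<comment> \<open>The eventual value: from n0 on the sequence decreases, so it stays at its
    minimum once this is attained.\<close>
  define \<beta> where "\<beta> = (LEAST m. \<exists>k\<ge>n0. b k = m)"
  have "\<exists>k\<ge>n0. b k = \<beta>" unfolding \<beta>_def by (rule LeastI_ex) auto
  then obtain N where N: "N \<ge> n0" "b N = \<beta>" by blast
  have min: "\<beta> \<le> b k" if "k \<ge> n0" for k unfolding \<beta>_def by (rule Least_le) (use that in auto)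
  have const: "b k = \<beta>" if "k \<ge> N" for k
    using that
  proof (induction k rule: dec_induct)
    case base then show ?case by (rule N)
  next
    case (step k)
    then show ?case using dec[of k] min[of "Suc k"] N(1) by simp
  qed
  have \<beta>: "\<beta> > 0" using pos[of N] const[of "Suc N"] by simp
  \<comment> \<open>Far out both z-terms of the rank equation equal \<beta> + \<beta> g.\<close>
  have "\<beta> * (2 + 2 * g) = \<beta> * (1 + e + g)"
    using z_Suc[of "Suc N"] z[of "Suc N"] z[of "Suc (Suc N)"] c_eq[of N] c_eq[of "Suc N"] N(1)
      const[of "Suc N"] const[of "Suc (Suc N)"] const[of "Suc (Suc (Suc N))"]
    by (simp add: algebra_simps)
  then have "2 + 2 * g = 1 + e + g" using \<beta> mult_cancel1 by (metis less_numeral_extra(3))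
  then show eg: "e = Suc g" by simp
  have g: "g \<ge> 1" using e eg by simp
  \<comment> \<open>Eliminate z from the rank equation, use e = g + 1, and bound both values of c by
    \<open>c_le\<close>.\<close>
  have growth: "b (Suc n) + b (Suc n) * g \<le> b (Suc (Suc n)) + b n * g" for n
    using z_Suc[of n] z[of n] z[of "Suc n"] c_le[of n] c_le[of "Suc n"] eg
    by (simp add: algebra_simps)
  have inc: "b (Suc n) < b (Suc (Suc n))" if "b n < b (Suc n)" for n
  proof -
    have "Suc (b n) * g \<le> b (Suc n) * g" using that by (intro mult_right_mono) auto
    then show ?thesis using growth[of n] g unfolding mult_Suc by linarith
  qed
  have mono: "b (Suc n) \<le> b (Suc (Suc n))" if "b n \<le> b (Suc n)" for n
  proof -
    have "b n * g \<le> b (Suc n) * g" using that by (intro mult_right_mono) auto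
    then show ?thesis using growth[of n] by linarith
  qed
  \<comment> \<open>By \<open>inc\<close> a single strict increase would repeat in every later
    degree, against eventual constancy.\<close>
  have not_inc: "\<not> b n < b (Suc n)" for n
  proof
    assume n: "b n < b (Suc n)"
    have "b (n + k) < b (Suc (n + k))" for k
      by (induction k) (use n inc in auto)
    from this[of N] show False using const[of "n + N"] const[of "Suc (n + N)"] by simp
  qed
  have b1: "b 1 + c 0 + (2 + 2 * g) = b 0 * (2 + 2 * g)"
    using z_0 z[of 0] eg by (simp add: algebra_simps)
  have "b 0 < 3"
  proof (rule ccontr)
    assume "\<not> b 0 < 3"
    then have "3 * (1 + g) \<le> b 0 * (1 + g)" by (intro mult_right_mono) auto
    \<comment> \<open>Here \<open>b 1\<close> is at least
      \<open>b 0 * (2 + g) - (2 + 2 * g)\<close>, which exceeds \<open>b 0\<close> exactly when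
      \<open>b 0\<close> is greater than 2.\<close>
    then have "b 0 < b 1" using b1 c_le[of 0] by (simp add: algebra_simps)
    then show False using not_inc[of 0] by simp
  qed
  then consider "b 0 \<le> 1" | "b 0 = 2" by linarith
  then show "b 0 \<le> 1 \<or> (b 0 = 2 \<and> b 1 = 2 \<and> b 2 = 2 \<and> c 0 = 2 * g \<and> c 1 = 2 * g)"
  proof cases
    case 2
    \<comment> \<open>The bound on \<open>c 0\<close> forces \<open>b 1\<close> to be at least 2,
      and no increase is allowed, so both inequalities are equalities.\<close>
    have "b 1 + c 0 = 2 + 2 * g" "c 0 \<le> 2 * g" using b1 c_le[of 0] 2 by auto
    moreover have "\<not> b 0 < b 1" using not_inc[of 0] by simp
    ultimately have b1': "b 1 = 2" "c 0 = 2 * g" using 2 by auto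
    then have "b 2 \<ge> 2" "\<not> b 2 > 2" using mono[of 0] not_inc[of 1] 2 by (auto simp: numeral_2_eq_2)
    then have b2: "b 2 = 2" by simp
    then have "c 1 = 2 * g"
      using z_Suc[of 0] z[of 0] z[of 1] b1' eg by (simp add: numeral_2_eq_2)
    then show ?thesis using 2 b1' b2 by simp
  qed simp
qed

text \<open>Half of the second isomorphism theorem: adding A to a chain keeps it strict by
  \<open>modular_eq\<close>, because all its members meet A in the same submodule A \<inter>
  W.\<close>

lemma (in module) interval_length_Int_le:
  assumes A: "submodule A R M" and W: "submodule W R M"
  shows "interval_length R M (A \<inter> W) W \<le> interval_length R M A (W <+>\<^bsub>M\<^esub> A)"
proof (rule interval_length_le)
  fix n N assume N: "submodule_chain R M (A \<inter> W) W n N"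
  have Ni: "submodule (N i) R M" "A \<inter> W \<subseteq> N i" "N i \<subseteq> W" if "i \<le> n" for i
    using N that by (simp_all add: submodule_chain_def)
  have "submodule_chain R M A (W <+>\<^bsub>M\<^esub> A) n (\<lambda>i. N i <+>\<^bsub>M\<^esub> A)"
    unfolding submodule_chain_def
  proof (intro conjI allI impI)
    fix i assume i: "i \<le> n"
    show "submodule (N i <+>\<^bsub>M\<^esub> A) R M" by (rule submodule_set_add[OF Ni(1)[OF i] A])
    show "A \<subseteq> N i <+>\<^bsub>M\<^esub> A" by (rule subset_set_add(2)[OF Ni(1)[OF i] A])
    show "N i <+>\<^bsub>M\<^esub> A \<subseteq> W <+>\<^bsub>M\<^esub> A" by (rule set_add_mono[OF Ni(3)[OF i]])
  next
    fix i assume i: "i < n"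
    then have i': "i \<le> n" "Suc i \<le> n" by auto
    have lt: "N i \<subset> N (Suc i)" using N i by (simp add: submodule_chain_def)
    have int: "N j \<inter> A = A \<inter> W" if "j \<le> n" for j using Ni[OF that] by blast
    have "N i <+>\<^bsub>M\<^esub> A \<noteq> N (Suc i) <+>\<^bsub>M\<^esub> A"
      using modular_eq[OF Ni(1)[OF i'(1)] Ni(1)[OF i'(2)] A] int[OF i'(1)] int[OF i'(2)] lt by auto
    then show "N i <+>\<^bsub>M\<^esub> A \<subset> N (Suc i) <+>\<^bsub>M\<^esub> A"
      using set_add_mono[of "N i" "N (Suc i)" A] lt by blast
  qed
  then show "enat n \<le> interval_length R M A (W <+>\<^bsub>M\<^esub> A)" by (rule interval_length_ge)
qed

context cube_zero_injective_hull
begin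

text \<open>Some coordinate of h is nonzero at the socle generator w. Its kernel omits w and is
  therefore zero, so E embeds into R; equal lengths make this embedding onto, and E is
  cyclic.\<close>

lemma gorenstein_if_embeds:
  assumes h: "h \<in> linear_maps R E (F n)" and inj: "\<And>v. v \<in> carrier E \<Longrightarrow> h v = \<zero>\<^bsub>F n\<^esub> \<Longrightarrow> v = \<zero>\<^bsub>E\<^esub>"
  shows "gorenstein R \<mm>"
proof -
  have "h w \<noteq> \<zero>\<^bsub>F n\<^esub>" using inj[OF w(1)] w(2) by blast
  then obtain i where i: "h w i \<noteq> \<zero>" by (auto simp: free_module_eq fun_eq_iff)
  let ?f = "\<lambda>v. h v i"
  have f: "?f \<in> linear_maps R E Reg"
    by (rule lin_comp[OF h]) (use Reg.lin_coordinate in \<open>simp add: free_module_eq\<close>)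
  have fR: "?f v \<in> carrier R" if "v \<in> carrier E" for v using lin_closed[OF f that] by simp
  let ?K = "{v \<in> carrier E. ?f v = \<zero>\<^bsub>Reg\<^esub>}"
  have "submodule {v \<in> carrier E. ?f v \<in> {\<zero>\<^bsub>Reg\<^esub>}} R E"
    by (rule submodule_vimage[OF E.module_axioms Reg.module_axioms f E.carrier_is_submodule Reg.submodule_zero])
  then have K: "?K = {\<zero>\<^bsub>E\<^esub>}" using w(4)[of ?K] i by auto
  have im: "submodule (?f ` carrier E) R Reg"
    by (rule submodule_image[OF E.module_axioms Reg.module_axioms f E.carrier_is_submodule])
  have "interval_length R Reg {\<zero>} (?f ` carrier E) = enat (1 + embdim + sqdim)"
    using interval_length_rank_nullity[OF E.module_axioms Reg.module_axioms f E.carrier_is_submodule]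
    unfolding K length_E by simp
  then have "?f ` carrier E = carrier Reg"
    using Reg.interval_length_eq_imp_eq[OF Reg.submodule_zero im Reg.carrier_is_submodule]
      length_R(3) Reg.submodule_zero_mem[OF im] Reg.submodule_sub[OF im] by auto
  then obtain y where y: "y \<in> carrier E" "?f y = \<one>" using one_closed by (metis imageE regular_module_simps(1))
  have "v = ?f v \<odot>\<^bsub>E\<^esub> y" if v: "v \<in> carrier E" for v
  proof -
    have c: "?f v \<odot>\<^bsub>E\<^esub> y \<in> carrier E" using fR[OF v] y by simp
    have "?f (v \<ominus>\<^bsub>E\<^esub> ?f v \<odot>\<^bsub>E\<^esub> y) = ?f v \<ominus>\<^bsub>Reg\<^esub> ?f v"
      unfolding lin_minus[OF E.module_axioms Reg.module_axioms f v c] lin_smult[OF f fR[OF v] y(1)] y(2)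
      using fR[OF v] by simp
    also have "\<dots> = \<zero>\<^bsub>Reg\<^esub>" using fR[OF v] by (subst Reg.minus_eq_zero_iff) simp_all
    finally have "v \<ominus>\<^bsub>E\<^esub> ?f v \<odot>\<^bsub>E\<^esub> y \<in> ?K" using v c by simp
    then have "v \<ominus>\<^bsub>E\<^esub> ?f v \<odot>\<^bsub>E\<^esub> y = \<zero>\<^bsub>E\<^esub>" unfolding K by simp
    then show ?thesis using E.minus_eq_zero_iff[OF v c] by simp
  qed
  then have "carrier E = (\<lambda>a. a \<odot>\<^bsub>E\<^esub> y) ` carrier R" using fR y(1) by blast
  then show ?thesis by (rule gorenstein_if_cyclic[OF y(1)])
qed

end

context minimal_hull_resolution
begin

text \<open>Writing \<open>d 0\<close> as a 2 by 2 matrix, its determinant annihilates the faithful module \<open>E\<close>, so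
  its adjugate \<open>\<beta>\<close> composes to zero with \<open>d 0\<close> on both sides. Counting lengths,
  \<open>ker \<beta> = im (d 0)\<close>, whence \<open>E = coker (d 0)\<close> embeds into a free module.\<close>

lemma gorenstein_if_betti_2:
  assumes b: "b 0 = 2" "b (Suc 0) = 2" "b (Suc (Suc 0)) = 2"
    and c: "c 0 = 2 * sqdim" "c (Suc 0) = 2 * sqdim"
    and dims: "embdim = Suc sqdim" "sqdim \<ge> 1"
  shows "gorenstein R \<mm>"
proof -
  interpret F2: module R "F 2" by (rule F_module)
  \<comment> \<open>Column vectors with two entries, padded by zeros since elements of
    \<open>F 2\<close> are functions on \<open>nat\<close>.\<close>
  define pr where "pr x y = (\<lambda>i::nat. if i = 0 then x else if i = 1 then y else \<zero>)" for x y
  have pr_F: "pr x y \<in> carrier (F 2)" if "x \<in> carrier R" "y \<in> carrier R" for x y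
    using that by (auto simp: F_carrier pr_def)
  have F2D: "u 0 \<in> carrier R" "u 1 \<in> carrier R" "u = pr (u 0) (u 1)" if "u \<in> carrier (F 2)" for u
  proof -
    show "u 0 \<in> carrier R" "u 1 \<in> carrier R" using that by (simp_all add: F_carrier)
    show "u = pr (u 0) (u 1)"
    proof
      fix i show "u i = pr (u 0) (u 1) i"
        using that by (cases "i = 0"; cases "i = 1") (auto simp: F_carrier pr_def)
    qed
  qed
  have pr_simps: "pr x y 0 = x" "pr x y (Suc 0) = y" for x y by (simp_all add: pr_def)
  have pr_zero: "\<zero>\<^bsub>F 2\<^esub> = pr \<zero> \<zero>" by (auto simp: free_module_eq pr_def)
  have pr_add: "pr x y \<oplus>\<^bsub>F 2\<^esub> pr x' y' = pr (x \<oplus> x') (y \<oplus> y')" for x y x' y'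
    by (auto simp: free_module_eq pr_def fun_eq_iff)
  have pr_smult: "a \<odot>\<^bsub>F 2\<^esub> pr x y = pr (a \<otimes> x) (a \<otimes> y)" if "a \<in> carrier R" for a x y
    using that by (auto simp: free_module_eq pr_def fun_eq_iff)
  have lin0: "d 0 \<in> linear_maps R (F 2) (F 2)" and lin1: "d (Suc 0) \<in> linear_maps R (F 2) (F 2)"
    using lin_d[of 0] lin_d[of "Suc 0"] unfolding b .
  define A C where "A = d 0 (pr \<one> \<zero>) 0" and "C = d 0 (pr \<one> \<zero>) 1"
  define B D where "B = d 0 (pr \<zero> \<one>) 0" and "D = d 0 (pr \<zero> \<one>) 1"
  have m: "A \<in> \<mm>" "B \<in> \<mm>" "C \<in> \<mm>" "D \<in> \<mm>"
    using minimal[of "pr \<one> \<zero>" 0] minimal[of "pr \<zero> \<one>" 0] unfolding b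
    by (auto simp: pr_F mF_iff A_def B_def C_def D_def)
  then have ABCD: "A \<in> carrier R" "B \<in> carrier R" "C \<in> carrier R" "D \<in> carrier R"
    using m_carrier by auto
  have d0: "d 0 (pr x y) = pr (A \<otimes> x \<oplus> B \<otimes> y) (C \<otimes> x \<oplus> D \<otimes> y)"
    if xy: "x \<in> carrier R" "y \<in> carrier R" for x y
  proof -
    have e: "pr \<one> \<zero> \<in> carrier (F 2)" "pr \<zero> \<one> \<in> carrier (F 2)" by (simp_all add: pr_F)
    have "pr x y = x \<odot>\<^bsub>F 2\<^esub> pr \<one> \<zero> \<oplus>\<^bsub>F 2\<^esub> y \<odot>\<^bsub>F 2\<^esub> pr \<zero> \<one>"
      using xy by (simp add: pr_smult pr_add)
    then have "d 0 (pr x y) = x \<odot>\<^bsub>F 2\<^esub> d 0 (pr \<one> \<zero>) \<oplus>\<^bsub>F 2\<^esub> y \<odot>\<^bsub>F 2\<^esub> d 0 (pr \<zero> \<one>)"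
      using lin_add[OF lin0 F2.smult_closed[OF xy(1) e(1)] F2.smult_closed[OF xy(2) e(2)]]
        lin_smult[OF lin0 xy(1) e(1)] lin_smult[OF lin0 xy(2) e(2)] by simp
    also have "d 0 (pr \<one> \<zero>) = pr A C"
      using F2D(3)[OF lin_closed[OF lin0 e(1)]] by (simp add: A_def C_def)
    also have "d 0 (pr \<zero> \<one>) = pr B D"
      using F2D(3)[OF lin_closed[OF lin0 e(2)]] by (simp add: B_def D_def)
    finally show ?thesis using xy ABCD by (simp add: pr_smult pr_add m_comm)
  qed
  \<comment> \<open>The columns of \<open>d 0\<close> are (A, C) and (B, D), so this is
    multiplication by the adjugate matrix with rows (D, -B) and (-C, A).\<close>
  define \<beta> where "\<beta> u = pr (D \<otimes> u 0 \<ominus> B \<otimes> u (Suc 0)) (A \<otimes> u (Suc 0) \<ominus> C \<otimes> u 0)" for u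
  have \<beta>_pr: "\<beta> (pr x y) = pr (D \<otimes> x \<ominus> B \<otimes> y) (A \<otimes> y \<ominus> C \<otimes> x)" for x y
    by (simp add: \<beta>_def pr_simps)
  have \<beta>: "\<beta> \<in> linear_maps R (F 2) (F 2)"
  proof (rule linear_mapsI)
    show "\<beta> u \<in> carrier (F 2)" if "u \<in> carrier (F 2)" for u
      using F2D[OF that] ABCD unfolding \<beta>_def by (intro pr_F) auto
    show "\<beta> (u \<oplus>\<^bsub>F 2\<^esub> v) = \<beta> u \<oplus>\<^bsub>F 2\<^esub> \<beta> v" if "u \<in> carrier (F 2)" "v \<in> carrier (F 2)" for u v
    proof -
      obtain x y x' y' where xy: "x \<in> carrier R" "y \<in> carrier R" "u = pr x y"
        "x' \<in> carrier R" "y' \<in> carrier R" "v = pr x' y'"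
        using F2D[OF \<open>u \<in> carrier (F 2)\<close>] F2D[OF \<open>v \<in> carrier (F 2)\<close>] by blast
      have "D \<otimes> (x \<oplus> x') \<ominus> B \<otimes> (y \<oplus> y') = (D \<otimes> x \<ominus> B \<otimes> y) \<oplus> (D \<otimes> x' \<ominus> B \<otimes> y')"
        "A \<otimes> (y \<oplus> y') \<ominus> C \<otimes> (x \<oplus> x') = (A \<otimes> y \<ominus> C \<otimes> x) \<oplus> (A \<otimes> y' \<ominus> C \<otimes> x')"
        using xy(1,2,4,5) ABCD by algebra+
      then show ?thesis unfolding xy by (simp add: pr_add \<beta>_pr)
    qed
    show "\<beta> (a \<odot>\<^bsub>F 2\<^esub> u) = a \<odot>\<^bsub>F 2\<^esub> \<beta> u" if a: "a \<in> carrier R" and u: "u \<in> carrier (F 2)" for a u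
    proof -
      obtain x y where xy: "x \<in> carrier R" "y \<in> carrier R" "u = pr x y" using F2D[OF u] by blast
      have "D \<otimes> (a \<otimes> x) \<ominus> B \<otimes> (a \<otimes> y) = a \<otimes> (D \<otimes> x \<ominus> B \<otimes> y)"
        "A \<otimes> (a \<otimes> y) \<ominus> C \<otimes> (a \<otimes> x) = a \<otimes> (A \<otimes> y \<ominus> C \<otimes> x)"
        using xy(1,2) ABCD a by algebra+
      then show ?thesis unfolding xy using a by (simp add: pr_smult \<beta>_pr)
    qed
  qed
  let ?det = "A \<otimes> D \<ominus> B \<otimes> C"
  have detR: "?det \<in> carrier R" using ABCD by simp
  have d\<beta>: "d 0 (\<beta> u) = ?det \<odot>\<^bsub>F 2\<^esub> u" if u: "u \<in> carrier (F 2)" for u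
  proof -
    obtain x y where xy: "x \<in> carrier R" "y \<in> carrier R" "u = pr x y" using F2D[OF u] by blast
    have eqs: "A \<otimes> (D \<otimes> x \<ominus> B \<otimes> y) \<oplus> B \<otimes> (A \<otimes> y \<ominus> C \<otimes> x) = ?det \<otimes> x"
      "C \<otimes> (D \<otimes> x \<ominus> B \<otimes> y) \<oplus> D \<otimes> (A \<otimes> y \<ominus> C \<otimes> x) = ?det \<otimes> y"
      using xy(1,2) ABCD by algebra+
    have c: "D \<otimes> x \<ominus> B \<otimes> y \<in> carrier R" "A \<otimes> y \<ominus> C \<otimes> x \<in> carrier R" using xy ABCD by auto
    show ?thesis unfolding xy \<beta>_pr d0[OF c] eqs pr_smult[OF detR] ..
  qed
  have \<beta>d: "\<beta> (d 0 u) = ?det \<odot>\<^bsub>F 2\<^esub> u" if u: "u \<in> carrier (F 2)" for u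
  proof -
    obtain x y where xy: "x \<in> carrier R" "y \<in> carrier R" "u = pr x y" using F2D[OF u] by blast
    have eqs: "D \<otimes> (A \<otimes> x \<oplus> B \<otimes> y) \<ominus> B \<otimes> (C \<otimes> x \<oplus> D \<otimes> y) = ?det \<otimes> x"
      "A \<otimes> (C \<otimes> x \<oplus> D \<otimes> y) \<ominus> C \<otimes> (A \<otimes> x \<oplus> B \<otimes> y) = ?det \<otimes> y"
      using xy(1,2) ABCD by algebra+
    show ?thesis unfolding xy d0[OF xy(1,2)] \<beta>_pr eqs pr_smult[OF detR] ..
  qed
  have eps: "\<epsilon> \<in> linear_maps R (F 2) E" "\<epsilon> ` carrier (F 2) = carrier E"
    using resolutionD(1,2) unfolding b .
  have Z0: "u \<in> Z 0 \<longleftrightarrow> u \<in> carrier (F 2) \<and> \<epsilon> u = \<zero>\<^bsub>E\<^esub>" for u using Z_0[of u] unfolding b .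
  have Z0': "Z 0 = d 0 ` carrier (F 2)" unfolding Z_def b ..
  have det: "?det = \<zero>"
  proof (rule E_faithful[OF detR])
    fix v assume "v \<in> carrier E"
    then obtain u where u: "u \<in> carrier (F 2)" "v = \<epsilon> u" using eps(2) by blast
    \<comment> \<open>The determinant times u is \<open>d 0 (\<beta> u)\<close>, a relation of E;
      hence the determinant kills E.\<close>
    have "?det \<odot>\<^bsub>F 2\<^esub> u \<in> Z 0"
      unfolding Z0' d\<beta>[OF u(1), symmetric] using lin_closed[OF \<beta> u(1)] by blast
    then show "?det \<odot>\<^bsub>E\<^esub> v = \<zero>\<^bsub>E\<^esub>" unfolding Z0 using lin_smult[OF eps(1) detR u(1)] u(2) by simp
  qed
  have Z0_ker: "Z 0 \<subseteq> {u \<in> carrier (F 2). \<beta> u = \<zero>\<^bsub>F 2\<^esub>}"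
    unfolding Z0' using \<beta>d lin_closed[OF lin0] det by auto
  let ?W = "\<beta> ` carrier (F 2)"
  have W_Z: "?W \<subseteq> Z (Suc 0)"
  proof
    fix v assume "v \<in> ?W"
    then obtain u where u: "u \<in> carrier (F 2)" "v = \<beta> u" by blast
    then show "v \<in> Z (Suc 0)"
      unfolding Z_Suc b using d\<beta>[OF u(1)] lin_closed[OF \<beta> u(1)] det by simp
  qed
  have W: "submodule ?W R (F 2)" by (rule submodule_image[OF F_module F_module \<beta> F2.carrier_is_submodule])
  have mZ0: "mZ 0 = m2F 2" and mZ1: "mZ (Suc 0) = m2F 2"
    using mZ_eq_m2F_if[of 0] mZ_eq_m2F_if[of "Suc 0"] b c by simp_all
  have sZ1: "submodule (Z (Suc 0)) R (F 2)" using submodule_Z[of "Suc 0"] unfolding b .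
  have m2F2: "pr x y \<in> m2F 2" if "x \<in> msq" "y \<in> msq" for x y
  proof -
    have "x \<in> carrier R" "y \<in> carrier R" using that msq_subset m_carrier by auto
    then show ?thesis
      using that pr_F[of x y] Reg.submodule_zero_mem[OF submodule_msq]
      by (auto simp: power_submodule_def free_module_eq pr_def)
  qed
  \<comment> \<open>A nonzero t in m^2 serves as a detector: x t = 0 is possible only for x in
    m.\<close>
  obtain t where t: "t \<in> msq" "t \<noteq> \<zero>"
  proof -
    have "msq \<noteq> {\<zero>}"
    proof
      assume "msq = {\<zero>}"
      then have "interval_length R Reg {\<zero>} msq = 0" by simp
      then show False using length_R(1) dims(2) by (simp add: zero_enat_def)
    qed
    then show thesis using that Reg.submodule_zero_mem[OF submodule_msq] by auto
  qed
  have tR: "t \<in> carrier R" using t msq_subset m_carrier by auto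
  have unit: "x \<in> \<mm>" if "x \<in> carrier R" "x \<otimes> t = \<zero>" for x
    using smult_unit_cancel[OF Reg.module_axioms Reg.submodule_zero, of t x] that t(2) tR by auto
  have \<beta>_m2F: "u \<in> mF 2" if u: "u \<in> carrier (F 2)" and \<beta>u: "\<beta> u \<in> m2F 2" for u
  proof -
    obtain x y where xy: "x \<in> carrier R" "y \<in> carrier R" "u = pr x y" using F2D[OF u] by blast
    \<comment> \<open>Chosen so that f (d 0 (p, q)) = q (D x - B y) - p (A y - C x), a combination
      of the entries of \<open>\<beta> u\<close>. These lie in m^2, so f maps \<open>Z 0\<close>
      into m^2 and kills \<open>mZ 0\<close>, which is all of m^2 F. Testing on (0, t) and (t, 0)
      gives x t = y t = 0.\<close>
    define f where "f v = x \<otimes> v (Suc 0) \<ominus> y \<otimes> v 0" for v :: "nat \<Rightarrow> 'a"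
    have f: "f \<in> linear_maps R (F 2) Reg"
    proof (rule linear_mapsI)
      show "f v \<in> carrier Reg" if "v \<in> carrier (F 2)" for v
        using F2D[OF that] xy by (simp add: f_def)
      show "f (v \<oplus>\<^bsub>F 2\<^esub> v') = f v \<oplus>\<^bsub>Reg\<^esub> f v'" if "v \<in> carrier (F 2)" "v' \<in> carrier (F 2)" for v v'
      proof -
        obtain p q p' q' where pq: "p \<in> carrier R" "q \<in> carrier R" "v = pr p q"
          "p' \<in> carrier R" "q' \<in> carrier R" "v' = pr p' q'"
          using F2D[OF \<open>v \<in> carrier (F 2)\<close>] F2D[OF \<open>v' \<in> carrier (F 2)\<close>] by blast
        have "x \<otimes> (q \<oplus> q') \<ominus> y \<otimes> (p \<oplus> p') = (x \<otimes> q \<ominus> y \<otimes> p) \<oplus> (x \<otimes> q' \<ominus> y \<otimes> p')"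
          using xy(1,2) pq(1,2,4,5) by algebra
        then show ?thesis unfolding pq by (simp add: pr_add f_def pr_simps)
      qed
      show "f (a \<odot>\<^bsub>F 2\<^esub> v) = a \<odot>\<^bsub>Reg\<^esub> f v" if a: "a \<in> carrier R" and v: "v \<in> carrier (F 2)" for a v
      proof -
        obtain p q where pq: "p \<in> carrier R" "q \<in> carrier R" "v = pr p q" using F2D[OF v] by blast
        have "x \<otimes> (a \<otimes> q) \<ominus> y \<otimes> (a \<otimes> p) = a \<otimes> (x \<otimes> q \<ominus> y \<otimes> p)"
          using xy(1,2) pq(1,2) a by algebra
        then show ?thesis unfolding pq using a by (simp add: pr_smult f_def pr_simps)
      qed
    qed
    have \<beta>m: "D \<otimes> x \<ominus> B \<otimes> y \<in> msq" "A \<otimes> y \<ominus> C \<otimes> x \<in> msq"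
      using \<beta>u unfolding xy \<beta>_pr power_submodule_def by (force simp: pr_simps dest: spec[of _ 0] spec[of _ "Suc 0"])+
    have fZ: "f v \<in> msq" if "v \<in> Z 0" for v
    proof -
      obtain u' where "u' \<in> carrier (F 2)" "v = d 0 u'" using \<open>v \<in> Z 0\<close> unfolding Z0' by blast
      then obtain p q where pq: "p \<in> carrier R" "q \<in> carrier R" "v = d 0 (pr p q)" using F2D by metis
      have "f v = q \<otimes> (D \<otimes> x \<ominus> B \<otimes> y) \<oplus> (\<ominus> p) \<otimes> (A \<otimes> y \<ominus> C \<otimes> x)"
        unfolding pq(3) d0[OF pq(1,2)] f_def pr_simps using pq(1,2) xy(1,2) ABCD by algebra
      moreover have "q \<otimes> (D \<otimes> x \<ominus> B \<otimes> y) \<in> msq"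
        using Reg.submodule_smult[OF submodule_msq pq(2) \<beta>m(1)] by simp
      moreover have "(\<ominus> p) \<otimes> (A \<otimes> y \<ominus> C \<otimes> x) \<in> msq"
        using Reg.submodule_smult[OF submodule_msq a_inv_closed[OF pq(1)] \<beta>m(2)] by simp
      ultimately show ?thesis using Reg.submodule_add[OF submodule_msq] by simp
    qed
    have sub: "submodule {v \<in> carrier (F 2). f v \<in> {\<zero>\<^bsub>Reg\<^esub>}} R (F 2)"
      by (rule submodule_vimage[OF F_module Reg.module_axioms f F2.carrier_is_submodule Reg.submodule_zero])
    have "mZ 0 \<subseteq> {v \<in> carrier (F 2). f v \<in> {\<zero>\<^bsub>Reg\<^esub>}}"
      unfolding mZ_def b
    proof (rule F2.ideal_mult_least[OF sub])
      fix a v assume a: "a \<in> \<mm>" and v: "v \<in> Z 0"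
      then have vF: "v \<in> carrier (F 2)" by (simp add: Z0)
      then have "f (a \<odot>\<^bsub>F 2\<^esub> v) = \<zero>" using lin_smult[OF f m_carrier[OF a] vF] m_msq[OF a fZ[OF v]] by simp
      then show "a \<odot>\<^bsub>F 2\<^esub> v \<in> {v \<in> carrier (F 2). f v \<in> {\<zero>\<^bsub>Reg\<^esub>}}"
        using F2.smult_closed[OF m_carrier[OF a] vF] by simp
    qed
    then have f0: "f v = \<zero>" if "v \<in> m2F 2" for v using that unfolding mZ0 by auto
    have z: "\<zero> \<in> msq" using Reg.submodule_zero_mem[OF submodule_msq] by simp
    have "x \<otimes> t = \<zero>" using f0[OF m2F2[OF z t(1)]] xy tR by (simp add: f_def pr_simps a_minus_def)
    then have x: "x \<in> \<mm>" by (rule unit[OF xy(1)])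
    have "\<ominus> (y \<otimes> t) = \<zero>" using f0[OF m2F2[OF t(1) z]] xy tR by (simp add: f_def pr_simps a_minus_def)
    then have "y \<otimes> t = \<zero>" using xy tR by (metis m_closed minus_minus minus_zero)
    then have y: "y \<in> \<mm>" by (rule unit[OF xy(2)])
    show ?thesis unfolding xy(3) mF_iff using pr_F[OF xy(1,2)] x y m.zero_closed by (auto simp: pr_def)
  qed
  let ?A = "mZ (Suc 0)"
  have A: "submodule ?A R (F 2)" using submodule_mZ[of "Suc 0"] unfolding b .
  have AW: "submodule (?A \<inter> ?W) R (F 2)" by (rule F2.submodule_Int[OF A W])
  have "interval_length R (F 2) {u \<in> carrier (F 2). \<beta> u \<in> ?A \<inter> ?W} {u \<in> carrier (F 2). \<beta> u \<in> ?W} =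
      interval_length R (F 2) (?A \<inter> ?W) ?W"
    by (rule interval_length_image[OF F_module F_module \<beta> F2.carrier_is_submodule AW]) auto
  moreover have "{u \<in> carrier (F 2). \<beta> u \<in> ?W} = carrier (F 2)" by blast
  \<comment> \<open>By \<open>\<beta>_m2F\<close> this preimage lies in \<open>mF 2\<close>, whose
    quotient has length two. So the image of \<beta> contributes length two modulo
    \<open>mZ 1\<close>, as much as \<open>Z 1\<close> has.\<close>
  moreover have "enat 2 \<le> interval_length R (F 2) {u \<in> carrier (F 2). \<beta> u \<in> ?A \<inter> ?W} (carrier (F 2))"
    unfolding length_F_mod_mF[of 2, symmetric]
    by (rule interval_length_mono) (use \<beta>_m2F in \<open>auto simp: mZ1\<close>)
  ultimately have "enat 2 \<le> interval_length R (F 2) (?A \<inter> ?W) ?W" by simp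
  also have "\<dots> \<le> interval_length R (F 2) ?A (?W <+>\<^bsub>F 2\<^esub> ?A)"
    by (rule F2.interval_length_Int_le[OF A W])
  finally have len_WA: "enat 2 \<le> interval_length R (F 2) ?A (?W <+>\<^bsub>F 2\<^esub> ?A)" .
  have WA: "submodule (?W <+>\<^bsub>F 2\<^esub> ?A) R (F 2)" by (rule F2.submodule_set_add[OF W A])
  have WA_Z: "?W <+>\<^bsub>F 2\<^esub> ?A \<subseteq> Z (Suc 0)" by (rule F2.set_add_least[OF sZ1 W_Z mZ_subset_Z])
  have len_Z: "interval_length R (F 2) ?A (Z (Suc 0)) = enat 2"
    using length_Z_mod_mZ[of "Suc 0"] unfolding b .
  have "interval_length R (F 2) ?A (?W <+>\<^bsub>F 2\<^esub> ?A) \<le> enat 2"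
    unfolding len_Z[symmetric] by (rule interval_length_mono) (use WA_Z in auto)
  then have fin: "interval_length R (F 2) ?A (?W <+>\<^bsub>F 2\<^esub> ?A) \<noteq> \<infinity>" using enat_ile by fastforce
  have WA_eq: "?W <+>\<^bsub>F 2\<^esub> ?A = Z (Suc 0)"
    by (rule F2.interval_length_eq_imp_eq[OF A WA sZ1 F2.subset_set_add(2)[OF W A] WA_Z])
       (use fin len_WA len_Z in simp_all)
  \<comment> \<open>Nakayama in one step: \<open>Z 1\<close> is W + m \<open>Z 1\<close>, and m
    kills m \<open>Z 1\<close> = m^2 F, so m \<open>Z 1\<close> = m W is contained in W.\<close>
  have "?A \<subseteq> ?W"
    unfolding mZ_def[of "Suc 0"] b
  proof (rule F2.ideal_mult_least[OF W])
    fix a v assume a: "a \<in> \<mm>" and v: "v \<in> Z (Suc 0)"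
    then obtain p q where pq: "p \<in> ?W" "q \<in> ?A" "v = p \<oplus>\<^bsub>F 2\<^esub> q"
      unfolding WA_eq[symmetric] by (auto simp: set_add_def')
    have pF: "p \<in> carrier (F 2)" "q \<in> carrier (F 2)"
      using F2.submodule_sub[OF W pq(1)] F2.submodule_sub[OF A pq(2)] .
    have "a \<odot>\<^bsub>F 2\<^esub> q \<in> ideal_mult R \<mm> (F 2) (m2F 2)"
      by (rule F2.ideal_mult_mem[OF a]) (use pq(2) mZ1 in blast)
    then have "a \<odot>\<^bsub>F 2\<^esub> q = \<zero>\<^bsub>F 2\<^esub>" unfolding m_m2F by blast
    then have "a \<odot>\<^bsub>F 2\<^esub> v = a \<odot>\<^bsub>F 2\<^esub> p"
      unfolding pq(3) using pF m_carrier[OF a] by (subst F2.smult_r_distr) (simp_all del: direct_power_simps)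
    then show "a \<odot>\<^bsub>F 2\<^esub> v \<in> ?W" using F2.submodule_smult[OF W m_carrier[OF a] pq(1)] by simp
  qed
  then have W_eq: "?W = Z (Suc 0)" using F2.set_add_least[OF W order_refl] WA_eq W_Z by blast
  let ?K = "{u \<in> carrier (F 2). \<beta> u = \<zero>\<^bsub>F 2\<^esub>}"
  have "submodule {u \<in> carrier (F 2). \<beta> u \<in> {\<zero>\<^bsub>F 2\<^esub>}} R (F 2)"
    by (rule submodule_vimage[OF F_module F_module \<beta> F2.carrier_is_submodule F2.submodule_zero])
  then have K: "submodule ?K R (F 2)" by simp
  have z0: "z 0 = 2 + 2 * sqdim" and z1: "z (Suc 0) = 2 + 2 * sqdim" using z_eq[of 0] z_eq[of "Suc 0"] b c by auto
  have len0: "interval_length R (F 2) {\<zero>\<^bsub>F 2\<^esub>} (Z 0) = enat (2 + 2 * sqdim)"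
    using length_Z[of 0] unfolding b z0 .
  have len1: "interval_length R (F 2) {\<zero>\<^bsub>F 2\<^esub>} (Z (Suc 0)) = enat (2 + 2 * sqdim)"
    using length_Z[of "Suc 0"] unfolding b z1 .
  \<comment> \<open>As \<open>embdim\<close> is \<open>Suc sqdim\<close>, length R is 2 + 2
    \<open>sqdim\<close>. The image of \<beta> takes exactly half the length of \<open>F 2\<close>,
    which leaves the length of \<open>Z 0\<close> for the kernel.\<close>
  have "enat (2 * (2 + 2 * sqdim)) = interval_length R (F 2) {\<zero>\<^bsub>F 2\<^esub>} ?K + enat (2 + 2 * sqdim)"
    using interval_length_rank_nullity[OF F_module F_module \<beta> F2.carrier_is_submodule]
    unfolding W_eq len1 length_F dims(1) by simp
  then have "interval_length R (F 2) {\<zero>\<^bsub>F 2\<^esub>} ?K = enat (2 + 2 * sqdim)"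
    by (cases "interval_length R (F 2) {\<zero>\<^bsub>F 2\<^esub>} ?K") auto
  then have Z0_eq: "Z 0 = ?K"
    using F2.interval_length_eq_imp_eq[OF F2.submodule_zero submodule_Z[of 0, unfolded b] K _ Z0_ker]
      len0 F2.submodule_zero_mem[OF submodule_Z[of 0, unfolded b]] by simp
  have "\<exists>h \<in> linear_maps R (E\<lparr>carrier := \<epsilon> ` carrier (F 2)\<rparr>) (F 2). \<forall>u\<in>carrier (F 2). h (\<epsilon> u) = \<beta> u"
  proof (rule lin_factor[OF F_module E.module_axioms F_module eps(1) \<beta>])
    fix u assume "u \<in> carrier (F 2)" "\<epsilon> u = \<zero>\<^bsub>E\<^esub>"
    then have "u \<in> Z 0" by (simp add: Z0)
    then show "\<beta> u = \<zero>\<^bsub>F 2\<^esub>" unfolding Z0_eq by simp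
  qed
  moreover have "E\<lparr>carrier := \<epsilon> ` carrier (F 2)\<rparr> = E" unfolding eps(2) by simp
  ultimately obtain h where h: "h \<in> linear_maps R E (F 2)" "\<And>u. u \<in> carrier (F 2) \<Longrightarrow> h (\<epsilon> u) = \<beta> u"
    by auto
  show ?thesis
  proof (rule gorenstein_if_embeds[OF h(1)])
    fix v assume v: "v \<in> carrier E" "h v = \<zero>\<^bsub>F 2\<^esub>"
    then obtain u where u: "u \<in> carrier (F 2)" "v = \<epsilon> u" using eps(2) by blast
    then have "u \<in> Z 0" unfolding Z0_eq using h(2)[OF u(1)] v(2) by simp
    then show "v = \<zero>\<^bsub>E\<^esub>" unfolding Z0 using u(2) by simp
  qed
qed

end

section \<open>Assembly of the Betti number cases\<close>

context Ext_vanishing_setup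
begin

lemma gorenstein: "gorenstein R \<mm>"
\<comment> \<open>These cases are Gorenstein directly. Outside them all later Betti numbers are
  positive, and no socle generators occur far out, which is what the arithmetic requires.\<close>
proof (cases "embdim \<le> 1 \<or> b (Suc 0) = 0")
  case True
  then show ?thesis using gorenstein_if_embdim_le_1 gorenstein_if_b1_0 by blast
next
  case False
  then have e: "embdim \<ge> 2" and b1: "b (Suc 0) > 0" by auto
  have pos: "b (Suc n) > 0" for n
    by (induction n) (use b1 betti_pos_Suc in auto)
  have c_eq: "c (Suc k) = b (Suc k) * sqdim" if k: "k \<ge> n0" for k
  proof (rule c_eq_if_no_socle_generator, rule ccontr)
    fix y assume y: "y \<in> carrier (F (b (Suc (Suc k))))" "y \<notin> mF (b (Suc (Suc k)))"
      and my: "\<And>a. a \<in> \<mm> \<Longrightarrow> a \<odot>\<^bsub>F (b (Suc (Suc k)))\<^esub> y \<in> Z (Suc (Suc k))"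
    have "embdim \<le> 1" by (rule embdim_le_1_if_socle_generator[OF _ y my]) (use k in auto)
    then show False using e by simp
  qed
  note numerics = betti_numerics[OF z_eq z_Suc z_0 c_le betti_decreasing c_eq pos e]
  then consider "b 0 \<le> 1"
    | "b 0 = 2" "b 1 = 2" "b 2 = 2" "c 0 = 2 * sqdim" "c 1 = 2 * sqdim" by blast
  then show ?thesis
  proof cases
    case 1
    then show ?thesis by (rule gorenstein_if_b0_le_1)
  next
    case 2
    show ?thesis
      by (rule gorenstein_if_betti_2) (use 2 numerics(1) e in \<open>auto simp: numeral_2_eq_2\<close>)
  qed
qed

end

theorem proposition3p17:
  fixes R :: "('a, 'r) ring_scheme" and \<mm> :: "'a set"
    and E :: "('a, 'e) module" and M :: "('a, 'm) module"
  assumes "noetherian_local_ring R \<mm>"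
    and "\<mm> [^]\<^bsub>ideals_set R\<^esub> (3::nat) = {\<zero>\<^bsub>R\<^esub>}"
    and "injective_hull R (residue_module R \<mm>) E"
    and "module R M" and "finitely_generated R M" and "\<not> zero_module M"
    and "ideal_smult R (\<mm> [^]\<^bsub>ideals_set R\<^esub> (2::nat)) M = {\<zero>\<^bsub>M\<^esub>}"
    and "enat (min_generators R M) \<le> module_length R (M\<lparr>carrier := ideal_smult R \<mm> M\<rparr>)"
    and "\<exists>n. \<forall>i>n. zero_module (Ext R i E M)"
  shows "gorenstein R \<mm>"
proof -
  interpret cube_zero_local_ring R \<mm>
    by (intro cube_zero_local_ring.intro cube_zero_local_ring_axioms.intro assms(1,2))
  interpret cube_zero_injective_hull R \<mm> E
    by unfold_locales (rule assms(3))
  obtain b d \<epsilon> where res: "free_resolution R E (\<lambda>n. {..<b n}) d \<epsilon>"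
    and min: "\<And>n u. u \<in> carrier (F (b (Suc n))) \<Longrightarrow> d n u \<in> mF (b n)"
    using minimal_resolution_exists by blast
  obtain n0 where n0: "\<And>i. i > n0 \<Longrightarrow> zero_module (Ext R i E M)" using assms(9) by blast
  interpret minimal_hull_resolution R \<mm> E b d \<epsilon>
    by (intro minimal_hull_resolution.intro cube_zero_injective_hull_axioms
        minimal_hull_resolution_axioms.intro res min)
  interpret square_zero_module R \<mm> M
    by (intro square_zero_module.intro cube_zero_local_ring_axioms
        square_zero_module_axioms.intro assms(4-8))
  have "Ext_vanishing_setup R \<mm> E b d \<epsilon> M n0"
  proof (intro Ext_vanishing_setup.intro minimal_hull_resolution_axioms square_zero_module_axioms
      Ext_vanishing_setup_axioms.intro)
    \<comment> \<open>The relevant Ext has degree \<open>Suc k\<close>, which is strictly greater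
      than n0 as the vanishing hypothesis demands.\<close>
    fix k f assume k: "k \<ge> n0" and f: "f \<in> linear_maps R (F (b (Suc k))) M"
      and fd: "\<And>u. u \<in> carrier (F (b (Suc (Suc k)))) \<Longrightarrow> f (d (Suc k) u) = \<zero>\<^bsub>M\<^esub>"
    show "\<exists>h \<in> linear_maps R (F (b k)) M. \<forall>u\<in>carrier (F (b (Suc k))). f u = h (d k u)"
      by (rule Ext_zero_imp_coboundary_any_resolution[OF E.module_axioms assms(4) n0 res f fd])
         (use k in auto)
  qed
  then show ?thesis by (rule Ext_vanishing_setup.gorenstein)
qed

end
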